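(* Let $0<\gamma<1$ and set $b=\frac{\gamma}{1-\gamma}$, $a=(1-\gamma)\gamma^{\frac{\gamma}{1-\gamma}}$, $c=\frac b2+1$, $A=\sqrt{2\pi(b+1)}\,(ab)^{-\frac1{b+1}(\frac12-c)}$. Let $\theta_n=[z^{n-1}]\bigl(A(1-z)^{-c}\exp(a(1-z)^{-b})\bigr)$ for $n\ge1$. Then, under $\mathbb{P}_n$ as $n\to\infty$: (a) $\dfrac{L_1}{(\log n)^{1/\gamma}}$ converges in distribution to the constant $(1-\gamma)^{-1/\gamma}$; (b) $R_1,R_2,\dots$ converge weakly to independent Poisson random variables with respective means $\theta_1,\frac{\theta_2}{2},\frac{\theta_3}{3},\dots$.
   Context: For $\sigma\in\mathcal{S}_n$ (permutations of $\{1,\dots,n\}$), $R_j(\sigma)$ is the number of cycles of length $j$ and $L_1(\sigma)$ the length of the cycle containing $1$. Given parameters $\theta_j\ge0$, $h_n=\frac1{n!}\sum_{\sigma\in\mathcal{S}_n}\prod_j\theta_j^{R_j(\sigma)}$ and $\mathbb{P}_n(\sigma)=\frac1{n!h_n}\prod_j\theta_j^{R_j(\sigma)}$. $[z^m]G(z)$ denotes the $m$-th Taylor coefficient of $G$ at $0$. *)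

theory Defs
  imports "HOL-Probability.Probability" "HOL-Combinatorics.Permutations"
begin

definition cyc :: "(nat \<Rightarrow> nat) \<Rightarrow> nat \<Rightarrow> nat set" where
  "cyc \<sigma> i = {(\<sigma> ^^ k) i | k. True}"

definition cycle_count :: "nat \<Rightarrow> (nat \<Rightarrow> nat) \<Rightarrow> nat \<Rightarrow> nat" where
  "cycle_count n \<sigma> j = card {cyc \<sigma> i | i. i \<in> {1..n} \<and> card (cyc \<sigma> i) = j}"

definition L1 :: "(nat \<Rightarrow> nat) \<Rightarrow> nat" where
  "L1 \<sigma> = card (cyc \<sigma> 1)"

definition weight :: "(nat \<Rightarrow> real) \<Rightarrow> nat \<Rightarrow> (nat \<Rightarrow> nat) \<Rightarrow> real" where
  "weight \<theta> n \<sigma> = (\<Prod>j\<in>{1..n}. \<theta> j ^ cycle_count n \<sigma> j)"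

definition hn :: "(nat \<Rightarrow> real) \<Rightarrow> nat \<Rightarrow> real" where
  "hn \<theta> n = (\<Sum>\<sigma> | \<sigma> permutes {1..n}. weight \<theta> n \<sigma>) / fact n"

definition Pn :: "(nat \<Rightarrow> real) \<Rightarrow> nat \<Rightarrow> (nat \<Rightarrow> nat) pmf" where
  "Pn \<theta> n = embed_pmf (\<lambda>\<sigma>. if \<sigma> permutes {1..n} then weight \<theta> n \<sigma> / (fact n * hn \<theta> n) else 0)"

definition taylor_coeff :: "(real \<Rightarrow> real) \<Rightarrow> nat \<Rightarrow> real" where
  "taylor_coeff G m = (deriv ^^ m) G 0 / fact m"

definition genfun :: "real \<Rightarrow> real \<Rightarrow> real" where
  "genfun \<gamma> z =
     (let b = \<gamma> / (1 - \<gamma>);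
          a = (1 - \<gamma>) * \<gamma> powr (\<gamma> / (1 - \<gamma>));
          c = b / 2 + 1;
          A = sqrt (2 * pi * (b + 1)) * (a * b) powr (- (1 / (b + 1)) * (1/2 - c))
      in A * (1 - z) powr (- c) * exp (a * (1 - z) powr (- b)))"

definition theta :: "real \<Rightarrow> nat \<Rightarrow> real" where
  "theta \<gamma> n = taylor_coeff (genfun \<gamma>) (n - 1)"

end

theory Submission
  imports Defs "HOL-Combinatorics.Cycles" "HOL-Complex_Analysis.Complex_Analysis"
    "HOL-Real_Asymp.Real_Asymp"
begin

text \<open>
  Let \<open>h n\<close> be the coefficients of \<open>exp (\<Sum>j. \<theta> j / j * z ^ j)\<close>. Splitting off the cycle of \<open>1\<close> gives
  \<open>P (L1 = j) = \<theta> j * h (n - j) / (n * h n)\<close>, and the joint law of the first \<open>k\<close> cycle counts is a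
  Poisson weight times a ratio of coefficients in which \<open>\<theta> 1, \<dots>, \<theta> k\<close> are suppressed. Both
  limits therefore reduce to \<open>h\<close>, which is studied at the saddle point \<open>r\<close> with
  \<open>(\<Sum>j. \<theta> j * r ^ j) = n\<close>. A Fourier integral in the style of Hayman shows that \<open>h k * r ^ k\<close> is at most
  a constant multiple of \<open>h n * r ^ n\<close> for all \<open>k\<close>, and that \<open>h (n - 1) / h n\<close> tends to \<open>1\<close>; away from
  the positive axis it uses only that \<open>\<theta>\<close> is nondecreasing, i.e. that the factor \<open>(1 - z) powr (- c)\<close>
  has \<open>c \<ge> 1\<close>. Hence the law of \<open>L1\<close> is dominated by a multiple of \<open>\<theta> j * r ^ j / n\<close>,
  which concentrates by a Chernoff bound, since \<open>\<Sum>j. \<theta> j * r ^ j\<close> is explicit.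
\<close>

section \<open>Splitting off a cycle of a permutation\<close>

text \<open>Both limit laws only compare coefficients of one series with each other, so no
  asymptotic formula for them is derived: at a common radius \<open>r\<close> every coefficient is
  at most of order \<open>H / sqrt B\<close>, the \<open>n\<close>-th is at least of that order, and
  its difference from the previous one is smaller by a power of \<open>n\<close>. The common factor
  cancels, so crude integral bounds suffice where a full saddle point analysis would need a Gaussian
  limit. The room for this comes from the size of the saddle point. With
  \<open>r = 1 - 1 / t\<close>, the saddle equation makes \<open>a * t powr b\<close> asymptotic to
  \<open>ln n\<close>, so \<open>t\<close> is only a power of \<open>ln n\<close>. Each further
  moment of the weights \<open>\<theta> j * r ^ j\<close> costs about a factor
  \<open>t powr (b + 1)\<close>, again a power of \<open>ln n\<close>; hence
  \<open>real n powr s\<close> eventually bounds the second moment for any \<open>s > 1\<close>, and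
  \<open>s = 33 / 32\<close> leaves room in the Fourier estimates. The same scale gives the limit of
  \<open>L1\<close>: the weights concentrate near \<open>j = a * b * t powr (b + 1)\<close>, and
  \<open>(b + 1) / b = 1 / \<gamma>\<close> turns this into a multiple of
  \<open>(ln n) powr (1 / \<gamma>)\<close>.\<close>

definition cycle_type :: "nat set \<Rightarrow> (nat \<Rightarrow> nat) \<Rightarrow> nat \<Rightarrow> nat" where
  "cycle_type S \<sigma> j = card {cyc \<sigma> i | i. i \<in> S \<and> card (cyc \<sigma> i) = j}"

text \<open>Deleting a cycle from a permutation of \<open>{1..n}\<close> leaves a permutation of a
  set that need not be an initial segment, so the induction runs over arbitrary ground sets.\<close>

lemma cycle_count_eq_cycle_type: "cycle_count n \<sigma> = cycle_type {1..n} \<sigma>"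
  by (simp add: fun_eq_iff cycle_count_def cycle_type_def)

lemma cyc_eq_range: "cyc \<sigma> i = range (\<lambda>k. (\<sigma> ^^ k) i)"
  by (auto simp: cyc_def)

lemma cyc_self: "i \<in> cyc \<sigma> i"
  by (auto simp: cyc_def intro: exI[of _ 0])

lemma cyc_subset:
  assumes "\<sigma> permutes S" "i \<in> S"
  shows "cyc \<sigma> i \<subseteq> S"
  using assms by (auto simp: cyc_def permutes_in_image[OF permutes_funpow[OF assms(1)]])

lemma funpow_cycle_of_list_nth:
  assumes "distinct l" "i < length l"
  shows "(cycle_of_list l ^^ k) (l ! i) = l ! ((i + k) mod length l)"
proof -
  have "map (cycle_of_list l ^^ k) l ! i = rotate k l ! i"
    using cyclic_rotation[OF assms(1)] by simp
  thus ?thesis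
    using assms by (simp add: nth_rotate add.commute)
qed

section \<open>Composing a cycle with a permutation of the remaining points\<close>

context
  fixes l :: "nat list" and S :: "nat set" and \<tau> :: "nat \<Rightarrow> nat"
  assumes l: "distinct l" "l \<noteq> []" and dj: "set l \<inter> S = {}" and \<tau>: "\<tau> permutes S"
begin

lemma glue_list: "y \<in> set l \<Longrightarrow> (cycle_of_list l \<circ> \<tau>) y = cycle_of_list l y"
  using dj permutes_not_in[OF \<tau>, of y] by (simp add: disjoint_iff)

lemma glue_rest: "y \<in> S \<Longrightarrow> (cycle_of_list l \<circ> \<tau>) y = \<tau> y"
  using dj permutes_in_image[OF \<tau>, of y] id_outside_supp[of "\<tau> y" l] by auto

lemma glue_funpow_list:
  assumes "y \<in> set l"
  shows "((cycle_of_list l \<circ> \<tau>) ^^ k) y = (cycle_of_list l ^^ k) y \<and> (cycle_of_list l ^^ k) y \<in> set l"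
proof (induction k)
  case (Suc k)
  have "(cycle_of_list l) z \<in> set l" if "z \<in> set l" for z
    using cycle_is_surj[OF l(1)] that by blast
  with Suc show ?case using glue_list by simp
qed (use assms in auto)

lemma glue_funpow_rest:
  assumes "y \<in> S"
  shows "((cycle_of_list l \<circ> \<tau>) ^^ k) y = (\<tau> ^^ k) y \<and> (\<tau> ^^ k) y \<in> S"
proof (induction k)
  case (Suc k)
  with Suc show ?case using glue_rest permutes_in_image[OF \<tau>] by simp
qed (use assms in auto)

lemma cyc_glue_list:
  assumes "y \<in> set l"
  shows "cyc (cycle_of_list l \<circ> \<tau>) y = set l"
proof -
  obtain i where i: "i < length l" "y = l ! i" using assms by (metis in_set_conv_nth)
  have "l ! m \<in> range (\<lambda>k. (cycle_of_list l ^^ k) y)" if "m < length l" for m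
  proof -
    \<comment> \<open>The exponent passes the end of the list on the way from \<open>i\<close> to
      \<open>m\<close>, so no case distinction on \<open>i \<le> m\<close> arises.\<close>
    have "(cycle_of_list l ^^ (length l - i + m)) y = l ! m"
      using i that unfolding i(2) funpow_cycle_of_list_nth[OF l(1) i(1)] by simp
    thus ?thesis by (metis rangeI)
  qed
  hence "set l \<subseteq> range (\<lambda>k. (cycle_of_list l ^^ k) y)"
    by (auto simp: in_set_conv_nth)
  thus ?thesis
    using glue_funpow_list[OF assms] by (auto simp: cyc_eq_range)
qed

lemma cyc_glue_rest: "y \<in> S \<Longrightarrow> cyc (cycle_of_list l \<circ> \<tau>) y = cyc \<tau> y"
  using glue_funpow_rest by (auto simp: cyc_eq_range)

lemma glue_permutes: "(cycle_of_list l \<circ> \<tau>) permutes (S \<union> set l)"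
  by (meson permutes_compose permutes_subset[OF \<tau>] permutes_subset[OF cycle_permutes] Un_upper1 Un_upper2)

text \<open>Iterating from the head reproduces the list, so the list can be read back from the
  composed permutation: this is the injectivity behind the bijection in
  \<open>sum_permutes_split_cycle\<close>.\<close>

lemma support_glue:
  "map (\<lambda>i. ((cycle_of_list l \<circ> \<tau>) ^^ i) (hd l)) [0..<length l] = l"
proof (rule nth_equalityI)
  fix i assume "i < length (map (\<lambda>i. ((cycle_of_list l \<circ> \<tau>) ^^ i) (hd l)) [0..<length l])"
  hence i: "i < length l" by simp
  have "((cycle_of_list l \<circ> \<tau>) ^^ i) (hd l) = (cycle_of_list l ^^ i) (l ! 0)"
    using glue_funpow_list[of "hd l"] l by (simp add: hd_conv_nth)
  also have "\<dots> = l ! i"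
    using l i by (subst funpow_cycle_of_list_nth) auto
  finally show "map (\<lambda>i. ((cycle_of_list l \<circ> \<tau>) ^^ i) (hd l)) [0..<length l] ! i = l ! i"
    using i by simp
qed simp

lemma cycle_type_glue:
  assumes "finite S"
  shows "cycle_type (S \<union> set l) (cycle_of_list l \<circ> \<tau>) =
    (cycle_type S \<tau>)(length l := Suc (cycle_type S \<tau> (length l)))"
proof
  fix j
  let ?g = "cycle_of_list l \<circ> \<tau>"
  have *: "{cyc ?g i |i. i \<in> S \<union> set l \<and> card (cyc ?g i) = j} =
    {cyc \<tau> i |i. i \<in> S \<and> card (cyc \<tau> i) = j} \<union> (if j = length l then {set l} else {})"
    (is "?A = ?B \<union> ?C")
  proof (intro equalityI subsetI)
    fix C assume "C \<in> ?A"
    then obtain i where i: "C = cyc ?g i" "i \<in> S \<or> i \<in> set l" "card (cyc ?g i) = j" by auto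
    show "C \<in> ?B \<union> ?C"
    proof (cases "i \<in> S")
      case True thus ?thesis using i cyc_glue_rest by auto
    next
      case False
      hence "C = set l" using i cyc_glue_list by auto
      thus ?thesis using i l by (auto simp: distinct_card)
    qed
  next
    fix C assume "C \<in> ?B \<union> ?C"
    thus "C \<in> ?A"
    proof
      assume "C \<in> ?B" thus ?thesis using cyc_glue_rest by fastforce
    next
      assume "C \<in> ?C"
      hence "C = set l" "j = length l" by (auto split: if_splits)
      moreover have "hd l \<in> set l" using l by simp
      ultimately show ?thesis
        using cyc_glue_list[of "hd l"] l by (auto simp: distinct_card intro!: exI[of _ "hd l"])
    qed
  qed
  have fin: "finite {cyc \<tau> i |i. i \<in> S \<and> card (cyc \<tau> i) = j}"
    using assms by simp
  \<comment> \<open>A cycle of \<tau> counted here contains its starting point in \<open>S\<close>,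
    so the new cycle cannot coincide with an old one and the count really grows.\<close>
  have "set l \<notin> {cyc \<tau> i |i. i \<in> S \<and> card (cyc \<tau> i) = j}"
  proof
    assume "set l \<in> {cyc \<tau> i |i. i \<in> S \<and> card (cyc \<tau> i) = j}"
    then obtain i where "i \<in> S" "set l = cyc \<tau> i" by auto
    thus False using cyc_self[of i \<tau>] dj by auto
  qed
  with fin show "cycle_type (S \<union> set l) ?g j =
      ((cycle_type S \<tau>)(length l := Suc (cycle_type S \<tau> (length l)))) j"
    unfolding cycle_type_def * fun_upd_apply 
    by (cases "j = length l") (simp_all only: card_insert_disjoint Un_insert_right Un_empty_right if_True if_False refl simp_thms)
qed

end

text \<open>Fixing \<open>x\<close> as the head of the list picks one of the rotations that
  represent the same cycle; this makes the pair of cycle and remaining permutation unique.\<close>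

lemma sum_permutes_split_cycle:
  fixes f :: "(nat \<Rightarrow> nat) \<Rightarrow> real"
  assumes S: "finite S" and x: "x \<in> S"
  shows "(\<Sum>\<sigma> | \<sigma> permutes S. f \<sigma>) =
    (\<Sum>l | distinct l \<and> set l \<subseteq> S - {x}. \<Sum>\<tau> | \<tau> permutes (S - set (x # l)). f (cycle_of_list (x # l) \<circ> \<tau>))"
proof -
  let ?L = "{l. distinct l \<and> set l \<subseteq> S - {x}}"
  have finL: "finite ?L"
    using S finite_subset_distinct[of "S - {x}"] by (simp add: conj_commute)
  \<comment> \<open>This is \<sigma> with its cycle through \<open>x\<close> turned into fixed
    points; \<open>semidecomposition\<close> says that it permutes the complement of that
    cycle.\<close>
  let ?R = "\<lambda>\<sigma> y. if y \<in> S - set (support \<sigma> x) then \<sigma> y else y"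
  have hdl: "support \<sigma> x = x # tl (support \<sigma> x)" if "\<sigma> permutes S" for \<sigma>
  proof -
    have "permutation \<sigma>" using that S permutation_permutes by blast
    from least_power_of_permutation(2)[OF this, of x] show ?thesis
      by (simp add: upt_conv_Cons)
  qed
  have "(\<Sum>l\<in>?L. \<Sum>\<tau> | \<tau> permutes (S - set (x # l)). f (cycle_of_list (x # l) \<circ> \<tau>)) =
    (\<Sum>(l,\<tau>)\<in>Sigma ?L (\<lambda>l. {\<tau>. \<tau> permutes (S - set (x # l))}). f (cycle_of_list (x # l) \<circ> \<tau>))"
    using S finL by (subst sum.Sigma) (auto intro!: finite_permutations)
  also have "\<dots> = (\<Sum>\<sigma> | \<sigma> permutes S. f \<sigma>)"
  proof (rule sum.reindex_bij_witness[where
        i = "\<lambda>\<sigma>. (tl (support \<sigma> x), ?R \<sigma>)" and j = "\<lambda>(l,\<tau>). cycle_of_list (x # l) \<circ> \<tau>"], goal_cases)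
    case (1 a)
    then obtain l \<tau> where a: "a = (l, \<tau>)" and l: "distinct l" "set l \<subseteq> S - {x}"
      and \<tau>: "\<tau> permutes (S - set (x # l))" by auto
    let ?l = "x # l" and ?S = "S - set (x # l)"
    have d: "distinct ?l" "?l \<noteq> []" "set ?l \<inter> ?S = {}" using l by auto
    let ?g = "cycle_of_list ?l \<circ> \<tau>"
    have gS: "?g permutes S"
    proof -
      have "?S \<union> set ?l = S" using l x by auto
      thus ?thesis using glue_permutes[OF d \<tau>] by simp
    qed
    have perm: "permutation ?g" using gS S permutation_permutes by blast
    have "length (support ?g x) = card (set (support ?g x))"
      using cycle_of_permutation[OF perm] distinct_card by metis
    also have "set (support ?g x) = cyc ?g x"
      by (simp only: support_set[OF perm] cyc_eq_range)
    also have "\<dots> = set ?l" using cyc_glue_list[OF d \<tau>, of x] by simp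
    finally have lp: "least_power ?g x = length ?l"
      using d(1) by (simp only: distinct_card length_map length_upt diff_zero)
    have supp: "support ?g x = ?l"
      using support_glue[OF d \<tau>] unfolding lp list.sel(1) .
    have "?R ?g = \<tau>"
    proof
      fix y show "?R ?g y = \<tau> y"
        unfolding supp using glue_rest[OF d \<tau>, of y] permutes_not_in[OF \<tau>, of y] by auto
    qed
    thus ?case unfolding a by (simp only: case_prod_conv supp list.sel)
  next
    case (2 a)
    then obtain l \<tau> where a: "a = (l, \<tau>)" and l: "distinct l" "set l \<subseteq> S - {x}"
      and \<tau>: "\<tau> permutes (S - set (x # l))" by auto
    let ?l = "x # l" and ?S = "S - set (x # l)"
    have d: "distinct ?l" "?l \<noteq> []" "set ?l \<inter> ?S = {}" using l by auto
    have "?S \<union> set ?l = S" using l x by auto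
    thus ?case using glue_permutes[OF d \<tau>] a by simp
  next
    case (3 \<sigma>)
    hence \<sigma>: "\<sigma> permutes S" by simp
    have perm: "permutation \<sigma>" using \<sigma> S permutation_permutes by blast
    have "cycle_of_list (support \<sigma> x) (?R \<sigma> y) = \<sigma> y" for y
    proof -
      consider "y \<in> set (support \<sigma> x)" | "y \<in> S - set (support \<sigma> x)" | "y \<notin> S" "y \<notin> set (support \<sigma> x)" by blast
      thus ?thesis
      proof cases
        case 1 thus ?thesis using cycle_restrict[OF perm 1] by simp
      next
        case 2
        have "\<sigma> y \<notin> set (support \<sigma> x)"
          using permutes_in_image[OF semidecomposition[OF \<sigma> S, of x], of y] 2 by auto
        thus ?thesis using 2 id_outside_supp[of "\<sigma> y"] by simp
      next
        case 3
        have "\<sigma> y = y" using 3 permutes_not_in[OF \<sigma>] by blast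
        thus ?thesis using 3 id_outside_supp[of y] by simp
      qed
    qed
    thus ?case using hdl[OF \<sigma>] by (simp add: fun_eq_iff)
  next
    case (4 \<sigma>)
    hence \<sigma>: "\<sigma> permutes S" by simp
    have perm: "permutation \<sigma>" using \<sigma> S permutation_permutes by blast
    have "distinct (x # tl (support \<sigma> x))"
      using cycle_of_permutation[OF perm] hdl[OF \<sigma>] by metis
    moreover have "set (x # tl (support \<sigma> x)) \<subseteq> S"
      unfolding hdl[OF \<sigma>, symmetric] using cyc_subset[OF \<sigma> x]
      by (simp only: support_set[OF perm] cyc_eq_range)
    moreover have "?R \<sigma> permutes (S - set (x # tl (support \<sigma> x)))"
      unfolding hdl[OF \<sigma>, symmetric] using semidecomposition[OF \<sigma> S] .
    ultimately show ?case by auto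
  next
    case (5 a)
    thus ?case by auto
  qed
  finally show ?thesis by simp
qed

text \<open>\<open>cycle_type_mean n F\<close> is the mean of \<open>F\<close> over the cycle types of uniform permutations of \<open>n\<close> points;
  the length of the cycle through a given point is uniform on \<open>{1..n}\<close>.\<close>
fun cycle_type_mean :: "nat \<Rightarrow> ((nat \<Rightarrow> nat) \<Rightarrow> real) \<Rightarrow> real" where
  "cycle_type_mean n F = (if n = 0 then F (\<lambda>_. 0)
     else (\<Sum>j\<in>{1..n}. cycle_type_mean (n - j) (\<lambda>R. F (R(j := Suc (R j))))) / real n)"

declare cycle_type_mean.simps [simp del]

lemma cycle_type_mean_cmult: "cycle_type_mean m (\<lambda>R. c * F R) = c * cycle_type_mean m F"
proof (induction m arbitrary: F rule: less_induct)
  case (less m)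
  show ?case
    unfolding cycle_type_mean.simps[of m "\<lambda>R. c * F R"] cycle_type_mean.simps[of m F]
    using less by (simp add: sum_distrib_left)
qed

text \<open>The product counts lists of \<open>j - 1\<close> distinct elements out of
  \<open>n - 1\<close>, that is, cycles of length \<open>j\<close> through a given point. Together
  with the \<open>(n - j)!\<close> permutations of the rest the total is independent of
  \<open>j\<close>: the cycle length is uniform.\<close>

lemma fact_div_lists:
  assumes "1 \<le> j" "j \<le> n"
  shows "real (\<Prod>{n - 1 - (j - 1) + 1..n - 1}) * fact (n - j) = fact (n - 1)"
proof -
  have "fact (n - 1) = (fact (n - j) :: nat) * \<Prod>{n - j + 1..n - 1}"
  proof -
    have "{1..n - 1} = {1..n - j} \<union> {n - j + 1..n - 1}" using assms by auto
    hence "\<Prod>{1..n - 1} = \<Prod>{1..n - j} * \<Prod>{n - j + 1..n - 1}"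
      by (simp only:) (subst prod.union_disjoint, auto)
    thus ?thesis unfolding fact_prod by simp
  qed
  moreover have "n - 1 - (j - 1) = n - j" using assms by simp
  ultimately show ?thesis by (metis mult.commute of_nat_fact of_nat_mult)
qed

text \<open>Taking the claim for smaller sets as a hypothesis lets one computation serve twice: with
  \<open>g = 1\<close> as the induction step, and afterwards for the joint law of the cycle through
  \<open>x\<close> and the cycle type.\<close>

lemma sum_permutes_cycle_type_aux:
  fixes F :: "(nat \<Rightarrow> nat) \<Rightarrow> real" and g :: "nat \<Rightarrow> real"
  assumes S: "finite S" "x \<in> S" "card S = n"
    and IH: "\<And>T F. finite T \<Longrightarrow> card T < n \<Longrightarrow>
      (\<Sum>\<sigma> | \<sigma> permutes T. F (cycle_type T \<sigma>)) = fact (card T) * cycle_type_mean (card T) F"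
  shows "(\<Sum>\<sigma> | \<sigma> permutes S. g (card (cyc \<sigma> x)) * F (cycle_type S \<sigma>)) =
    fact (n - 1) * (\<Sum>j\<in>{1..n}. g j * cycle_type_mean (n - j) (\<lambda>R. F (R(j := Suc (R j)))))"
proof -
  let ?L = "{l. distinct l \<and> set l \<subseteq> S - {x}}"
  let ?M = "\<lambda>j. cycle_type_mean (n - j) (\<lambda>R. F (R(j := Suc (R j))))"
  have finL: "finite ?L"
    using S finite_subset_distinct[of "S - {x}"] by (simp add: conj_commute)
  have n: "n > 0" using S card_gt_0_iff by blast
  have len: "length l + 1 \<le> n" if "l \<in> ?L" for l
  proof -
    have "length l = card (set l)" using that distinct_card by fastforce
    also have "\<dots> \<le> card (S - {x})" using that S by (intro card_mono) auto
    finally show ?thesis using S n by simp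
  qed
  have "(\<Sum>\<sigma> | \<sigma> permutes S. g (card (cyc \<sigma> x)) * F (cycle_type S \<sigma>)) =
    (\<Sum>l\<in>?L. \<Sum>\<tau> | \<tau> permutes (S - set (x # l)). g (card (cyc (cycle_of_list (x # l) \<circ> \<tau>) x)) *
        F (cycle_type S (cycle_of_list (x # l) \<circ> \<tau>)))"
    by (rule sum_permutes_split_cycle[OF S(1,2)])
  also have "\<dots> = (\<Sum>l\<in>?L. g (Suc (length l)) * (fact (n - Suc (length l)) * ?M (Suc (length l))))"
  proof (rule sum.cong[OF refl])
    fix l assume l: "l \<in> ?L"
    let ?l = "x # l" let ?S = "S - set ?l"
    have d: "distinct ?l" "?l \<noteq> []" "set ?l \<inter> ?S = {}" using l by auto
    have U: "?S \<union> set ?l = S" using l S by auto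
    have cardS: "card ?S = n - Suc (length l)"
      using card_Diff_subset[of "set ?l" S] d(1) U S distinct_card[OF d(1)] by auto
    have "g (card (cyc (cycle_of_list ?l \<circ> \<tau>) x)) * F (cycle_type S (cycle_of_list ?l \<circ> \<tau>)) =
      g (Suc (length l)) * F ((cycle_type ?S \<tau>)(Suc (length l) := Suc (cycle_type ?S \<tau> (Suc (length l)))))"
      if \<tau>: "\<tau> permutes ?S" for \<tau>
    proof -
      have "cyc (cycle_of_list ?l \<circ> \<tau>) x = set ?l" by (rule cyc_glue_list[OF d \<tau>]) simp
      hence c: "card (cyc (cycle_of_list ?l \<circ> \<tau>) x) = Suc (length l)"
        using distinct_card[OF d(1)] by simp
      have "cycle_type S (cycle_of_list ?l \<circ> \<tau>) =
        (cycle_type ?S \<tau>)(length ?l := Suc (cycle_type ?S \<tau> (length ?l)))"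
        using cycle_type_glue[OF d \<tau>] S unfolding U by simp
      with c show ?thesis by simp
    qed
    hence "(\<Sum>\<tau> | \<tau> permutes ?S. g (card (cyc (cycle_of_list ?l \<circ> \<tau>) x)) *
        F (cycle_type S (cycle_of_list ?l \<circ> \<tau>))) =
      g (Suc (length l)) * (\<Sum>\<tau> | \<tau> permutes ?S.
        F ((cycle_type ?S \<tau>)(Suc (length l) := Suc (cycle_type ?S \<tau> (Suc (length l))))))"
      by (simp add: sum_distrib_left)
    also have "(\<Sum>\<tau> | \<tau> permutes ?S.
        F ((cycle_type ?S \<tau>)(Suc (length l) := Suc (cycle_type ?S \<tau> (Suc (length l)))))) =
      fact (n - Suc (length l)) * ?M (Suc (length l))"
      using IH[of ?S "\<lambda>R. F (R(Suc (length l) := Suc (R (Suc (length l)))))"] S n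
      unfolding cardS by simp
    finally show "(\<Sum>\<tau> | \<tau> permutes ?S. g (card (cyc (cycle_of_list ?l \<circ> \<tau>) x)) *
        F (cycle_type S (cycle_of_list ?l \<circ> \<tau>))) =
      g (Suc (length l)) * (fact (n - Suc (length l)) * ?M (Suc (length l)))" .
  qed
  also have "\<dots> = (\<Sum>j\<in>{1..n}. \<Sum>l\<in>{l\<in>?L. Suc (length l) = j}. g (Suc (length l)) * (fact (n - Suc (length l)) * ?M (Suc (length l))))"
    using len finL by (subst sum.group) (auto simp: Suc_le_eq)
  also have "\<dots> = (\<Sum>j\<in>{1..n}. fact (n - 1) * (g j * ?M j))"
  proof (rule sum.cong[OF refl])
    fix j assume j: "j \<in> {1..n}"
    have *: "{l\<in>?L. Suc (length l) = j} = {l. length l = j - 1 \<and> distinct l \<and> set l \<subseteq> S - {x}}"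
      using j by auto
    have "card {l\<in>?L. Suc (length l) = j} = \<Prod>{n - 1 - (j - 1) + 1..n - 1}"
    proof -
      have "card (S - {x}) = n - 1" "j - 1 \<le> n - 1" using S j by auto
      thus ?thesis
        unfolding * using card_lists_distinct_length_eq[of "S - {x}" "j - 1"] S(1) by simp
    qed
    hence "real (card {l\<in>?L. Suc (length l) = j}) * fact (n - j) = fact (n - 1)"
      using fact_div_lists[of j n] j by simp
    moreover have "(\<Sum>l\<in>{l\<in>?L. Suc (length l) = j}. g (Suc (length l)) * (fact (n - Suc (length l)) * ?M (Suc (length l)))) =
      (\<Sum>l\<in>{l\<in>?L. Suc (length l) = j}. g j * (fact (n - j) * ?M j))"
      by (rule sum.cong) auto
    moreover have "\<dots> = g j * (real (card {l\<in>?L. Suc (length l) = j}) * fact (n - j)) * ?M j"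
      by (simp only: sum_constant mult_ac)
    ultimately show "(\<Sum>l\<in>{l\<in>?L. Suc (length l) = j}. g (Suc (length l)) * (fact (n - Suc (length l)) * ?M (Suc (length l)))) =
      fact (n - 1) * (g j * ?M j)"
      by (simp only: mult_ac)
  qed
  finally show ?thesis by (simp add: sum_distrib_left)
qed

lemma sum_permutes_cycle_type:
  fixes F :: "(nat \<Rightarrow> nat) \<Rightarrow> real"
  assumes "finite S"
  shows "(\<Sum>\<sigma> | \<sigma> permutes S. F (cycle_type S \<sigma>)) = fact (card S) * cycle_type_mean (card S) F"
  using assms
proof (induction "card S" arbitrary: S F rule: less_induct)
  case less
  show ?case
  proof (cases "S = {}")
    case True
    have "cycle_type {} \<sigma> = (\<lambda>_. 0)" for \<sigma>
      by (simp add: cycle_type_def fun_eq_iff)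
    thus ?thesis using True by (simp add: cycle_type_mean.simps)
  next
    case False
    then obtain x where x: "x \<in> S" by blast
    have n: "card S > 0" using x less.prems card_gt_0_iff by blast
    have "(\<Sum>\<sigma> | \<sigma> permutes S. (\<lambda>_. 1) (card (cyc \<sigma> x)) * F (cycle_type S \<sigma>)) =
      fact (card S - 1) * (\<Sum>j\<in>{1..card S}. 1 * cycle_type_mean (card S - j) (\<lambda>R. F (R(j := Suc (R j)))))"
      by (rule sum_permutes_cycle_type_aux[OF less.prems x refl]) (use less.hyps in auto)
    thus ?thesis using n
      by (simp add: cycle_type_mean.simps[of "card S"] fact_reduce[of "card S"])
  qed
qed

lemma sum_permutes_cyc_cycle_type:
  fixes F :: "(nat \<Rightarrow> nat) \<Rightarrow> real" and g :: "nat \<Rightarrow> real"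
  assumes "finite S" "x \<in> S"
  shows "(\<Sum>\<sigma> | \<sigma> permutes S. g (card (cyc \<sigma> x)) * F (cycle_type S \<sigma>)) =
    fact (card S - 1) * (\<Sum>j\<in>{1..card S}. g j * cycle_type_mean (card S - j) (\<lambda>R. F (R(j := Suc (R j)))))"
  using assms sum_permutes_cycle_type by (intro sum_permutes_cycle_type_aux) auto

section \<open>Cycle statistics of weighted permutations\<close>

text \<open>Comparing coefficients in \<open>z * F' = (\<Sum>j. \<theta> j * z ^ j) * F\<close> for
  \<open>F = exp (\<Sum>j. \<theta> j / j * z ^ j)\<close> gives this recursion. It presupposes no
  convergence and has the shape of \<open>cycle_type_mean\<close>.\<close>

fun exp_coeff :: "(nat \<Rightarrow> real) \<Rightarrow> nat \<Rightarrow> real" where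
  "exp_coeff \<theta> n = (if n = 0 then 1 else (\<Sum>j\<in>{1..n}. \<theta> j * exp_coeff \<theta> (n - j)) / real n)"

declare exp_coeff.simps [simp del]

lemma exp_coeff_0 [simp]: "exp_coeff \<theta> 0 = 1"
  by (simp add: exp_coeff.simps)

lemma exp_coeff_rec: "real n * exp_coeff \<theta> n = (\<Sum>j\<in>{1..n}. \<theta> j * exp_coeff \<theta> (n - j))" if "n > 0"
  using that by (simp add: exp_coeff.simps[of \<theta> n])

lemma exp_coeff_nonneg: "(\<And>j. j \<ge> 1 \<Longrightarrow> \<theta> j \<ge> 0) \<Longrightarrow> exp_coeff \<theta> n \<ge> 0"
proof (induction n rule: less_induct)
  case (less n)
  show ?case
  proof (cases "n = 0")
    case False
    thus ?thesis unfolding exp_coeff.simps[of \<theta> n]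
      using less by (auto intro!: divide_nonneg_nonneg sum_nonneg mult_nonneg_nonneg)
  qed simp
qed

lemma exp_coeff_pos:
  assumes "\<And>j. j \<ge> 1 \<Longrightarrow> \<theta> j \<ge> 0" "\<theta> 1 > 0"
  shows "exp_coeff \<theta> n > 0"
proof (induction n)
  case (Suc n)
  have "\<theta> 1 * exp_coeff \<theta> (Suc n - 1) \<le> (\<Sum>j\<in>{1..Suc n}. \<theta> j * exp_coeff \<theta> (Suc n - j))"
    using assms exp_coeff_nonneg[OF assms(1)] by (intro member_le_sum) auto
  moreover have "0 < \<theta> 1 * exp_coeff \<theta> (Suc n - 1)"
    using Suc assms by simp
  ultimately have "0 < (\<Sum>j\<in>{1..Suc n}. \<theta> j * exp_coeff \<theta> (Suc n - j))"
    by linarith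
  thus ?case by (simp add: exp_coeff.simps[of \<theta> "Suc n"])
qed simp

lemma exp_coeff_cong:
  "(\<And>j. 1 \<le> j \<Longrightarrow> \<theta> j = \<theta>' j) \<Longrightarrow> exp_coeff \<theta> n = exp_coeff \<theta>' n"
proof (induction n rule: less_induct)
  case (less n)
  thus ?case unfolding exp_coeff.simps[of \<theta> n] exp_coeff.simps[of \<theta>' n] by auto
qed

text \<open>The bound \<open>N\<close> of the product stays fixed while the number of points shrinks
  along the recursion; \<open>k = 0\<close> removes the constraint and leaves the plain
  weight.\<close>

definition type_weight :: "(nat \<Rightarrow> real) \<Rightarrow> nat \<Rightarrow> nat \<Rightarrow> (nat \<Rightarrow> nat) \<Rightarrow> (nat \<Rightarrow> nat) \<Rightarrow> real" where
  "type_weight \<theta> N k r R = (if \<forall>j\<in>{1..k}. R j = r j then \<Prod>j\<in>{1..N}. \<theta> j ^ R j else 0)"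

text \<open>A new cycle of length at most \<open>k\<close> uses up one of the \<open>r j\<close>
  prescribed cycles, so the prescription drops by one, and nothing survives if none was
  prescribed.\<close>

lemma type_weight_incr:
  assumes "1 \<le> j" "j \<le> N"
  shows "type_weight \<theta> N k r (R(j := Suc (R j))) =
    (if j > k then \<theta> j * type_weight \<theta> N k r R
     else if r j = 0 then 0 else \<theta> j * type_weight \<theta> N k (r(j := r j - 1)) R)"
proof -
  have "(\<Prod>i\<in>{1..N}. \<theta> i ^ (R(j := Suc (R j))) i) = \<theta> j * (\<Prod>i\<in>{1..N}. \<theta> i ^ R i)"
  proof -
    have "(\<Prod>i\<in>{1..N}. \<theta> i ^ (R(j := Suc (R j))) i) = (\<Prod>i\<in>{1..N}. (if i = j then \<theta> j else 1) * \<theta> i ^ R i)"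
      by (rule prod.cong) auto
    also have "\<dots> = \<theta> j * (\<Prod>i\<in>{1..N}. \<theta> i ^ R i)"
      using assms by (simp add: prod.distrib)
    finally show ?thesis .
  qed
  moreover have "(\<forall>i\<in>{1..k}. (R(j := Suc (R j))) i = r i) \<longleftrightarrow>
    (if j > k then (\<forall>i\<in>{1..k}. R i = r i)
     else r j \<noteq> 0 \<and> (\<forall>i\<in>{1..k}. R i = (r(j := r j - 1)) i))"
    using assms by auto
  ultimately show ?thesis unfolding type_weight_def by auto
qed

text \<open>Joint Poisson weights without the factors \<open>exp (- \<theta> j / j)\<close>; those
  emerge only in the limit, from the ratio of truncated to full coefficients.\<close>

definition poisson_coeff :: "(nat \<Rightarrow> real) \<Rightarrow> nat \<Rightarrow> (nat \<Rightarrow> nat) \<Rightarrow> real" where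
  "poisson_coeff \<theta> k r = (\<Prod>j\<in>{1..k}. (\<theta> j / real j) ^ r j / fact (r j))"

lemma poisson_coeff_decr:
  assumes "j \<in> {1..k}" "r j > 0"
  shows "\<theta> j * poisson_coeff \<theta> k (r(j := r j - 1)) = real j * real (r j) * poisson_coeff \<theta> k r"
proof -
  let ?f = "\<lambda>r j. (\<theta> j / real j) ^ r j / (fact (r j) :: real)"
  have *: "poisson_coeff \<theta> k r = ?f r j * (\<Prod>i\<in>{1..k} - {j}. ?f r i)" for r :: "nat \<Rightarrow> nat"
    unfolding poisson_coeff_def using assms by (subst prod.remove[of _ j]) auto
  have "(\<Prod>i\<in>{1..k} - {j}. ?f (r(j := r j - 1)) i) = (\<Prod>i\<in>{1..k} - {j}. ?f r i)"
    by (rule prod.cong) auto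
  moreover have "\<theta> j * ?f (r(j := r j - 1)) j = real j * real (r j) * ?f r j"
  proof -
    obtain m where m: "r j = Suc m" using assms by (cases "r j") auto
    have "(fact (Suc m) :: real) = real (Suc m) * fact m" by simp
    moreover have "real j > 0" using assms by simp
    ultimately show ?thesis unfolding fun_upd_same m
      by (simp add: divide_simps del: of_nat_Suc fact_Suc)
  qed
  ultimately show ?thesis unfolding * by (simp only: mult.assoc[symmetric])
qed

text \<open>Both sides satisfy the same recursion: on the right, \<open>n\<close> splits as \<open>s + (n - s)\<close>, where the summand \<open>s\<close>
  comes from cycles of length at most \<open>k\<close>.\<close>
lemma cycle_type_mean_type_weight:
  assumes "n \<le> N" "k \<le> N"
  shows "cycle_type_mean n (type_weight \<theta> N k r) =
    (let s = \<Sum>j\<in>{1..k}. j * r j in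
     if s \<le> n then poisson_coeff \<theta> k r * exp_coeff (\<lambda>j. if j \<le> k then 0 else \<theta> j) (n - s) else 0)"
  using assms
proof (induction n arbitrary: r rule: less_induct)
  case (less n)
  define s where "s = (\<lambda>r::nat\<Rightarrow>nat. \<Sum>j\<in>{1..k}. j * r j)"
  define e where "e = exp_coeff (\<lambda>j. if j \<le> k then 0 else \<theta> j)"
  define V where "V = (\<lambda>n r. if s r \<le> n then poisson_coeff \<theta> k r * e (n - s r) else 0)"
  have IH: "cycle_type_mean m (type_weight \<theta> N k r) = V m r" if "m < n" for m r
    using less.IH[of m r] that less.prems unfolding V_def s_def e_def Let_def by simp
  have "cycle_type_mean n (type_weight \<theta> N k r) = V n r"
  proof (cases "n = 0")
    case True
    have "s r = 0 \<longleftrightarrow> (\<forall>j\<in>{1..k}. r j = 0)" by (auto simp: s_def)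
    moreover have "poisson_coeff \<theta> k r = 1" if "\<forall>j\<in>{1..k}. r j = 0"
      using that by (simp add: poisson_coeff_def)
    moreover have "(\<forall>j\<in>{1..k}. 0 = r j) \<longleftrightarrow> (\<forall>j\<in>{1..k}. r j = 0)" by (metis)
    ultimately show ?thesis
      using True by (auto simp: V_def cycle_type_mean.simps type_weight_def e_def)
  next
    case False
    have step: "cycle_type_mean (n - j) (\<lambda>R. type_weight \<theta> N k r (R(j := Suc (R j)))) =
      (if j > k then \<theta> j * V (n - j) r else if r j = 0 then 0 else \<theta> j * V (n - j) (r(j := r j - 1)))"
      if j: "j \<in> {1..n}" for j
    proof -
      have zero: "cycle_type_mean m (\<lambda>R. 0) = 0" for m
        using cycle_type_mean_cmult[of m 0 "\<lambda>_. 0"] by simp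
      have "(\<lambda>R. type_weight \<theta> N k r (R(j := Suc (R j)))) =
        (if j > k then (\<lambda>R. \<theta> j * type_weight \<theta> N k r R)
         else if r j = 0 then (\<lambda>R. 0) else (\<lambda>R. \<theta> j * type_weight \<theta> N k (r(j := r j - 1)) R))"
        using type_weight_incr[of j N \<theta> k r] j less.prems by (auto simp: fun_eq_iff)
      thus ?thesis using j IH by (auto simp: cycle_type_mean_cmult zero)
    qed
    have sdec: "s r = s (r(j := r j - 1)) + j" if "j \<in> {1..k}" "r j > 0" for j
    proof -
      have "s r = j * r j + (\<Sum>i\<in>{1..k} - {j}. i * r i)" for r
        unfolding s_def using that by (subst sum.remove[of _ j]) auto
      moreover have "(\<Sum>i\<in>{1..k} - {j}. i * (r(j := r j - 1)) i) = (\<Sum>i\<in>{1..k} - {j}. i * r i)"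
        by (rule sum.cong) auto
      moreover have "j * r j = j * (r j - 1) + j"
        using that by (metis Suc_diff_1 mult_Suc_right add.commute)
      ultimately show ?thesis by simp
    qed
    have small: "\<theta> j * V (n - j) (r(j := r j - 1)) = (if s r \<le> n then real j * real (r j) * poisson_coeff \<theta> k r * e (n - s r) else 0)"
      if "j \<in> {1..k}" "r j > 0" "j \<le> n" for j
    proof -
      have "s (r(j := r j - 1)) \<le> n - j \<longleftrightarrow> s r \<le> n" "n - j - s (r(j := r j - 1)) = n - s r"
        using sdec[OF that(1,2)] that(3) by auto
      thus ?thesis using poisson_coeff_decr[of j k r \<theta>] that
        unfolding V_def by (simp add: mult.assoc[symmetric])
    qed
    have "real n * cycle_type_mean n (type_weight \<theta> N k r) =
       (\<Sum>j\<in>{1..n}. cycle_type_mean (n - j) (\<lambda>R. type_weight \<theta> N k r (R(j := Suc (R j)))))"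
      using False by (simp add: cycle_type_mean.simps[of n])
    also have "\<dots> = (\<Sum>j\<in>{1..n}. (if j > k then \<theta> j * V (n - j) r else
        if s r \<le> n then real j * real (r j) * poisson_coeff \<theta> k r * e (n - s r) else 0))"
      by (rule sum.cong[OF refl]) (auto simp: step small[unfolded One_nat_def])
    also have "\<dots> = real n * V n r"
    proof (cases "s r \<le> n")
      case False
      hence V0: "V (n - j) r = 0" "V n r = 0" for j by (auto simp: V_def)
      show ?thesis unfolding V0 using False by (auto intro!: sum.neutral)
    next
      case True
      \<comment> \<open>Since \<open>k\<close> may exceed \<open>n\<close>, the prescriptions beyond
        \<open>n\<close> must be seen to vanish before the sum over \<open>{1..n}\<close> can yield
        all of \<open>s r\<close>.\<close>
      have rk: "r j = 0" if "j \<in> {1..k}" "j > n" for j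
      proof (rule ccontr)
        assume "r j \<noteq> 0"
        hence "j \<le> j * r j" by simp
        also have "\<dots> \<le> s r" unfolding s_def using that by (intro member_le_sum) auto
        finally show False using that True by simp
      qed
      have "(\<Sum>j\<in>{1..n}. (if j > k then \<theta> j * V (n - j) r else real j * real (r j) * poisson_coeff \<theta> k r * e (n - s r))) =
        (\<Sum>j\<in>{1..n}. (if j > k then \<theta> j * V (n - j) r else 0)) +
        (\<Sum>j\<in>{1..n}. (if j > k then 0 else real j * real (r j))) * poisson_coeff \<theta> k r * e (n - s r)"
        unfolding sum_distrib_right sum.distrib[symmetric] by (rule sum.cong) auto
      also have "(\<Sum>j\<in>{1..n}. (if j > k then 0 else real j * real (r j))) = real (s r)"
      proof -
        have "(\<Sum>j\<in>{1..n}. (if j > k then 0 else real j * real (r j))) = (\<Sum>j\<in>{1..n} \<inter> {1..k}. real j * real (r j))"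
          by (subst sum.inter_restrict) (auto intro!: sum.cong)
        also have "\<dots> = (\<Sum>j\<in>{1..k}. real j * real (r j))"
          by (rule sum.mono_neutral_left) (use rk in auto)
        finally show ?thesis by (simp add: s_def)
      qed
      also have "(\<Sum>j\<in>{1..n}. (if j > k then \<theta> j * V (n - j) r else 0)) =
        poisson_coeff \<theta> k r * (real (n - s r) * e (n - s r))"
      \<comment> \<open>The recursion of \<open>exp_coeff\<close> is available only at a positive
        index; at index \<open>0\<close> no long cycle fits any more and both sides vanish.\<close>
      proof (cases "n - s r = 0")
        case t: True
        have "V (n - j) r = 0" if "j \<in> {1..n}" for j
          using that t True by (auto simp: V_def)
        hence "(\<Sum>j\<in>{1..n}. (if j > k then \<theta> j * V (n - j) r else 0)) = 0"
          by (intro sum.neutral) auto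
        thus ?thesis using t by simp
      next
        case False
        have "real (n - s r) * e (n - s r) = (\<Sum>j\<in>{1..n - s r}. (if j \<le> k then 0 else \<theta> j) * e (n - s r - j))"
          unfolding e_def by (rule exp_coeff_rec) (use False in auto)
        hence "poisson_coeff \<theta> k r * (real (n - s r) * e (n - s r)) =
          (\<Sum>j\<in>{1..n - s r}. poisson_coeff \<theta> k r * ((if j \<le> k then 0 else \<theta> j) * e (n - s r - j)))"
          by (simp add: sum_distrib_left)
        also have "\<dots> = (\<Sum>j\<in>{1..n - s r}. (if j > k then \<theta> j * V (n - j) r else 0))"
        proof (rule sum.cong[OF refl])
          fix j assume "j \<in> {1..n - s r}"
          hence "s r \<le> n - j" "n - s r - j = n - j - s r" by auto
          thus "poisson_coeff \<theta> k r * ((if j \<le> k then 0 else \<theta> j) * e (n - s r - j)) = (if j > k then \<theta> j * V (n - j) r else 0)"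
            by (auto simp: V_def)
        qed
        also have "\<dots> = (\<Sum>j\<in>{1..n}. (if j > k then \<theta> j * V (n - j) r else 0))"
        proof (rule sum.mono_neutral_left)
          show "\<forall>i\<in>{1..n} - {1..n - s r}. (if k < i then \<theta> i * V (n - i) r else 0) = 0"
            using True by (auto simp: V_def)
        qed auto
        finally show ?thesis by simp
      qed
      finally show ?thesis
        using True by (simp add: V_def algebra_simps of_nat_diff cong: if_cong)
    qed
    finally show ?thesis using False by simp
  qed
  thus ?case by (simp add: V_def s_def e_def Let_def)
qed

section \<open>The weighted measure: normalisation, law of \<open>L1\<close>, joint law of small
  cycle counts\<close>

lemma weight_eq_type_weight:
  "weight \<theta> n \<sigma> = type_weight \<theta> n 0 r (cycle_type {1..n} \<sigma>)"
  by (simp add: weight_def type_weight_def cycle_count_eq_cycle_type)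

lemma hn_eq_exp_coeff: "hn \<theta> n = exp_coeff \<theta> n"
proof -
  have "(\<Sum>\<sigma> | \<sigma> permutes {1..n}. weight \<theta> n \<sigma>) = fact n * cycle_type_mean n (type_weight \<theta> n 0 (\<lambda>_. 0))"
    unfolding weight_eq_type_weight[where r = "\<lambda>_. 0"]
    using sum_permutes_cycle_type[of "{1..n}"] by simp
  also have "cycle_type_mean n (type_weight \<theta> n 0 (\<lambda>_. 0)) = exp_coeff (\<lambda>j. if j \<le> 0 then 0 else \<theta> j) n"
    by (subst cycle_type_mean_type_weight) (auto simp: poisson_coeff_def)
  also have "\<dots> = exp_coeff \<theta> n" by (rule exp_coeff_cong) auto
  finally show ?thesis by (simp add: hn_def)
qed

context
  fixes \<theta> :: "nat \<Rightarrow> real"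
  assumes nonneg: "\<And>j. j \<ge> 1 \<Longrightarrow> \<theta> j \<ge> 0" and pos: "\<theta> 1 > 0"
begin

lemma weight_nonneg: "weight \<theta> n \<sigma> \<ge> 0"
  unfolding weight_def using nonneg by (intro prod_nonneg) auto

text \<open>\<open>embed_pmf\<close> returns the given weights only if they are nonnegative with
  total mass \<open>1\<close>; this rests on \<open>hn \<theta> n > 0\<close>, a consequence of
  \<open>\<theta> 1 > 0\<close>.\<close>

lemma pmf_Pn:
  "pmf (Pn \<theta> n) \<sigma> = (if \<sigma> permutes {1..n} then weight \<theta> n \<sigma> / (fact n * exp_coeff \<theta> n) else 0)"
proof -
  let ?f = "\<lambda>\<sigma>. if \<sigma> permutes {1..n} then weight \<theta> n \<sigma> / (fact n * hn \<theta> n) else 0"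
  have h: "hn \<theta> n > 0" unfolding hn_eq_exp_coeff using nonneg pos by (rule exp_coeff_pos)
  have nn: "?f \<sigma> \<ge> 0" for \<sigma> using weight_nonneg h by simp
  have fin: "finite {\<sigma>. \<sigma> permutes {1..n}}" by (simp add: finite_permutations)
  have "(\<integral>\<^sup>+\<sigma>. ennreal (?f \<sigma>) \<partial>count_space UNIV) = (\<Sum>\<sigma> | \<sigma> permutes {1..n}. ennreal (?f \<sigma>))"
    by (rule nn_integral_count_space'[OF fin]) auto
  also have "\<dots> = ennreal (\<Sum>\<sigma> | \<sigma> permutes {1..n}. ?f \<sigma>)"
    by (rule sum_ennreal) (rule nn)
  also have "(\<Sum>\<sigma> | \<sigma> permutes {1..n}. ?f \<sigma>) = (\<Sum>\<sigma> | \<sigma> permutes {1..n}. weight \<theta> n \<sigma>) / (fact n * hn \<theta> n)"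
    by (simp add: sum_divide_distrib)
  also have "(\<Sum>\<sigma> | \<sigma> permutes {1..n}. weight \<theta> n \<sigma>) = fact n * hn \<theta> n"
    by (simp add: hn_def)
  also have "fact n * hn \<theta> n / (fact n * hn \<theta> n) = 1" using h by simp
  finally have "(\<integral>\<^sup>+\<sigma>. ennreal (?f \<sigma>) \<partial>count_space UNIV) = 1" by simp
  from pmf_embed_pmf[of ?f, OF nn this] show ?thesis
    unfolding Pn_def hn_eq_exp_coeff by simp
qed

lemma prob_Pn:
  "measure_pmf.prob (Pn \<theta> n) A =
    (\<Sum>\<sigma> | \<sigma> permutes {1..n}. (if \<sigma> \<in> A then weight \<theta> n \<sigma> else 0)) / (fact n * exp_coeff \<theta> n)"
proof -
  have fin: "finite {\<sigma>. \<sigma> permutes {1..n}}" by (simp add: finite_permutations)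
  have "measure_pmf.prob (Pn \<theta> n) A = measure_pmf.prob (Pn \<theta> n) (A \<inter> set_pmf (Pn \<theta> n))"
    by (simp add: measure_Int_set_pmf)
  also have "\<dots> = measure_pmf.prob (Pn \<theta> n) (A \<inter> {\<sigma>. \<sigma> permutes {1..n}} \<inter> set_pmf (Pn \<theta> n))"
    by (rule arg_cong[of _ _ "measure_pmf.prob (Pn \<theta> n)"]) (auto simp: set_pmf_iff pmf_Pn split: if_splits)
  also have "\<dots> = measure_pmf.prob (Pn \<theta> n) (A \<inter> {\<sigma>. \<sigma> permutes {1..n}})"
    by (simp add: measure_Int_set_pmf)
  also have "\<dots> = (\<Sum>\<sigma>\<in>{\<sigma>. \<sigma> permutes {1..n}} \<inter> A. pmf (Pn \<theta> n) \<sigma>)"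
    using fin by (subst measure_measure_pmf_finite) (auto simp: Int_commute)
  also have "\<dots> = (\<Sum>\<sigma> | \<sigma> permutes {1..n}. (if \<sigma> \<in> A then weight \<theta> n \<sigma> else 0) / (fact n * exp_coeff \<theta> n))"
    using fin by (subst sum.inter_restrict) (auto simp: pmf_Pn intro!: sum.cong)
  finally show ?thesis by (simp add: sum_divide_distrib)
qed

lemma prob_L1:
  assumes "n > 0"
  shows "measure_pmf.prob (Pn \<theta> n) {\<sigma>. L1 \<sigma> \<in> B} =
    (\<Sum>j\<in>{1..n}. if j \<in> B then \<theta> j * exp_coeff \<theta> (n - j) else 0) / (real n * exp_coeff \<theta> n)"
proof -
  have "(\<Sum>\<sigma> | \<sigma> permutes {1..n}. (if \<sigma> \<in> {\<sigma>. L1 \<sigma> \<in> B} then weight \<theta> n \<sigma> else 0)) =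
    (\<Sum>\<sigma> | \<sigma> permutes {1..n}. (if card (cyc \<sigma> 1) \<in> B then 1 else 0) * type_weight \<theta> n 0 (\<lambda>_. 0) (cycle_type {1..n} \<sigma>))"
    by (rule sum.cong) (auto simp: L1_def weight_eq_type_weight[where r = "\<lambda>_. 0"])
  also have "\<dots> = fact (n - 1) * (\<Sum>j\<in>{1..n}. (if j \<in> B then 1 else 0) *
      cycle_type_mean (n - j) (\<lambda>R. type_weight \<theta> n 0 (\<lambda>_. 0) (R(j := Suc (R j)))))"
    using sum_permutes_cyc_cycle_type[of "{1..n}" 1 "\<lambda>j. if j \<in> B then 1 else 0" "type_weight \<theta> n 0 (\<lambda>_. 0)"] assms
    by simp
  also have "(\<Sum>j\<in>{1..n}. (if j \<in> B then 1 else 0) *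
      cycle_type_mean (n - j) (\<lambda>R. type_weight \<theta> n 0 (\<lambda>_. 0) (R(j := Suc (R j))))) =
    (\<Sum>j\<in>{1..n}. if j \<in> B then \<theta> j * exp_coeff \<theta> (n - j) else 0)"
  proof (rule sum.cong[OF refl])
    fix j assume j: "j \<in> {1..n}"
    have "cycle_type_mean (n - j) (\<lambda>R. type_weight \<theta> n 0 (\<lambda>_. 0) (R(j := Suc (R j)))) =
      cycle_type_mean (n - j) (\<lambda>R. \<theta> j * type_weight \<theta> n 0 (\<lambda>_. 0) R)"
      using j by (subst type_weight_incr) auto
    also have "\<dots> = \<theta> j * exp_coeff (\<lambda>j. if j \<le> 0 then 0 else \<theta> j) (n - j)"
      unfolding cycle_type_mean_cmult by (subst cycle_type_mean_type_weight) (auto simp: poisson_coeff_def)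
    also have "exp_coeff (\<lambda>j. if j \<le> 0 then 0 else \<theta> j) (n - j) = exp_coeff \<theta> (n - j)"
      by (rule exp_coeff_cong) auto
    finally show "(if j \<in> B then 1 else 0) * cycle_type_mean (n - j) (\<lambda>R. type_weight \<theta> n 0 (\<lambda>_. 0) (R(j := Suc (R j)))) =
      (if j \<in> B then \<theta> j * exp_coeff \<theta> (n - j) else 0)" by (simp del: fun_upd_apply)
  qed
  finally show ?thesis
    unfolding prob_Pn using assms by (simp add: fact_reduce[of n] field_simps)
qed

lemma prob_cycle_counts:
  assumes "k \<le> n" "(\<Sum>j\<in>{1..k}. j * r j) \<le> n"
  shows "measure_pmf.prob (Pn \<theta> n) {\<sigma>. \<forall>j\<in>{1..k}. cycle_count n \<sigma> j = r j} =
    poisson_coeff \<theta> k r * exp_coeff (\<lambda>j. if j \<le> k then 0 else \<theta> j) (n - (\<Sum>j\<in>{1..k}. j * r j)) / exp_coeff \<theta> n"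
proof -
  have "(\<Sum>\<sigma> | \<sigma> permutes {1..n}. (if \<sigma> \<in> {\<sigma>. \<forall>j\<in>{1..k}. cycle_count n \<sigma> j = r j} then weight \<theta> n \<sigma> else 0)) =
    (\<Sum>\<sigma> | \<sigma> permutes {1..n}. type_weight \<theta> n k r (cycle_type {1..n} \<sigma>))"
    by (rule sum.cong) (auto simp: weight_def type_weight_def cycle_count_eq_cycle_type)
  also have "\<dots> = fact n * cycle_type_mean n (type_weight \<theta> n k r)"
    using sum_permutes_cycle_type[of "{1..n}"] by simp
  finally show ?thesis
    unfolding prob_Pn using assms by (simp add: cycle_type_mean_type_weight Let_def)
qed

end

section \<open>Exponentials of power series\<close>

lemma powser_has_field_derivative:
  fixes a :: "nat \<Rightarrow> 'a :: {real_normed_field, banach}"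
  assumes sums: "\<And>z. norm z < R \<Longrightarrow> (\<lambda>n. a n * z ^ n) sums f z" and z: "norm z < R"
  shows "(f has_field_derivative (\<Sum>n. diffs a n * z ^ n)) (at z)"
    and "(\<lambda>n. diffs a n * z ^ n) sums (\<Sum>n. diffs a n * z ^ n)"
proof -
  define \<rho> where "\<rho> = (norm z + R) / 2"
  have "0 \<le> norm z + R" using z norm_ge_zero[of z] by linarith
  hence \<rho>: "norm z < \<rho>" "\<rho> < R" "0 \<le> \<rho>" using z by (simp_all add: \<rho>_def)
  have s: "summable (\<lambda>n. a n * of_real \<rho> ^ n)" using sums[of "of_real \<rho>"] \<rho> by (auto simp: sums_iff)
  have "((\<lambda>z. \<Sum>n. a n * z ^ n) has_field_derivative (\<Sum>n. diffs a n * z ^ n)) (at z)"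
    using \<rho> by (intro termdiffs_strong[OF s]) auto
  moreover have "eventually (\<lambda>w. (\<Sum>n. a n * w ^ n) = f w) (nhds z)"
  proof -
    have "eventually (\<lambda>z. z \<in> ball 0 R) (nhds z)"
      using z by (intro eventually_nhds_in_open) auto
    thus ?thesis by eventually_elim (use sums in \<open>auto simp: sums_iff\<close>)
  qed
  ultimately show "(f has_field_derivative (\<Sum>n. diffs a n * z ^ n)) (at z)"
    by (subst (asm) DERIV_cong_ev[OF refl _ refl])
  have "summable (\<lambda>n. diffs a n * z ^ n)"
    by (rule termdiff_converges[OF z]) (use sums in \<open>auto simp: sums_iff\<close>)
  thus "(\<lambda>n. diffs a n * z ^ n) sums (\<Sum>n. diffs a n * z ^ n)" by (simp add: summable_sums)
qed

text \<open>Stated for real and complex fields alike: the real case evaluates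
  \<open>taylor_coeff\<close> and gives uniqueness of coefficients, the complex case feeds the
  Leibniz rule in \<open>exp_coeff_sums\<close>.\<close>

lemma powser_higher_deriv:
  fixes a :: "nat \<Rightarrow> 'a :: {real_normed_field, banach}"
  assumes "\<And>z. norm z < R \<Longrightarrow> (\<lambda>n. a n * z ^ n) sums f z" "R > 0"
  shows "(deriv ^^ n) f 0 = fact n * a n"
  using assms(1)
proof (induction n arbitrary: a f)
  case 0
  have "(\<lambda>n. a n * 0 ^ n) sums f 0" using 0[of 0] assms(2) by simp
  from sums_unique2[OF this powser_sums_zero[of a]] show ?case by simp
next
  case (Suc n)
  let ?f = "\<lambda>z. \<Sum>n. diffs a n * z ^ n"
  have d: "deriv f z = ?f z" if "norm z < R" for z
    using powser_has_field_derivative(1)[of R a f z, OF Suc.prems that] by (simp add: DERIV_imp_deriv)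
  have "eventually (\<lambda>z. z \<in> ball 0 R) (nhds (0::'a))"
    using assms(2) by (intro eventually_nhds_in_open) auto
  hence ev: "eventually (\<lambda>z. deriv f z = ?f z) (nhds 0)"
    by eventually_elim (use d in auto)
  have "(deriv ^^ Suc n) f 0 = (deriv ^^ n) (deriv f) 0" by (simp add: funpow_Suc_right del: funpow.simps)
  also have "\<dots> = (deriv ^^ n) ?f 0" by (rule higher_deriv_cong_ev[OF ev refl])
  also have "\<dots> = fact n * diffs a n"
    by (rule Suc.IH) (rule powser_has_field_derivative(2)[of R a f, OF Suc.prems])
  finally show ?case by (simp add: diffs_def)
qed

text \<open>Radius of convergence at least \<open>1\<close>, phrased absolutely so that comparison
  and Cauchy products also cover coefficients of either sign, as in
  \<open>truncated_ratio_tendsto\<close>.\<close>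

definition unit_disc_summable :: "(nat \<Rightarrow> real) \<Rightarrow> bool" where
  "unit_disc_summable a \<longleftrightarrow> (\<forall>x. 0 \<le> x \<and> x < 1 \<longrightarrow> summable (\<lambda>n. \<bar>a n\<bar> * x ^ n))"

lemma unit_disc_summableD:
  fixes z :: "'a :: {real_normed_algebra_1, banach}"
  assumes "unit_disc_summable a" "norm z < 1"
  shows "summable (\<lambda>n. norm (of_real (a n) * z ^ n))" "summable (\<lambda>n. of_real (a n) * z ^ n)"
proof -
  have s: "summable (\<lambda>n. \<bar>a n\<bar> * norm z ^ n)" using assms by (simp add: unit_disc_summable_def)
  show "summable (\<lambda>n. norm (of_real (a n) * z ^ n))"
  proof (rule summable_comparison_test'[OF s, where N = 0])
    fix n
    have "norm (of_real (a n) * z ^ n) \<le> norm (of_real (a n) :: 'a) * norm (z ^ n)" by (rule norm_mult_ineq)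
    also have "\<dots> \<le> \<bar>a n\<bar> * norm z ^ n" by (intro mult_mono norm_power_ineq) auto
    finally show "norm (norm (of_real (a n) * z ^ n)) \<le> \<bar>a n\<bar> * norm z ^ n" by simp
  qed
  thus "summable (\<lambda>n. of_real (a n) * z ^ n)" by (rule summable_norm_cancel)
qed

text \<open>The function \<open>f = exp g\<close> solves \<open>f' = G * f\<close>, so by the
  Leibniz rule its Taylor coefficients obey the recursion of \<open>exp_coeff\<close>. Convergence
  on the whole disc then comes from holomorphy of \<open>f\<close>, without any growth estimate for
  \<open>exp_coeff\<close>.\<close>

lemma exp_coeff_sums:
  fixes z :: complex
  assumes s: "unit_disc_summable (\<lambda>j. \<theta> (Suc j))" and z: "norm z < 1"
  shows "(\<lambda>n. of_real (exp_coeff \<theta> n) * z ^ n) sums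
    exp (\<Sum>j. of_real (\<theta> (Suc j) / real (Suc j)) * z ^ Suc j)"
proof -
  define c where "c = (\<lambda>n. if n = 0 then 0 else complex_of_real (\<theta> n / real n))"
  define G where "G = (\<lambda>z. \<Sum>j. of_real (\<theta> (Suc j)) * z ^ j :: complex)"
  define g where "g = (\<lambda>z. \<Sum>n. c n * z ^ n)"
  define f where "f = (\<lambda>z. exp (g z))"
  have Gs: "(\<lambda>j. of_real (\<theta> (Suc j)) * z ^ j) sums G z" if "norm z < 1" for z
    unfolding G_def using unit_disc_summableD(2)[OF s that] by (simp add: summable_sums)
  have gs1: "summable (\<lambda>j. of_real (\<theta> (Suc j) / real (Suc j)) * z ^ Suc j)" if "norm z < 1" for z :: complex
  proof (rule summable_comparison_test'[OF unit_disc_summableD(1)[OF s that], where N = 0])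
    fix n
    have "norm (complex_of_real (\<theta> (Suc n) / real (Suc n)) * z ^ Suc n) = \<bar>\<theta> (Suc n)\<bar> * norm z ^ n * (norm z / real (Suc n))"
      by (simp add: norm_mult norm_power norm_divide del: of_nat_Suc)
    also have "\<dots> \<le> \<bar>\<theta> (Suc n)\<bar> * norm z ^ n * 1"
      using that by (intro mult_left_mono) (auto simp: divide_simps)
    finally show "norm (complex_of_real (\<theta> (Suc n) / real (Suc n)) * z ^ Suc n) \<le> norm (complex_of_real (\<theta> (Suc n)) * z ^ n)"
      by (simp add: norm_mult norm_power)
  qed
  have gs: "(\<lambda>n. c n * z ^ n) sums g z" if "norm z < 1" for z
  proof -
    have "(\<lambda>j. c (Suc j) * z ^ Suc j) = (\<lambda>j. of_real (\<theta> (Suc j) / real (Suc j)) * z ^ Suc j)"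
      by (simp add: c_def fun_eq_iff)
    hence "summable (\<lambda>j. c (Suc j) * z ^ Suc j)" using gs1[OF that] by simp
    hence "summable (\<lambda>n. c n * z ^ n)" by (subst (asm) summable_Suc_iff)
    thus ?thesis unfolding g_def by (simp add: summable_sums)
  qed
  have g_eq: "g z = (\<Sum>j. of_real (\<theta> (Suc j) / real (Suc j)) * z ^ Suc j)" if "norm z < 1" for z
  proof -
    have "(\<lambda>j. c (Suc j) * z ^ Suc j) sums (g z - c 0 * z ^ 0)"
      using gs[OF that] by (subst sums_Suc_iff) simp
    thus ?thesis by (simp add: c_def sums_iff)
  qed
  have dc: "diffs c = (\<lambda>j. of_real (\<theta> (Suc j)))"
  proof
    fix j
    have "complex_of_nat (Suc j) \<noteq> 0" by (rule of_nat_neq_0)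
    thus "diffs c j = of_real (\<theta> (Suc j))" by (simp add: diffs_def c_def del: of_nat_Suc)
  qed
  have gd: "(g has_field_derivative G z) (at z)" if "norm z < 1" for z
    using powser_has_field_derivative(1)[of 1 c g z, OF gs that] unfolding dc G_def .
  have fd: "(f has_field_derivative G z * f z) (at z)" if "norm z < 1" for z
    unfolding f_def using gd[OF that] by (auto intro!: derivative_eq_intros)
  have holf: "f holomorphic_on ball 0 1"
  proof (subst holomorphic_on_open, simp, intro ballI)
    fix z :: complex assume "z \<in> ball 0 1"
    thus "\<exists>f'. (f has_field_derivative f') (at z)" using fd[of z] by (intro exI[of _ "G z * f z"]) simp
  qed
  have holG: "G holomorphic_on ball 0 1"
  proof -
    have "(G has_field_derivative (\<Sum>n. diffs (\<lambda>j. of_real (\<theta> (Suc j))) n * z ^ n)) (at z)" if "norm z < 1" for z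
      by (rule powser_has_field_derivative(1)[of 1, OF Gs that])
    thus ?thesis unfolding holomorphic_on_open[OF open_ball] by (metis mem_ball_0)
  qed
  have Gd: "(deriv ^^ i) G 0 = fact i * of_real (\<theta> (Suc i))" for i
    by (rule powser_higher_deriv[of 1]) (use Gs in auto)
  have step: "(deriv ^^ Suc n) f 0 = (\<Sum>i = 0..n. of_nat (n choose i) * (fact i * of_real (\<theta> (Suc i))) * (deriv ^^ (n - i)) f 0)" for n
  proof -
    have "eventually (\<lambda>z. z \<in> ball 0 1) (nhds (0::complex))"
      by (intro eventually_nhds_in_open) auto
    hence ev: "eventually (\<lambda>z. deriv f z = G z * f z) (nhds 0)"
      by eventually_elim (use fd in \<open>auto simp: DERIV_imp_deriv\<close>)
    have "(deriv ^^ Suc n) f 0 = (deriv ^^ n) (deriv f) 0" by (simp add: funpow_Suc_right del: funpow.simps)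
    also have "\<dots> = (deriv ^^ n) (\<lambda>z. G z * f z) 0" by (rule higher_deriv_cong_ev[OF ev refl])
    also have "\<dots> = (\<Sum>i = 0..n. of_nat (n choose i) * (deriv ^^ i) G 0 * (deriv ^^ (n - i)) f 0)"
      by (rule higher_deriv_mult[OF holG holf]) auto
    finally show ?thesis unfolding Gd .
  qed
  have coeff: "(deriv ^^ n) f 0 = fact n * of_real (exp_coeff \<theta> n)" for n
  proof (induction n rule: less_induct)
    case (less n)
    show ?case
    proof (cases n)
      case 0
      have "g 0 = 0" using g_eq[of 0] by simp
      thus ?thesis using 0 by (simp add: f_def)
    next
      case (Suc m)
      have "(deriv ^^ n) f 0 = (\<Sum>i = 0..m. of_nat (m choose i) * (fact i * of_real (\<theta> (Suc i))) * (fact (m - i) * of_real (exp_coeff \<theta> (m - i))))"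
        unfolding Suc step by (rule sum.cong) (use less Suc in auto)
      also have "\<dots> = (\<Sum>i = 0..m. fact m * (of_real (\<theta> (Suc i) * exp_coeff \<theta> (m - i))))"
      proof (rule sum.cong[OF refl])
        fix i assume i: "i \<in> {0..m}"
        have "(of_nat (m choose i) :: complex) * (fact i * fact (m - i)) = fact m"
          using binomial_fact_lemma[of i m] i by (metis atLeastAtMost_iff mult.commute of_nat_fact of_nat_mult)
        thus "of_nat (m choose i) * (fact i * of_real (\<theta> (Suc i))) * (fact (m - i) * of_real (exp_coeff \<theta> (m - i))) =
          fact m * (complex_of_real (\<theta> (Suc i) * exp_coeff \<theta> (m - i)))"
          by (simp add: algebra_simps)
      qed
      also have "\<dots> = fact m * of_real (\<Sum>i = 0..m. \<theta> (Suc i) * exp_coeff \<theta> (m - i))"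
        by (simp add: sum_distrib_left)
      also have "(\<Sum>i = 0..m. \<theta> (Suc i) * exp_coeff \<theta> (m - i)) = (\<Sum>j\<in>{1..n}. \<theta> j * exp_coeff \<theta> (n - j))"
        unfolding Suc by (rule sum.reindex_bij_witness[of _ "\<lambda>j. j - 1" Suc]) auto
      also have "\<dots> = real n * exp_coeff \<theta> n" by (rule exp_coeff_rec[symmetric]) (simp add: Suc)
      finally show ?thesis by (simp add: Suc)
    qed
  qed
  have "(\<lambda>n. (deriv ^^ n) f 0 / fact n * (z - 0) ^ n) sums f z"
    by (rule holomorphic_power_series[OF holf]) (use z in auto)
  thus ?thesis unfolding coeff using z by (simp add: f_def g_eq)
qed

lemma summable_integrated:
  fixes x :: real
  assumes "unit_disc_summable (\<lambda>j. \<theta> (Suc j))" "\<bar>x\<bar> < 1"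
  shows "summable (\<lambda>j. \<theta> (Suc j) / real (Suc j) * x ^ Suc j)"
proof (rule summable_comparison_test'[OF unit_disc_summableD(1)[OF assms(1), of x], where N = 0])
  fix n
  have "norm (\<theta> (Suc n) / real (Suc n) * x ^ Suc n) = \<bar>\<theta> (Suc n)\<bar> * \<bar>x\<bar> ^ n * (\<bar>x\<bar> / real (Suc n))"
    by (simp add: abs_mult power_abs del: of_nat_Suc)
  also have "\<dots> \<le> \<bar>\<theta> (Suc n)\<bar> * \<bar>x\<bar> ^ n * 1"
    using assms by (intro mult_left_mono) (auto simp: divide_simps)
  finally show "norm (\<theta> (Suc n) / real (Suc n) * x ^ Suc n) \<le> norm (of_real (\<theta> (Suc n)) * x ^ n)"
    by (simp add: abs_mult power_abs)
qed (use assms in auto)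

lemma exp_coeff_sums_real:
  fixes x :: real
  assumes s: "unit_disc_summable (\<lambda>j. \<theta> (Suc j))" and x: "\<bar>x\<bar> < 1"
  shows "(\<lambda>n. exp_coeff \<theta> n * x ^ n) sums exp (\<Sum>j. \<theta> (Suc j) / real (Suc j) * x ^ Suc j)"
proof -
  have "complex_of_real (exp (\<Sum>j. \<theta> (Suc j) / real (Suc j) * x ^ Suc j)) =
    exp (\<Sum>j. of_real (\<theta> (Suc j) / real (Suc j)) * of_real x ^ Suc j)"
  proof -
    have "complex_of_real (\<Sum>j. \<theta> (Suc j) / real (Suc j) * x ^ Suc j) =
        (\<Sum>j. of_real (\<theta> (Suc j) / real (Suc j) * x ^ Suc j))"
      by (rule suminf_of_real[OF summable_integrated[OF s x]])
    thus ?thesis by (simp add: exp_of_real[symmetric] del: of_nat_Suc power_Suc)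
  qed
  moreover have "(\<lambda>n. of_real (exp_coeff \<theta> n) * of_real x ^ n) sums
    exp (\<Sum>j. of_real (\<theta> (Suc j) / real (Suc j)) * complex_of_real x ^ Suc j)"
    by (rule exp_coeff_sums[OF s]) (use x in auto)
  ultimately have "(\<lambda>n. complex_of_real (exp_coeff \<theta> n * x ^ n)) sums complex_of_real (exp (\<Sum>j. \<theta> (Suc j) / real (Suc j) * x ^ Suc j))"
    by simp
  thus ?thesis by (simp only: sums_of_real_iff)
qed

section \<open>Fourier coefficients of absolutely convergent series\<close>

lemma has_integral_cis:
  "((\<lambda>t. cis (real_of_int k * t)) has_integral (if k = 0 then 2 * pi else 0)) {-pi..pi}"
proof (cases "k = 0")
  case True
  thus ?thesis using has_integral_const_real[of "1::complex" "-pi" pi] by (simp add: cis_conv_exp scaleR_conv_of_real)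
next
  case False
  have "((\<lambda>t. cis (real_of_int k * t)) has_integral
      (cis (real_of_int k * pi) / (\<i> * of_int k) - cis (real_of_int k * (- pi)) / (\<i> * of_int k))) {-pi..pi}"
  proof (rule fundamental_theorem_of_calculus)
    fix t :: real
    have i: "\<i> * (E * \<i>) = - E" for E by (simp add: complex_eq_iff)
    show "((\<lambda>t. cis (real_of_int k * t) / (\<i> * of_int k)) has_vector_derivative cis (real_of_int k * t)) (at t within {-pi..pi})"
      unfolding cis_conv_exp using False
      by (auto intro!: derivative_eq_intros has_vector_derivative_real_field simp: i)
  qed auto
  moreover have "cis (real_of_int k * pi) = cis (real_of_int k * (- pi))"
    by (simp add: complex_eq_iff) (simp add: mult.commute sin_int_times_real)
  ultimately show ?thesis using False by simp
qed

text \<open>Absolute summability gives uniform convergence by the M-test, hence termwise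
  integration; orthogonality leaves the term \<open>k\<close>.\<close>

lemma has_integral_fourier_coeff:
  fixes p :: "nat \<Rightarrow> real"
  assumes p: "summable (\<lambda>m. \<bar>p m\<bar>)" and F: "\<And>t. (\<lambda>m. of_real (p m) * cis (real m * t)) sums F t"
  shows "((\<lambda>t. F t * cis (- (real k * t))) has_integral of_real (2 * pi * p k)) {-pi..pi}"
proof -
  define f where "f = (\<lambda>m t. of_real (p m) * cis ((real_of_int (int m - int k)) * t))"
  have fs: "(\<lambda>m. f m t) sums (F t * cis (- (real k * t)))" for t
  proof -
    have "(\<lambda>m. of_real (p m) * cis (real m * t) * cis (- (real k * t))) sums (F t * cis (- (real k * t)))"
      by (rule sums_mult2[OF F])
    thus ?thesis by (simp add: f_def mult.assoc cis_mult algebra_simps)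
  qed
  have ul: "uniform_limit {-pi..pi} (\<lambda>n t. \<Sum>m<n. f m t) (\<lambda>t. F t * cis (- (real k * t))) sequentially"
  proof -
    have "uniform_limit {-pi..pi} (\<lambda>n t. \<Sum>m<n. f m t) (\<lambda>t. \<Sum>m. f m t) sequentially"
      by (rule Weierstrass_m_test[OF _ p]) (auto simp: f_def norm_mult)
    thus ?thesis using fs by (simp add: sums_iff)
  qed
  have cont: "continuous_on {-pi..pi} (\<lambda>t. \<Sum>m<n. f m t)" for n
    unfolding f_def by (intro continuous_intros)
  from uniform_limit_integral[OF ul cont]
  obtain I J where I: "\<And>n. ((\<lambda>t. \<Sum>m<n. f m t) has_integral I n) {-pi..pi}"
    and J: "((\<lambda>t. F t * cis (- (real k * t))) has_integral J) {-pi..pi}" and lim: "I \<longlonglongrightarrow> J"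
    by auto
  have "((\<lambda>t. \<Sum>m<n. f m t) has_integral (\<Sum>m<n. complex_of_real (p m) * (if int m - int k = 0 then of_real (2 * pi) else 0))) {-pi..pi}" for n
    unfolding f_def
  proof (intro has_integral_sum has_integral_mult_right)
    fix m
    show "((\<lambda>t. cis (real_of_int (int m - int k) * t)) has_integral
        (if int m - int k = 0 then of_real (2 * pi) else 0)) {-pi..pi}"
      using has_integral_cis[of "int m - int k"] by (simp only: if_distrib[of complex_of_real] of_real_0)
  qed auto
  hence "I n = (\<Sum>m<n. complex_of_real (p m) * (if int m - int k = 0 then of_real (2 * pi) else 0))" for n
    using I has_integral_unique by blast
  hence "I n = of_real (2 * pi * p k)" if "n > k" for n
    using that by (simp add: sum.If_cases if_distrib[of "\<lambda>x. _ * x"] cong: if_cong)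
  hence "eventually (\<lambda>n. I n = of_real (2 * pi * p k)) sequentially"
    by (rule eventually_mono[OF eventually_gt_at_top[of k]])
  hence "I \<longlonglongrightarrow> of_real (2 * pi * p k)" by (rule tendsto_eventually)
  hence "J = of_real (2 * pi * p k)" using lim LIMSEQ_unique by blast
  thus ?thesis using J by simp
qed

section \<open>The Fourier integral at a saddle point\<close>

text \<open>Real and imaginary parts of the Taylor remainder of \<open>iexp\<close>.\<close>

lemma cos_sin_Taylor:
  fixes x :: real
  shows "\<bar>cos x - 1\<bar> \<le> x\<^sup>2 / 2" "\<bar>cos x - 1 + x\<^sup>2 / 2\<bar> \<le> \<bar>x\<bar> ^ 3 / 6"
    "\<bar>sin x - x\<bar> \<le> \<bar>x\<bar> ^ 3 / 6"
proof -
  have 1: "cmod (iexp x - (\<Sum>k\<le>1. (\<i> * x) ^ k / fact k)) \<le> \<bar>x\<bar> ^ Suc 1 / fact (Suc 1)"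
    by (rule iexp_approx1)
  have 2: "cmod (iexp x - (\<Sum>k\<le>2. (\<i> * x) ^ k / fact k)) \<le> \<bar>x\<bar> ^ Suc 2 / fact (Suc 2)"
    by (rule iexp_approx1)
  have e1: "(\<Sum>k\<le>1. (\<i> * x) ^ k / fact k) = Complex 1 x"
    by (simp add: complex_eq_iff)
  have e2: "(\<Sum>k\<le>2. (\<i> * x) ^ k / fact k) = Complex (1 - x\<^sup>2 / 2) x"
    by (simp add: complex_eq_iff numeral_2_eq_2 power2_eq_square)
  show "\<bar>cos x - 1\<bar> \<le> x\<^sup>2 / 2"
    using order_trans[OF abs_Re_le_cmod 1] unfolding e1 by (simp add: Re_exp power2_eq_square)
  show "\<bar>cos x - 1 + x\<^sup>2 / 2\<bar> \<le> \<bar>x\<bar> ^ 3 / 6"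
    using order_trans[OF abs_Re_le_cmod 2] unfolding e2 by (simp add: Re_exp numeral_3_eq_3 fact_numeral numeral_2_eq_2 algebra_simps)
  show "\<bar>sin x - x\<bar> \<le> \<bar>x\<bar> ^ 3 / 6"
    using order_trans[OF abs_Im_le_cmod 2] unfolding e2 by (simp add: Im_exp numeral_3_eq_3 numeral_2_eq_2)
qed

text \<open>For \<open>|t| > 1\<close> the left side is at least \<open>1 - cos 1\<close>, hence at
  least \<open>1 / 3\<close>, while \<open>t ^ 2 \<le> 16\<close>; thus
  \<open>48 = 3 * 16\<close>.\<close>

lemma one_minus_cos_ge:
  assumes "\<bar>t\<bar> \<le> pi"
  shows "1 - cos t \<ge> t\<^sup>2 / 48"
proof -
  have small: "1 - cos x \<ge> x\<^sup>2 / 3" if "0 \<le> x" "x \<le> 1" for x :: real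
  proof -
    have "\<bar>x\<bar> ^ 3 \<le> x\<^sup>2 * 1" using that by (simp add: power3_eq_cube power2_eq_square mult_left_le)
    thus ?thesis using cos_sin_Taylor(2)[of x] by (simp add: abs_if split: if_splits)
  qed
  show ?thesis
  proof (cases "\<bar>t\<bar> \<le> 1")
    case True
    have "0 \<le> t\<^sup>2" by simp
    moreover have "1 - cos t \<ge> t\<^sup>2 / 3" using small[of "\<bar>t\<bar>"] True by simp
    ultimately show ?thesis by linarith
  next
    case False
    have "cos \<bar>t\<bar> \<le> cos 1" using False assms by (intro cos_monotone_0_pi_le) auto
    hence "1 - cos t \<ge> 1 / 3" using small[of 1] by simp
    moreover have "t\<^sup>2 \<le> 16"
    proof -
      have "\<bar>t\<bar> \<le> 4" using assms pi_less_4 by linarith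
      hence "\<bar>t\<bar>\<^sup>2 \<le> 4\<^sup>2" by (intro power_mono) auto
      thus ?thesis by simp
    qed
    ultimately show ?thesis by linarith
  qed
qed

lemma unit_disc_summable_diffs:
  assumes "unit_disc_summable a"
  shows "unit_disc_summable (diffs a)"
  unfolding unit_disc_summable_def
proof (intro allI impI)
  fix x :: real assume x: "0 \<le> x \<and> x < 1"
  have "summable (\<lambda>n. diffs (\<lambda>n. \<bar>a n\<bar>) n * x ^ n)"
  proof (rule termdiff_converges[of x 1])
    show "summable (\<lambda>n. \<bar>a n\<bar> * y ^ n)" if "norm y < 1" for y :: real
      using unit_disc_summableD(1)[OF assms that] summable_norm_cancel[of "\<lambda>n. \<bar>a n\<bar> * y ^ n"]
      by (simp add: abs_mult power_abs)
  qed (use x in auto)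
  thus "summable (\<lambda>n. \<bar>diffs a n\<bar> * x ^ n)" by (simp add: diffs_def abs_mult)
qed

lemma unit_disc_summable_Suc_mult:
  assumes "unit_disc_summable a"
  shows "unit_disc_summable (\<lambda>n. real (Suc n) * a n)"
  unfolding unit_disc_summable_def
proof (intro allI impI)
  fix x :: real assume x: "0 \<le> x \<and> x < 1"
  have "summable (\<lambda>n. \<bar>diffs a n\<bar> * x ^ n)"
    using unit_disc_summable_diffs[OF assms] x by (simp add: unit_disc_summable_def)
  hence "summable (\<lambda>n. \<bar>diffs a n\<bar> * x ^ n * x)" by (rule summable_mult2)
  hence "summable (\<lambda>n. (\<lambda>n. real n * \<bar>a n\<bar> * x ^ n) (Suc n))"
    by (simp add: diffs_def abs_mult mult_ac del: of_nat_Suc)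
  hence "summable (\<lambda>n. real n * \<bar>a n\<bar> * x ^ n)" by (subst (asm) summable_Suc_iff)
  moreover have "summable (\<lambda>n. \<bar>a n\<bar> * x ^ n)" using assms x by (simp add: unit_disc_summable_def)
  ultimately have "summable (\<lambda>n. real n * \<bar>a n\<bar> * x ^ n + \<bar>a n\<bar> * x ^ n)" by (rule summable_add)
  moreover have "real n * \<bar>a n\<bar> * x ^ n + \<bar>a n\<bar> * x ^ n = \<bar>real (Suc n) * a n\<bar> * x ^ n" for n
    unfolding abs_mult by (simp add: distrib_right)
  ultimately show "summable (\<lambda>n. \<bar>real (Suc n) * a n\<bar> * x ^ n)" by simp
qed

section \<open>Moments, damping and phase at a fixed radius\<close>

locale saddle =
  fixes \<theta> :: "nat \<Rightarrow> real" and r :: real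
  assumes nonneg: "\<And>j. j \<ge> 1 \<Longrightarrow> \<theta> j \<ge> 0"
    and incr: "\<And>j. j \<ge> 1 \<Longrightarrow> \<theta> j \<le> \<theta> (Suc j)"
    and usum: "unit_disc_summable (\<lambda>j. \<theta> (Suc j))"
    and r: "1 / 2 \<le> r" "r < 1"
begin

definition w :: "nat \<Rightarrow> real" where "w j = \<theta> (Suc j) * r ^ Suc j"

text \<open>For \<open>phi t = (\<Sum>j. \<theta> j / j * (r * cis t) ^ j)\<close> the numbers
  \<open>N\<close>, \<open>B\<close>, \<open>T\<close> are, up to powers of the imaginary unit, the
  first three derivatives at \<open>t = 0\<close>. The difference \<open>phi t - phi 0\<close> has
  real part \<open>- D t\<close> and imaginary part \<open>N * t + E t\<close>, so \<open>D\<close>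
  is the damping and \<open>E\<close> the nonlinear phase.\<close>

definition N where "N = (\<Sum>j. w j)"
definition B where "B = (\<Sum>j. real (Suc j) * w j)"
definition T where "T = (\<Sum>j. real (Suc j) ^ 2 * w j)"
definition D where "D t = (\<Sum>j. w j / real (Suc j) * (1 - cos (real (Suc j) * t)))"
definition E where "E t = (\<Sum>j. w j / real (Suc j) * (sin (real (Suc j) * t) - real (Suc j) * t))"

lemma w_nonneg: "w j \<ge> 0"
  using nonneg r by (simp add: w_def)

lemma summable_w: "summable w"
proof -
  have "summable (\<lambda>j. of_real (\<theta> (Suc j)) * r ^ j)"
    by (rule unit_disc_summableD(2)[OF usum]) (use r in auto)
  hence "summable (\<lambda>j. of_real (\<theta> (Suc j)) * r ^ j * r)" by (rule summable_mult2)
  thus ?thesis by (simp add: w_def[abs_def] mult_ac)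
qed

lemma summable_B: "summable (\<lambda>j. real (Suc j) * w j)"
proof -
  have "summable (\<lambda>j. of_real (real (Suc j) * \<theta> (Suc j)) * r ^ j)"
    by (rule unit_disc_summableD(2)[OF unit_disc_summable_Suc_mult[OF usum]]) (use r in auto)
  hence "summable (\<lambda>j. of_real (real (Suc j) * \<theta> (Suc j)) * r ^ j * r)" by (rule summable_mult2)
  thus ?thesis by (simp add: w_def[abs_def] mult_ac del: of_nat_Suc)
qed

lemma summable_T: "summable (\<lambda>j. real (Suc j) ^ 2 * w j)"
proof -
  have "summable (\<lambda>j. of_real (real (Suc j) * (real (Suc j) * \<theta> (Suc j))) * r ^ j)"
    by (rule unit_disc_summableD(2)[OF unit_disc_summable_Suc_mult[OF unit_disc_summable_Suc_mult[OF usum]]]) (use r in auto)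
  hence "summable (\<lambda>j. of_real (real (Suc j) * (real (Suc j) * \<theta> (Suc j))) * r ^ j * r)" by (rule summable_mult2)
  thus ?thesis by (simp add: w_def[abs_def] mult_ac power2_eq_square del: of_nat_Suc)
qed

lemma summable_bounded:
  assumes "\<And>j. \<bar>f j\<bar> \<le> C" shows "summable (\<lambda>j. w j / real (Suc j) * f j)"
proof (rule summable_comparison_test'[OF summable_mult[OF summable_w, of C], where N = 0])
  fix j
  have "C \<ge> 0" using assms[of 0] by linarith
  have "norm (w j / real (Suc j) * f j) = (w j * \<bar>f j\<bar>) / real (Suc j)"
    using w_nonneg[of j] by (simp add: abs_mult)
  also have "\<dots> \<le> (w j * \<bar>f j\<bar>) / 1"
    using w_nonneg[of j] by (intro divide_left_mono) auto
  also have "\<dots> \<le> C * w j" using assms[of j] w_nonneg[of j] by (simp add: mult.commute mult_right_mono)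
  finally show "norm (w j / real (Suc j) * f j) \<le> C * w j" .
qed

lemma summable_D: "summable (\<lambda>j. w j / real (Suc j) * (1 - cos (real (Suc j) * t)))"
proof (rule summable_bounded[of _ 2])
  fix j show "\<bar>1 - cos (real (Suc j) * t)\<bar> \<le> 2"
    using cos_ge_minus_one[of "real (Suc j) * t"] cos_le_one[of "real (Suc j) * t"] by linarith
qed

lemma summable_sin: "summable (\<lambda>j. w j / real (Suc j) * sin (real (Suc j) * t))"
  by (rule summable_bounded[of _ 1]) simp

lemma E_eq: "E t = (\<Sum>j. w j / real (Suc j) * sin (real (Suc j) * t)) - N * t"
proof -
  have "w j / real (Suc j) * (sin (real (Suc j) * t) - real (Suc j) * t) =
    w j / real (Suc j) * sin (real (Suc j) * t) - w j * t" for j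
    using of_nat_neq_0[of j, where ?'a = real] by (simp add: algebra_simps del: of_nat_Suc)
  thus ?thesis unfolding E_def N_def
    using suminf_diff[OF summable_sin summable_mult2[OF summable_w], of t t] suminf_mult2[OF summable_w, of t] by simp
qed

lemma B_nonneg: "B \<ge> 0"
  unfolding B_def using w_nonneg by (intro suminf_nonneg summable_B) auto

lemma N_le_B: "N \<le> B"
  unfolding N_def B_def
proof (rule suminf_le[OF _ summable_w summable_B])
  fix j show "w j \<le> real (Suc j) * w j" using w_nonneg[of j] by (simp add: mult_le_cancel_right1)
qed

lemma B_le_T: "B \<le> T"
  unfolding B_def T_def
proof (rule suminf_le[OF _ summable_B summable_T])
  fix j
  have "real (Suc j) * 1 \<le> real (Suc j) * real (Suc j)" by (intro mult_left_mono) auto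
  thus "real (Suc j) * w j \<le> real (Suc j) ^ 2 * w j"
    using w_nonneg[of j] by (intro mult_right_mono) (auto simp: power2_eq_square)
qed

lemma D_le: "D t \<le> B * t\<^sup>2 / 2"
proof -
  have "D t \<le> (\<Sum>j. real (Suc j) * w j * (t\<^sup>2 / 2))"
    unfolding D_def
  proof (rule suminf_le[OF _ summable_D summable_mult2[OF summable_B]])
    fix j
    have "w j / real (Suc j) * (1 - cos (real (Suc j) * t)) \<le> w j / real (Suc j) * ((real (Suc j) * t)\<^sup>2 / 2)"
      using cos_sin_Taylor(1)[of "real (Suc j) * t"] w_nonneg[of j] by (intro mult_left_mono) auto
    also have "\<dots> = real (Suc j) * w j * (t\<^sup>2 / 2)"
      using of_nat_neq_0[of j, where ?'a = real] by (simp add: field_simps power2_eq_square del: of_nat_Suc)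
    finally show "w j / real (Suc j) * (1 - cos (real (Suc j) * t)) \<le> real (Suc j) * w j * (t\<^sup>2 / 2)" .
  qed
  also have "\<dots> = B * (t\<^sup>2 / 2)" unfolding B_def by (rule suminf_mult2[OF summable_B, symmetric])
  finally show ?thesis by simp
qed

lemma D_ge: "D t \<ge> B * t\<^sup>2 / 2 - T * \<bar>t\<bar> ^ 3 / 6"
proof -
  have "B * (t\<^sup>2 / 2) - T * (\<bar>t\<bar> ^ 3 / 6) =
      (\<Sum>j. real (Suc j) * w j * (t\<^sup>2 / 2) - real (Suc j) ^ 2 * w j * (\<bar>t\<bar> ^ 3 / 6))"
    unfolding B_def T_def suminf_mult2[OF summable_B] suminf_mult2[OF summable_T]
    by (intro suminf_diff summable_mult2 summable_B summable_T)
  also have "\<dots> \<le> D t"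
    unfolding D_def
  proof (rule suminf_le[OF _ summable_diff[OF summable_mult2[OF summable_B] summable_mult2[OF summable_T]] summable_D])
    fix j
    let ?k = "real (Suc j)"
    have k: "?k > 0" by simp
    have "real (Suc j) * w j * (t\<^sup>2 / 2) - real (Suc j) ^ 2 * w j * (\<bar>t\<bar> ^ 3 / 6) =
      w j / ?k * ((?k * t)\<^sup>2 / 2 - \<bar>?k * t\<bar> ^ 3 / 6)"
      using k by (simp add: field_simps power2_eq_square power3_eq_cube abs_mult del: of_nat_Suc)
    also have "\<dots> \<le> w j / ?k * (1 - cos (?k * t))"
    proof (rule mult_left_mono)
      show "(?k * t)\<^sup>2 / 2 - \<bar>?k * t\<bar> ^ 3 / 6 \<le> 1 - cos (?k * t)"
        using cos_sin_Taylor(2)[of "?k * t"] unfolding abs_le_iff by linarith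
    qed (use w_nonneg[of j] in simp)
    finally show "real (Suc j) * w j * (t\<^sup>2 / 2) - real (Suc j) ^ 2 * w j * (\<bar>t\<bar> ^ 3 / 6) \<le> w j / ?k * (1 - cos (?k * t))" .
  qed
  finally show ?thesis by simp
qed

lemma E_le: "\<bar>E t\<bar> \<le> T * \<bar>t\<bar> ^ 3 / 6"
proof -
  have *: "norm (w j / real (Suc j) * (sin (real (Suc j) * t) - real (Suc j) * t)) \<le> real (Suc j) ^ 2 * w j * (\<bar>t\<bar> ^ 3 / 6)" for j
  proof -
    let ?k = "real (Suc j)"
    have k: "?k > 0" by simp
    have "norm (w j / ?k * (sin (?k * t) - ?k * t)) = w j / ?k * \<bar>sin (?k * t) - ?k * t\<bar>"
      using w_nonneg[of j] by (simp add: abs_mult)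
    also have "\<dots> \<le> w j / ?k * (\<bar>?k * t\<bar> ^ 3 / 6)"
      using cos_sin_Taylor(3)[of "?k * t"] w_nonneg[of j] by (intro mult_left_mono) auto
    also have "\<dots> = ?k ^ 2 * w j * (\<bar>t\<bar> ^ 3 / 6)"
      using k by (simp add: field_simps power2_eq_square power3_eq_cube abs_mult del: of_nat_Suc)
    finally show ?thesis .
  qed
  have "\<bar>E t\<bar> \<le> (\<Sum>j. real (Suc j) ^ 2 * w j * (\<bar>t\<bar> ^ 3 / 6))"
    unfolding E_def real_norm_def[symmetric, of "suminf _"]
    by (rule norm_suminf_le[OF *]) (rule summable_mult2[OF summable_T])
  also have "\<dots> = T * (\<bar>t\<bar> ^ 3 / 6)" unfolding T_def by (rule suminf_mult2[OF summable_T, symmetric])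
  finally show ?thesis by simp
qed

lemma cis_power: "(of_real r * cis t) ^ m = of_real (r ^ m) * cis (real m * t)"
  using Complex.DeMoivre[of t m] by (simp add: power_mult_distrib)

text \<open>Multiplying \<open>\<Sum>j. \<theta> j * z ^ j\<close> by \<open>1 - z\<close> leaves nonnegative coefficients.\<close>
lemma norm_w_cis_le: "cmod (1 - of_real r * cis t) * cmod (\<Sum>j. of_real (w j) * cis (real (Suc j) * t)) \<le> (1 - r) * N"
proof -
  define z where "z = of_real r * cis t"
  define a where "a = (\<lambda>j. \<theta> (Suc j))"
  define d where "d = (\<lambda>j. if j = 0 then a 0 else a j - a (j - 1))"
  have z: "norm z = r" using r by (simp add: z_def norm_mult)
  have d0: "d j \<ge> 0" for j using nonneg[of 1] incr[of j] by (auto simp: d_def a_def)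
  have S: "summable (\<lambda>j. of_real (a j) * x ^ j)" if "norm x < 1" for x :: "'x :: {real_normed_field, banach}"
    unfolding a_def by (rule unit_disc_summableD(2)[OF usum that])
  \<comment> \<open>Kept polymorphic because it is applied both at the complex \<open>z\<close> and
    at the real radius \<open>r\<close>, where the nonnegative \<open>d j\<close> make the majorant
    explicit.\<close>
  have main: "(\<lambda>j. of_real (d j) * x ^ j) sums ((1 - x) * (\<Sum>j. of_real (a j) * x ^ j))"
    if x: "norm x < 1" for x :: "'x :: {real_normed_field, banach}"
  proof -
    let ?A = "\<Sum>j. of_real (a j) * x ^ j"
    have 1: "(\<lambda>j. of_real (a j) * x ^ j) sums ?A" by (rule summable_sums[OF S[OF x]])
    have "(\<lambda>j. of_real (a j) * x ^ j * x) sums (?A * x)" by (rule sums_mult2[OF 1])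
    hence "(\<lambda>j. (\<lambda>j. if j = 0 then 0 else of_real (a (j - 1)) * x ^ j) (Suc j)) sums (?A * x)"
      by (simp add: mult_ac)
    hence 2: "(\<lambda>j. if j = 0 then 0 else of_real (a (j - 1)) * x ^ j) sums (?A * x)"
      by (subst (asm) sums_Suc_iff) simp
    have "(\<lambda>j. of_real (a j) * x ^ j - (if j = 0 then 0 else of_real (a (j - 1)) * x ^ j)) sums (?A - ?A * x)"
      by (rule sums_diff[OF 1 2])
    moreover have "(\<lambda>j. of_real (a j) * x ^ j - (if j = 0 then 0 else of_real (a (j - 1)) * x ^ j)) = (\<lambda>j. of_real (d j) * x ^ j)"
      by (auto simp: d_def fun_eq_iff algebra_simps)
    ultimately show ?thesis by (simp add: algebra_simps)
  qed
  have mr: "(\<lambda>j. d j * r ^ j) sums ((1 - r) * (\<Sum>j. a j * r ^ j))"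
    using main[of r] r by simp
  have "cmod ((1 - z) * (\<Sum>j. of_real (a j) * z ^ j)) = cmod (\<Sum>j. of_real (d j) * z ^ j)"
    using main[of z] z r by (simp add: sums_iff)
  also have "\<dots> \<le> (\<Sum>j. d j * r ^ j)"
    by (rule norm_suminf_le) (use mr d0 z in \<open>auto simp: sums_iff norm_mult norm_power\<close>)
  also have "\<dots> = (1 - r) * (\<Sum>j. a j * r ^ j)" using mr by (simp add: sums_iff)
  finally have 1: "cmod (1 - z) * cmod (\<Sum>j. of_real (a j) * z ^ j) \<le> (1 - r) * (\<Sum>j. a j * r ^ j)"
    by (simp add: norm_mult)
  have "(\<Sum>j. of_real (w j) * cis (real (Suc j) * t)) = (\<Sum>j. of_real (a j) * z ^ j * z)"
  proof (rule suminf_cong)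
    fix j
    have "of_real (a j) * z ^ j * z = of_real (a j) * z ^ Suc j" by simp
    also have "\<dots> = of_real (w j) * cis (real (Suc j) * t)"
      unfolding z_def cis_power by (simp add: w_def a_def del: of_nat_Suc)
    finally show "of_real (w j) * cis (real (Suc j) * t) = of_real (a j) * z ^ j * z" by simp
  qed
  also have "\<dots> = (\<Sum>j. of_real (a j) * z ^ j) * z"
    by (rule suminf_mult2[symmetric]) (use S[of z] z r in auto)
  finally have 2: "cmod (\<Sum>j. of_real (w j) * cis (real (Suc j) * t)) = cmod (\<Sum>j. of_real (a j) * z ^ j) * r"
    by (simp add: norm_mult z)
  have "N = (\<Sum>j. a j * r ^ j * r)" by (simp add: N_def w_def a_def mult_ac)
  also have "\<dots> = (\<Sum>j. a j * r ^ j) * r" by (rule suminf_mult2[symmetric]) (use S[of r] r in auto)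
  finally have 3: "N = (\<Sum>j. a j * r ^ j) * r" .
  have "cmod (1 - z) * cmod (\<Sum>j. of_real (a j) * z ^ j) * r \<le> (1 - r) * (\<Sum>j. a j * r ^ j) * r"
    using 1 r by (intro mult_right_mono) auto
  thus ?thesis unfolding 2 3 z_def[symmetric] by (simp add: mult_ac)
qed

lemma N_nonneg: "N \<ge> 0"
  unfolding N_def using w_nonneg by (intro suminf_nonneg summable_w) auto

text \<open>From \<open>|1 - z| ^ 2 = (1 - r) ^ 2 + 2 * r * (1 - cos t)\<close> and
  \<open>r \<ge> 1 / 2\<close> the quotient \<open>(1 - r) / |1 - z|\<close> is at most
  \<open>1 - u / 4\<close>. By \<open>norm_w_cis_le\<close> the cosine sum then misses a proportion
  \<open>u / 4\<close> of the mass \<open>N\<close>, uniformly as \<open>r\<close> approaches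
  \<open>1\<close>; the constant is \<open>192 = 4 * 48\<close>.\<close>

lemma sum_w_cos_le:
  assumes "\<bar>t\<bar> \<le> pi"
  shows "(\<Sum>j. w j * (1 - cos (real (Suc j) * t))) \<ge> N * t\<^sup>2 / 192"
proof -
  define z where "z = of_real r * cis t"
  define u where "u = t\<^sup>2 / 48"
  have "\<bar>t\<bar> \<le> 4" using assms pi_less_4 by linarith
  hence "\<bar>t\<bar>\<^sup>2 \<le> 4\<^sup>2" by (intro power_mono) auto
  hence "t\<^sup>2 \<le> 16" by simp
  moreover have "0 \<le> t\<^sup>2" by simp
  ultimately have u: "0 \<le> u" "u \<le> 1" unfolding u_def by linarith+
  have sc: "summable (\<lambda>j. of_real (w j) * cis (real (Suc j) * t))"
    by (rule summable_comparison_test'[OF summable_w, where N = 0]) (use w_nonneg in \<open>auto simp: norm_mult\<close>)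
  have Re: "Re (\<Sum>j. of_real (w j) * cis (real (Suc j) * t)) = (\<Sum>j. w j * cos (real (Suc j) * t))"
    using bounded_linear.suminf[OF bounded_linear_Re sc] by simp
  have sRe: "summable (\<lambda>j. w j * cos (real (Suc j) * t))"
    using bounded_linear.summable[OF bounded_linear_Re sc] by simp
  have "(cmod (1 - z))\<^sup>2 = (1 - r)\<^sup>2 + 2 * r * (1 - cos t)"
  proof -
    have "(cmod (1 - z))\<^sup>2 = (1 - r * cos t)\<^sup>2 + (r * sin t)\<^sup>2"
      by (simp add: cmod_power2 z_def)
    also have "\<dots> = 1 - 2 * r * cos t + r\<^sup>2 * ((cos t)\<^sup>2 + (sin t)\<^sup>2)"
      by (simp add: power2_eq_square algebra_simps del: sin_cos_squared_add sin_cos_squared_add2 sin_cos_squared_add3)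
    finally show ?thesis by (simp add: power2_eq_square algebra_simps)
  qed
  moreover have "2 * r * (1 - cos t) \<ge> 1 * u"
    unfolding u_def using one_minus_cos_ge[OF assms] r by (intro mult_mono) auto
  ultimately have q: "(cmod (1 - z))\<^sup>2 \<ge> (1 - r)\<^sup>2 + u" by simp
  \<comment> \<open>Uniformity in \<open>r\<close> comes from \<open>(1 - r) ^ 2 \<le> 1\<close>,
    which reduces the claim to \<open>v * (1 + u) \<ge> 1\<close> for
    \<open>0 \<le> u \<le> 1\<close>.\<close>
  have "(1 - r)\<^sup>2 \<le> ((1 - u / 4) * cmod (1 - z))\<^sup>2"
  proof -
    define v where "v = (1 - u / 4)\<^sup>2"
    have v1: "v \<le> 1" unfolding v_def using u by (intro power_le_one) auto
    have "(1 - r)\<^sup>2 \<le> 1" using r by (intro power_le_one) auto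
    hence "(1 - v) * (1 - r)\<^sup>2 \<le> (1 - v) * 1" using v1 by (intro mult_left_mono) auto
    moreover have "v * u \<ge> 1 - v"
    proof -
      have "v * (1 + u) - 1 = u * (8 - 7 * u + u\<^sup>2) / 16"
        unfolding v_def by (simp add: power2_eq_square field_simps)
      moreover have "0 \<le> 8 - 7 * u + u\<^sup>2" using u zero_le_power2[of u] by linarith
      hence "0 \<le> u * (8 - 7 * u + u\<^sup>2)" using u by simp
      ultimately have "v * (1 + u) - 1 \<ge> 0" by linarith
      thus ?thesis by (simp add: distrib_left)
    qed
    ultimately have "(1 - r)\<^sup>2 \<le> v * ((1 - r)\<^sup>2 + u)" by (simp add: algebra_simps)
    also have "\<dots> \<le> v * (cmod (1 - z))\<^sup>2" using q by (intro mult_left_mono) (auto simp: v_def)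
    finally show ?thesis by (simp add: v_def power_mult_distrib)
  qed
  hence d: "1 - r \<le> (1 - u / 4) * cmod (1 - z)"
  proof (rule power2_le_imp_le)
    show "0 \<le> (1 - u / 4) * cmod (1 - z)" using u by (intro mult_nonneg_nonneg) auto
  qed
  have zpos: "cmod (1 - z) > 0"
  proof -
    have "(1 - r)\<^sup>2 > 0" using r by simp
    hence "(cmod (1 - z))\<^sup>2 > 0" using q u by linarith
    thus ?thesis by (simp add: zero_less_power2)
  qed
  have "cmod (1 - z) * cmod (\<Sum>j. of_real (w j) * cis (real (Suc j) * t)) \<le> (1 - r) * N"
    unfolding z_def by (rule norm_w_cis_le)
  also have "\<dots> \<le> (1 - u / 4) * cmod (1 - z) * N" using d N_nonneg by (rule mult_right_mono)
  finally have "cmod (\<Sum>j. of_real (w j) * cis (real (Suc j) * t)) \<le> (1 - u / 4) * N"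
    using zpos by (simp add: mult_ac)
  hence "(\<Sum>j. w j * cos (real (Suc j) * t)) \<le> (1 - u / 4) * N"
    using complex_Re_le_cmod order_trans unfolding Re[symmetric] by blast
  moreover have "(\<Sum>j. w j * (1 - cos (real (Suc j) * t))) = N - (\<Sum>j. w j * cos (real (Suc j) * t))"
    unfolding N_def using suminf_diff[OF summable_w sRe] by (simp add: algebra_simps)
  ultimately show ?thesis by (simp add: u_def algebra_simps)
qed

text \<open>In effect Cauchy-Schwarz: \<open>D\<close> carries the smaller weights
  \<open>w j / Suc j\<close>, so the bound \<open>N * t ^ 2 / 192\<close> for the weights
  \<open>w j\<close> enters squared and divided by \<open>2 * B\<close>. Hence
  \<open>73728 = 2 * 192 ^ 2\<close>.\<close>

lemma D_ge_far:
  assumes "\<bar>t\<bar> \<le> pi" "N > 0"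
  shows "D t \<ge> N\<^sup>2 * t ^ 4 / (73728 * B)"
proof (cases "t = 0")
  case True
  thus ?thesis by (simp add: D_def)
next
  case False
  have B: "B > 0" using N_le_B assms by linarith
  \<comment> \<open>With this choice the error term \<open>B / (2 * l)\<close> is exactly half of
    the lower bound \<open>N * t ^ 2 / 192\<close> and can be absorbed.\<close>
  define l where "l = B / (N * t\<^sup>2 / 192)"
  have l: "l > 0" unfolding l_def using B assms False by simp
  have "(\<Sum>j. w j * (1 - cos (real (Suc j) * t))) \<le>
    (\<Sum>j. l * (w j / real (Suc j) * (1 - cos (real (Suc j) * t))) + real (Suc j) * w j * (1 / (2 * l)))"
  proof (rule suminf_le)
    fix j
    let ?k = "real (Suc j)" let ?c = "1 - cos (?k * t)"
    have k: "?k > 0" by simp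
    have c: "0 \<le> ?c" "?c \<le> 2"
      using cos_ge_minus_one[of "?k * t"] cos_le_one[of "?k * t"] by linarith+
    \<comment> \<open>AM-GM, to get rid of the factor \<open>1 / Suc j\<close> in \<open>D\<close>\<close>
    have "1 \<le> l / ?k + ?k / (4 * l)"
    proof -
      have "0 \<le> (2 * l - ?k)\<^sup>2" by simp
      hence "4 * l * ?k \<le> 4 * l * l + ?k * ?k" by (simp add: power2_eq_square algebra_simps del: of_nat_Suc)
      thus ?thesis using k l by (simp add: field_simps del: of_nat_Suc)
    qed
    hence "w j * ?c * 1 \<le> w j * ?c * (l / ?k + ?k / (4 * l))"
      using w_nonneg[of j] c by (intro mult_left_mono) auto
    also have "\<dots> = l * (w j / ?k * ?c) + ?k * w j * (?c / (4 * l))"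
      by (simp add: algebra_simps add_divide_distrib diff_divide_distrib del: of_nat_Suc)
    also have "\<dots> \<le> l * (w j / ?k * ?c) + ?k * w j * (2 / (4 * l))"
      using w_nonneg[of j] c l by (intro add_left_mono mult_left_mono divide_right_mono) auto
    finally show "w j * ?c \<le> l * (w j / ?k * ?c) + ?k * w j * (1 / (2 * l))" by simp
  next
    show "summable (\<lambda>j. w j * (1 - cos (real (Suc j) * t)))"
    proof (rule summable_comparison_test'[OF summable_mult[OF summable_w, of 2], where N = 0])
      fix j
      have "\<bar>1 - cos (real (Suc j) * t)\<bar> \<le> 2"
        using cos_ge_minus_one[of "real (Suc j) * t"] cos_le_one[of "real (Suc j) * t"] by linarith
      thus "norm (w j * (1 - cos (real (Suc j) * t))) \<le> 2 * w j"
        using mult_left_mono[of _ 2 "w j"] w_nonneg[of j] by (simp add: abs_mult mult.commute[of 2])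
    qed
  qed (intro summable_add summable_mult summable_mult2 summable_D summable_B)
  also have "\<dots> = l * D t + B * (1 / (2 * l))"
    unfolding D_def B_def suminf_mult[OF summable_D, symmetric] suminf_mult2[OF summable_B]
    by (intro suminf_add[symmetric] summable_mult summable_mult2 summable_D summable_B)
  finally have "N * t\<^sup>2 / 192 \<le> l * D t + B * (1 / (2 * l))"
    using sum_w_cos_le[OF assms(1)] by linarith
  moreover have "B * (1 / (2 * l)) = N * t\<^sup>2 / 384"
    unfolding l_def using B assms False by (simp add: field_simps)
  ultimately have "N * t\<^sup>2 / 384 \<le> l * D t" by simp
  hence "N * t\<^sup>2 / 384 / l \<le> D t" using l by (simp add: field_simps)
  moreover have "N * t\<^sup>2 / 384 / l = N\<^sup>2 * t ^ 4 / (73728 * B)"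
    unfolding l_def using B assms False by (simp add: field_simps power2_eq_square power4_eq_xxxx)
  ultimately show ?thesis by simp
qed

text \<open>The value at \<open>r\<close> of the generating function of
  \<open>exp_coeff \<theta>\<close>; dividing by it turns
  \<open>exp_coeff \<theta> k * r ^ k\<close> into a probability distribution in
  \<open>k\<close>.\<close>

definition H where "H = exp (\<Sum>j. w j / real (Suc j))"

text \<open>The index \<open>k\<close> is not tied to \<open>r\<close>: a single saddle point
  controls all coefficients at once. Taking real parts turns the inversion formula into a damped
  cosine integral.\<close>

lemma fourier:
  "((\<lambda>t. exp (- D t) * cos (E t + (N - real k) * t)) has_integral (2 * pi * (exp_coeff \<theta> k * r ^ k / H))) {-pi..pi}"
proof -
  define p where "p = (\<lambda>m. exp_coeff \<theta> m * r ^ m / H)"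
  define F where "F = (\<lambda>t. of_real (exp (- D t)) * cis (E t + N * t))"
  have swj: "summable (\<lambda>j. w j / real (Suc j))"
    using summable_bounded[of "\<lambda>_. 1" 1] by simp
  have H: "H > 0" by (simp add: H_def)
  have Fs: "(\<lambda>m. of_real (p m) * cis (real m * t)) sums F t" for t
  proof -
    have "(\<lambda>m. of_real (exp_coeff \<theta> m) * (of_real r * cis t) ^ m) sums
      exp (\<Sum>j. of_real (\<theta> (Suc j) / real (Suc j)) * (of_real r * cis t) ^ Suc j)"
      by (rule exp_coeff_sums[OF usum]) (use r in \<open>simp add: norm_mult\<close>)
    hence "(\<lambda>m. of_real (exp_coeff \<theta> m) * (of_real r * cis t) ^ m / of_real H) sums
      (exp (\<Sum>j. of_real (\<theta> (Suc j) / real (Suc j)) * (of_real r * cis t) ^ Suc j) / of_real H)"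
      by (rule sums_divide)
    moreover have "(\<lambda>m. of_real (exp_coeff \<theta> m) * (of_real r * cis t) ^ m / of_real H) =
        (\<lambda>m. of_real (p m) * cis (real m * t))"
      by (simp only: cis_power) (simp add: p_def fun_eq_iff)
    moreover have "(\<Sum>j. of_real (\<theta> (Suc j) / real (Suc j)) * (of_real r * cis t) ^ Suc j) =
      of_real (\<Sum>j. w j / real (Suc j)) + (of_real (- D t) + \<i> * of_real (E t + N * t))"
    proof -
      have c: "(\<lambda>j. w j / real (Suc j) * cos (real (Suc j) * t)) sums ((\<Sum>j. w j / real (Suc j)) - D t)"
      proof -
        have "w j / real (Suc j) - w j / real (Suc j) * (1 - cos (real (Suc j) * t)) = w j / real (Suc j) * cos (real (Suc j) * t)" for j
          by (simp add: right_diff_distrib del: of_nat_Suc)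
        thus ?thesis using sums_diff[OF summable_sums[OF swj] summable_sums[OF summable_D[of t]]]
          by (simp only: D_def)
      qed
      have s: "(\<lambda>j. w j / real (Suc j) * sin (real (Suc j) * t)) sums (E t + N * t)"
        using summable_sums[OF summable_sin[of t]] by (simp add: E_eq)
      have "(\<lambda>j. of_real (w j / real (Suc j) * cos (real (Suc j) * t)) + \<i> * of_real (w j / real (Suc j) * sin (real (Suc j) * t))) sums
        (of_real ((\<Sum>j. w j / real (Suc j)) - D t) + \<i> * of_real (E t + N * t))"
        by (intro sums_add sums_mult sums_of_real c s)
      moreover have "of_real (\<theta> (Suc j) / real (Suc j)) * (of_real r * cis t) ^ Suc j =
        of_real (w j / real (Suc j) * cos (real (Suc j) * t)) + \<i> * of_real (w j / real (Suc j) * sin (real (Suc j) * t))" for j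
        unfolding cis_power by (simp add: complex_eq_iff w_def del: of_nat_Suc power_Suc)
      ultimately show ?thesis by (simp add: sums_iff del: of_nat_Suc power_Suc)
    qed
    moreover have "exp (of_real (\<Sum>j. w j / real (Suc j)) + (of_real (- D t) + \<i> * of_real (E t + N * t))) / of_real H = F t"
      unfolding F_def H_def exp_add exp_of_real cis_conv_exp by simp
    ultimately show ?thesis by simp
  qed
  have sp: "summable (\<lambda>m. \<bar>p m\<bar>)"
  proof -
    have "summable (\<lambda>m. exp_coeff \<theta> m * r ^ m)"
      using exp_coeff_sums_real[OF usum, of r] r by (auto simp: sums_iff)
    hence "summable (\<lambda>m. exp_coeff \<theta> m * r ^ m / H)" by (rule summable_divide)
    moreover have "\<bar>p m\<bar> = exp_coeff \<theta> m * r ^ m / H" for m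
      unfolding p_def using exp_coeff_nonneg[of \<theta>] nonneg r H by simp
    ultimately show ?thesis by simp
  qed
  have "((\<lambda>t. F t * cis (- (real k * t))) has_integral of_real (2 * pi * p k)) {-pi..pi}"
    by (rule has_integral_fourier_coeff[OF sp Fs])
  hence "((\<lambda>t. Re (F t * cis (- (real k * t)))) has_integral Re (of_real (2 * pi * p k))) {-pi..pi}"
    by (rule has_integral_Re)
  moreover have "F t * cis (- (real k * t)) = of_real (exp (- D t)) * cis (E t + (N - real k) * t)" for t
    unfolding F_def mult.assoc cis_mult by (simp add: algebra_simps)
  ultimately show ?thesis by (simp add: p_def)
qed

end

section \<open>Coefficient bounds when the mean \<open>N\<close> equals \<open>n\<close>\<close>

context saddle
begin

context
  fixes n :: nat
  assumes N: "N = real n" and T: "T \<le> real n powr (33 / 32)"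
    and n1: "real n powr (1 / 8) \<ge> 4" and n2: "real n powr (11 / 32) \<ge> 73728"
begin

lemma n_pos: "real n > 0"
  using n1 by (cases n) auto

lemma n_ge_1: "real n \<ge> 1"
  using n_pos by simp

text \<open>Up to \<open>n powr (- 1 / 8)\<close> the cubic error is dominated by the quadratic
  term: \<open>T * |t| \<le> n powr (29 / 32) \<le> n \<le> B\<close>.\<close>

lemma near_D:
  assumes "\<bar>t\<bar> \<le> real n powr (- 1 / 8)"
  shows "B * t\<^sup>2 / 4 \<le> D t"
proof -
  have "T * \<bar>t\<bar> \<le> real n powr (33 / 32) * real n powr (- 1 / 8)"
    using T assms by (intro mult_mono) auto
  also have "\<dots> = real n powr (29 / 32)" by (simp add: powr_add[symmetric])
  also have "\<dots> \<le> real n powr 1" using n_ge_1 by (intro powr_mono) auto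
  also have "\<dots> \<le> B" using N_le_B N n_pos by simp
  finally have "T * \<bar>t\<bar> * (t\<^sup>2 / 6) \<le> B * (t\<^sup>2 / 6)" by (rule mult_right_mono) simp
  moreover have "T * \<bar>t\<bar> * (t\<^sup>2 / 6) = T * \<bar>t\<bar> ^ 3 / 6"
  proof -
    have "\<bar>t\<bar> ^ 3 = \<bar>t\<bar> * \<bar>t\<bar>\<^sup>2" by (simp only: power3_eq_cube power2_eq_square mult.assoc)
    thus ?thesis by simp
  qed
  ultimately have "T * \<bar>t\<bar> ^ 3 / 6 \<le> B * (t\<^sup>2 / 6)" by linarith
  moreover have "B * t\<^sup>2 \<ge> 0" using B_nonneg by simp
  ultimately show ?thesis using D_ge[of t] by linarith
qed

text \<open>The shorter range makes the cubic phase error harmless: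
  \<open>33 / 32 - 3 * 3 / 8\<close> is negative. A phase of size at most \<open>1\<close> keeps the
  cosine above \<open>1 / 2\<close>.\<close>

lemma near_E:
  assumes "\<bar>t\<bar> \<le> real n powr (- 3 / 8)"
  shows "\<bar>E t\<bar> \<le> 1"
proof -
  have "\<bar>t\<bar> ^ 3 \<le> (real n powr (- 3 / 8)) ^ 3" using assms by (intro power_mono) auto
  also have "\<dots> = real n powr (- 9 / 8)" using n_pos by (simp add: powr_power)
  finally have "T * \<bar>t\<bar> ^ 3 \<le> real n powr (33 / 32) * real n powr (- 9 / 8)"
    using T by (intro mult_mono) auto
  also have "\<dots> = real n powr (- 3 / 32)" by (simp add: powr_add[symmetric])
  also have "\<dots> \<le> real n powr 0" using n_ge_1 by (intro powr_mono) auto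
  finally show ?thesis using E_le[of t] n_pos by simp
qed

text \<open>Two regimes: up to \<open>n powr (- 1 / 8)\<close> the quadratic term gives order
  \<open>n powr (1 / 4)\<close>; beyond, \<open>D_ge_far\<close> gives order
  \<open>n powr (15 / 32)\<close>. The size assumptions on \<open>n\<close> absorb the constants
  \<open>4\<close> and \<open>73728\<close>.\<close>

lemma far_D:
  assumes "\<bar>t\<bar> \<ge> real n powr (- 3 / 8)" "\<bar>t\<bar> \<le> pi"
  shows "real n powr (1 / 8) \<le> D t"
proof (cases "\<bar>t\<bar> \<le> real n powr (- 1 / 8)")
  case True
  have "(real n powr (- 3 / 8))\<^sup>2 \<le> \<bar>t\<bar>\<^sup>2" using assms by (intro power_mono) auto
  moreover have "(real n powr (- 3 / 8))\<^sup>2 = real n powr (- 3 / 4)" using n_pos by (simp add: powr_power)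
  ultimately have t: "real n powr (- 3 / 4) \<le> t\<^sup>2" by simp
  have "real n powr 1 * real n powr (- 3 / 4) \<le> B * t\<^sup>2"
    using N_le_B N n_pos t by (intro mult_mono) auto
  moreover have "real n powr 1 * real n powr (- 3 / 4) = real n powr (1 / 4)"
    unfolding powr_add[symmetric] by simp
  ultimately have "real n powr (1 / 4) \<le> B * t\<^sup>2" by linarith
  moreover have "real n powr (1 / 8) * 4 \<le> real n powr (1 / 8) * real n powr (1 / 8)"
    using n1 by (intro mult_left_mono) auto
  moreover have "real n powr (1 / 8) * real n powr (1 / 8) = real n powr (1 / 4)"
    by (simp add: powr_add[symmetric])
  ultimately show ?thesis using near_D[OF True] by linarith
next
  case False
  have B: "B > 0" "B \<le> real n powr (33 / 32)" using N_le_B N n_pos B_le_T T by linarith+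
  have "(real n powr (- 1 / 8)) ^ 4 \<le> \<bar>t\<bar> ^ 4" using False by (intro power_mono) auto
  moreover have "(real n powr (- 1 / 8)) ^ 4 = real n powr (- 1 / 2)" using n_pos by (simp add: powr_power)
  ultimately have t: "real n powr (- 1 / 2) \<le> t ^ 4" by simp
  have "real n powr (1 / 8) * (73728 * B) \<le> real n powr (1 / 8) * (real n powr (11 / 32) * real n powr (33 / 32))"
    using n2 B by (intro mult_left_mono mult_mono) auto
  also have "\<dots> = real n powr 2 * real n powr (- 1 / 2)" unfolding powr_add[symmetric] by simp
  also have "\<dots> \<le> N\<^sup>2 * t ^ 4" using t N n_pos by (intro mult_mono) (auto simp: powr_numeral)
  finally have "real n powr (1 / 8) \<le> N\<^sup>2 * t ^ 4 / (73728 * B)" using B by (simp add: field_simps)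
  also have "\<dots> \<le> D t" using D_ge_far[OF assms(2)] N n_pos by simp
  finally show ?thesis .
qed

text \<open>Since \<open>exp x \<ge> 1 + x\<close>, a Lorentz profile can replace the Gaussian. It
  has an elementary antiderivative and still integrates to the right order
  \<open>1 / sqrt B\<close>.\<close>

lemma exp_D_le:
  assumes "\<bar>t\<bar> \<le> pi"
  shows "exp (- D t) \<le> inverse (1 + B * t\<^sup>2 / 4) + exp (- (real n powr (1 / 8)))"
proof (cases "\<bar>t\<bar> \<le> real n powr (- 3 / 8)")
  case True
  have "real n powr (- 3 / 8) \<le> real n powr (- 1 / 8)" using n_ge_1 by (intro powr_mono) auto
  hence "1 + B * t\<^sup>2 / 4 \<le> 1 + D t" using near_D[of t] True by simp
  also have "\<dots> \<le> exp (D t)" by (rule exp_ge_add_one_self)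
  finally have "inverse (exp (D t)) \<le> inverse (1 + B * t\<^sup>2 / 4)"
    using B_nonneg by (intro le_imp_inverse_le add_pos_nonneg) auto
  thus ?thesis by (simp add: exp_minus add_increasing2)
next
  case False
  have "exp (- D t) \<le> exp (- (real n powr (1 / 8)))" using far_D[of t] False assms by simp
  moreover have "inverse (1 + B * t\<^sup>2 / 4) \<ge> 0" using B_nonneg by simp
  ultimately show ?thesis by linarith
qed

lemma B_pos: "B > 0" and sqrt_B_le: "sqrt B \<le> real n"
proof -
  show "B > 0" using N_le_B N n_pos by linarith
  have "B \<le> real n powr 2" using B_le_T T powr_mono[of "33/32" 2 "real n"] n_ge_1 by linarith
  hence "B \<le> (real n)\<^sup>2" using n_pos by (simp add: powr_numeral)
  thus "sqrt B \<le> real n" by (intro real_le_lsqrt) auto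
qed

lemma integral_Lorentz: "\<exists>J. ((\<lambda>t. inverse (1 + B * t\<^sup>2 / 4)) has_integral J) {-pi..pi} \<and> J \<le> 2 * pi / sqrt B"
proof -
  define s where "s = sqrt B / 2"
  let ?s = s
  have s: "?s > 0" using B_pos by (simp add: s_def)
  have sq: "(?s * t)\<^sup>2 = B * t\<^sup>2 / 4" for t
    using B_pos by (simp add: s_def power_mult_distrib power_divide)
  have "((\<lambda>t. inverse (1 + B * t\<^sup>2 / 4)) has_integral (arctan (?s * pi) / ?s - arctan (?s * (- pi)) / ?s)) {-pi..pi}"
  proof (rule fundamental_theorem_of_calculus)
    fix t :: real
    have d: "((\<lambda>t. arctan (?s * t) / ?s) has_real_derivative (inverse (1 + (?s * t)\<^sup>2) * ?s) / ?s) (at t within {-pi..pi})"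
      using s by (auto intro!: derivative_eq_intros)
    have eq: "(inverse (1 + (?s * t)\<^sup>2) * ?s) / ?s = inverse (1 + (?s * t)\<^sup>2)"
      by (rule nonzero_mult_div_cancel_right) (use s in linarith)
    show "((\<lambda>t. arctan (?s * t) / ?s) has_vector_derivative inverse (1 + B * t\<^sup>2 / 4)) (at t within {-pi..pi})"
      using d[unfolded eq, unfolded sq has_real_derivative_iff_has_vector_derivative] .
  qed auto
  moreover have "arctan (?s * pi) / ?s - arctan (?s * (- pi)) / ?s \<le> 2 * pi / sqrt B"
  proof -
    have "arctan (?s * pi) / ?s - arctan (?s * (- pi)) / ?s = 2 * arctan (?s * pi) / ?s"
      by (simp add: arctan_minus)
    also have "\<dots> \<le> 2 * (pi / 2) / ?s"
      using s arctan_ubound[of "?s * pi"] by (intro divide_right_mono mult_left_mono) auto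
    finally show ?thesis by (simp add: s_def field_simps)
  qed
  ultimately show ?thesis by blast
qed

lemma coeff_upper:
  "exp_coeff \<theta> k * r ^ k / H \<le> 1 / sqrt B + exp (- (real n powr (1 / 8)))"
proof -
  let ?e = "exp (- (real n powr (1 / 8)))"
  obtain J where J: "((\<lambda>t. inverse (1 + B * t\<^sup>2 / 4)) has_integral J) {-pi..pi}" "J \<le> 2 * pi / sqrt B"
    using integral_Lorentz by blast
  have c: "((\<lambda>t. ?e) has_integral (2 * pi * ?e)) {-pi..pi}"
    using has_integral_const_real[of ?e "-pi" pi] by simp
  have "2 * pi * (exp_coeff \<theta> k * r ^ k / H) \<le> J + 2 * pi * ?e"
  proof (rule has_integral_le[OF fourier has_integral_add[OF J(1) c]])
    fix t assume "t \<in> {-pi..pi}"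
    hence "\<bar>t\<bar> \<le> pi" by auto
    have "exp (- D t) * cos (E t + (N - real k) * t) \<le> exp (- D t)" by simp
    thus "exp (- D t) * cos (E t + (N - real k) * t) \<le> inverse (1 + B * t\<^sup>2 / 4) + ?e"
      using exp_D_le[OF \<open>\<bar>t\<bar> \<le> pi\<close>] by linarith
  qed
  also have "\<dots> \<le> 2 * pi * (1 / sqrt B + ?e)" using J(2) by (simp add: algebra_simps)
  finally have "2 * pi * (exp_coeff \<theta> k * r ^ k / H) \<le> 2 * pi * (1 / sqrt B + ?e)" .
  thus ?thesis by (subst (asm) mult_le_cancel_left_pos) auto
qed

text \<open>At \<open>k = n\<close> the linear phase vanishes. Then the integrand is at least
  \<open>1 / 2 * (1 / 2)\<close> for \<open>|t| \<le> 1 / sqrt B\<close>, nonnegative in the rest of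
  the near range, and exponentially small beyond it.\<close>

lemma coeff_lower:
  "1 / (4 * pi * sqrt B) - exp (- (real n powr (1 / 8))) \<le> exp_coeff \<theta> n * r ^ n / H"
proof -
  let ?e = "exp (- (real n powr (1 / 8)))"
  define \<delta> where "\<delta> = 1 / sqrt B"
  have \<delta>: "0 < \<delta>" using B_pos by (simp add: \<delta>_def)
  have sB: "sqrt B \<ge> real n powr (1 / 2)" using N_le_B N n_pos by (simp add: powr_half_sqrt)
  have "\<delta> \<le> 1 / real n powr (1 / 2)"
    unfolding \<delta>_def using sB n_pos by (intro frac_le) auto
  also have "\<dots> = real n powr (- 1 / 2)" by (simp add: powr_minus_divide)
  finally have \<delta>1: "\<delta> \<le> real n powr (- 1 / 2)" .
  have \<delta>2: "\<delta> \<le> real n powr (- 3 / 8)" using \<delta>1 powr_mono[of "-1/2" "-3/8" "real n"] n_ge_1 by simp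
  have "real n powr (- 3 / 8) \<le> real n powr 0" using n_ge_1 by (intro powr_mono) auto
  hence \<delta>3: "\<delta> \<le> pi" using \<delta>2 pi_gt3 n_pos by simp
  have c: "((\<lambda>t. - ?e) has_integral (- (2 * pi * ?e))) {-pi..pi}"
    using has_integral_const_real[of "- ?e" "-pi" pi] by simp
  have "((\<lambda>t. 1 / 4) has_integral (2 * \<delta> * (1 / 4))) {-\<delta>..\<delta>}"
    using has_integral_const_real[of "1 / 4 :: real" "-\<delta>" \<delta>] \<delta> by simp
  hence i: "((\<lambda>t. if t \<in> {-\<delta>..\<delta>} then 1 / 4 else 0) has_integral (2 * \<delta> * (1 / 4))) {-pi..pi}"
    by (subst has_integral_restrict) (use \<delta>3 in auto)
  have "2 * \<delta> * (1 / 4) + - (2 * pi * ?e) \<le> 2 * pi * (exp_coeff \<theta> n * r ^ n / H)"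
  proof (rule has_integral_le[OF has_integral_add[OF i c] fourier])
    fix t assume "t \<in> {-pi..pi}"
    hence tpi: "\<bar>t\<bar> \<le> pi" by auto
    have cosx: "cos x \<ge> 1 / 2" if "\<bar>x\<bar> \<le> 1" for x :: real
    proof -
      have "\<bar>x\<bar>\<^sup>2 \<le> 1\<^sup>2" using that by (intro power_mono) auto
      thus ?thesis using cos_sin_Taylor(1)[of x] by (simp add: abs_le_iff)
    qed
    have "(if t \<in> {-\<delta>..\<delta>} then 1 / 4 else 0) + - ?e \<le> exp (- D t) * cos (E t)"
    proof (cases "\<bar>t\<bar> \<le> real n powr (- 3 / 8)")
      case True
      have cE: "cos (E t) \<ge> 1 / 2" by (rule cosx[OF near_E[OF True]])
      show ?thesis
      proof (cases "t \<in> {-\<delta>..\<delta>}")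
        case t: True
        hence "\<bar>t\<bar>\<^sup>2 \<le> \<delta>\<^sup>2" by (intro power_mono) auto
        hence "B * t\<^sup>2 / 2 \<le> B * \<delta>\<^sup>2 / 2" using B_nonneg by (simp add: mult_left_mono)
        also have "\<dots> = 1 / 2" using B_pos by (simp add: \<delta>_def power_divide)
        finally have "D t \<le> 1 / 2" using D_le[of t] by linarith
        hence "exp (- D t) \<ge> 1 / 2" using exp_ge_add_one_self[of "- D t"] by linarith
        hence "1 / 2 * (1 / 2) \<le> exp (- D t) * cos (E t)" using cE by (intro mult_mono) auto
        moreover have "?e > 0" by simp
        ultimately show ?thesis unfolding if_P[OF t] by linarith
      next
        case False
        have "exp (- D t) * cos (E t) \<ge> 0" using cE by simp
        moreover have "?e > 0" by simp
        ultimately show ?thesis using False by (auto intro: order_trans[of "- ?e" 0])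
      qed
    next
      case False
      have "\<bar>exp (- D t) * cos (E t)\<bar> \<le> exp (- D t)" by (simp add: abs_mult)
      also have "\<dots> \<le> ?e" using far_D[of t] False tpi by simp
      finally have "exp (- D t) * cos (E t) \<ge> - ?e" by linarith
      moreover have "t \<notin> {-\<delta>..\<delta>}" using False \<delta>2 by auto
      ultimately show ?thesis by (simp only: if_False)
    qed
    thus "(if t \<in> {-\<delta>..\<delta>} then 1 / 4 else 0) + - ?e \<le> exp (- D t) * cos (E t + (N - real n) * t)"
      using N by simp
  qed
  moreover have "2 * pi * (\<delta> / (4 * pi) - ?e) = 2 * \<delta> * (1 / 4) + - (2 * pi * ?e)"
    by (simp add: right_diff_distrib)
  ultimately have "2 * pi * (\<delta> / (4 * pi) - ?e) \<le> 2 * pi * (exp_coeff \<theta> n * r ^ n / H)"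
    by (simp only:)
  hence "\<delta> / (4 * pi) - ?e \<le> exp_coeff \<theta> n * r ^ n / H" by (subst (asm) mult_le_cancel_left_pos) auto
  thus ?thesis by (simp add: \<delta>_def field_simps)
qed

text \<open>Lowering the index by one shifts the phase by \<open>t\<close>, which changes the cosine
  by at most \<open>|t|\<close>. In the near range this gains a factor
  \<open>n powr (- 3 / 8)\<close> over the size of the coefficients.\<close>

lemma coeff_diff:
  assumes "n = Suc m"
  shows "\<bar>exp_coeff \<theta> n * r ^ n / H - exp_coeff \<theta> m * r ^ m / H\<bar> \<le>
    real n powr (- 3 / 8) / sqrt B + pi * exp (- (real n powr (1 / 8)))"
proof -
  let ?e = "exp (- (real n powr (1 / 8)))" let ?t1 = "real n powr (- 3 / 8)"
  obtain J where J: "((\<lambda>t. inverse (1 + B * t\<^sup>2 / 4)) has_integral J) {-pi..pi}" "J \<le> 2 * pi / sqrt B"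
    using integral_Lorentz by blast
  have c: "((\<lambda>t. pi * ?e) has_integral (2 * pi * (pi * ?e))) {-pi..pi}"
    using has_integral_const_real[of "pi * ?e" "-pi" pi] by simp
  have g: "((\<lambda>t. ?t1 * inverse (1 + B * t\<^sup>2 / 4) + pi * ?e) has_integral (?t1 * J + 2 * pi * (pi * ?e))) {-pi..pi}"
    by (rule has_integral_add[OF has_integral_mult_right[OF J(1)] c])
  have f: "((\<lambda>t. exp (- D t) * cos (E t + (N - real n) * t) - exp (- D t) * cos (E t + (N - real m) * t)) has_integral
    (2 * pi * (exp_coeff \<theta> n * r ^ n / H) - 2 * pi * (exp_coeff \<theta> m * r ^ m / H))) {-pi..pi}"
    by (rule has_integral_diff[OF fourier fourier])
  have bd: "\<bar>exp (- D t) * cos (E t + (N - real n) * t) - exp (- D t) * cos (E t + (N - real m) * t)\<bar>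
    \<le> ?t1 * inverse (1 + B * t\<^sup>2 / 4) + pi * ?e" if "t \<in> {-pi..pi}" for t
  proof -
    have tpi: "\<bar>t\<bar> \<le> pi" using that by auto
    have "\<bar>cos (E t) - cos (E t + t)\<bar> \<le> \<bar>t\<bar>"
    proof -
      have "cos (E t) - cos (E t + t) = 2 * sin (E t + t / 2) * sin (t / 2)"
      proof -
        have "(E t + (E t + t)) / 2 = E t + t / 2" "(E t + t - E t) / 2 = t / 2" by (simp_all add: field_simps)
        thus ?thesis using cos_diff_cos[of "E t" "E t + t"] by (simp only:)
      qed
      hence "\<bar>cos (E t) - cos (E t + t)\<bar> = 2 * (\<bar>sin (E t + t / 2)\<bar> * \<bar>sin (t / 2)\<bar>)"
        by (simp add: abs_mult)
      also have "\<dots> \<le> 2 * (1 * \<bar>t / 2\<bar>)"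
        using abs_sin_x_le_abs_x[of "t / 2"] by (intro mult_left_mono mult_mono) auto
      finally show ?thesis by simp
    qed
    hence "\<bar>exp (- D t) * cos (E t) - exp (- D t) * cos (E t + t)\<bar> \<le> exp (- D t) * \<bar>t\<bar>"
      unfolding right_diff_distrib[symmetric] abs_mult by (simp add: mult_left_mono)
    also have "\<dots> \<le> ?t1 * inverse (1 + B * t\<^sup>2 / 4) + pi * ?e"
    proof (cases "\<bar>t\<bar> \<le> ?t1")
      case True
      have "?t1 \<le> real n powr (- 1 / 8)" using n_ge_1 by (intro powr_mono) auto
      hence "1 + B * t\<^sup>2 / 4 \<le> 1 + D t" using near_D[of t] True by simp
      also have "\<dots> \<le> exp (D t)" by (rule exp_ge_add_one_self)
      finally have "inverse (exp (D t)) \<le> inverse (1 + B * t\<^sup>2 / 4)"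
        using B_nonneg by (intro le_imp_inverse_le add_pos_nonneg) auto
      hence "exp (- D t) * \<bar>t\<bar> \<le> inverse (1 + B * t\<^sup>2 / 4) * ?t1"
        using True B_nonneg by (intro mult_mono) (auto simp: exp_minus)
      thus ?thesis by (simp add: mult.commute add_increasing2)
    next
      case False
      have "exp (- D t) * \<bar>t\<bar> \<le> ?e * pi"
        using far_D[of t] False tpi by (intro mult_mono) auto
      moreover have "?t1 * inverse (1 + B * t\<^sup>2 / 4) \<ge> 0" using B_nonneg by simp
      ultimately show ?thesis by (simp add: mult.commute)
    qed
    finally show ?thesis using N assms by (simp add: algebra_simps)
  qed
  have "2 * pi * (exp_coeff \<theta> n * r ^ n / H) - 2 * pi * (exp_coeff \<theta> m * r ^ m / H) \<le> ?t1 * J + 2 * pi * (pi * ?e)"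
    by (rule has_integral_le[OF f g]) (use bd in \<open>fastforce simp: abs_le_iff\<close>)
  moreover have "- (?t1 * J + 2 * pi * (pi * ?e)) \<le> 2 * pi * (exp_coeff \<theta> n * r ^ n / H) - 2 * pi * (exp_coeff \<theta> m * r ^ m / H)"
  proof (rule has_integral_le[OF has_integral_neg[OF g] f])
    fix t assume "t \<in> {-pi..pi}"
    from bd[OF this] show "- (?t1 * inverse (1 + B * t\<^sup>2 / 4) + pi * ?e) \<le>
      exp (- D t) * cos (E t + (N - real n) * t) - exp (- D t) * cos (E t + (N - real m) * t)" by linarith
  qed
  moreover have "?t1 * J \<le> ?t1 * (2 * pi / sqrt B)" using J(2) by (intro mult_left_mono) auto
  ultimately have "\<bar>2 * pi * (exp_coeff \<theta> n * r ^ n / H) - 2 * pi * (exp_coeff \<theta> m * r ^ m / H)\<bar> \<le>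
    ?t1 * (2 * pi / sqrt B) + 2 * pi * (pi * ?e)" by linarith
  hence "2 * pi * \<bar>exp_coeff \<theta> n * r ^ n / H - exp_coeff \<theta> m * r ^ m / H\<bar> \<le> 2 * pi * (?t1 / sqrt B + pi * ?e)"
    unfolding right_diff_distrib[symmetric] abs_mult by (simp add: algebra_simps)
  thus ?thesis by (subst (asm) mult_le_cancel_left_pos) auto
qed

text \<open>As \<open>sqrt B \<le> n\<close>, the assumption makes the exponential error at most
  half of the lower bound \<open>1 / (4 * pi * sqrt B)\<close>. The upper bound
  \<open>2 / sqrt B\<close> and the remaining lower bound \<open>1 / (8 * pi * sqrt B)\<close>
  differ by the factor \<open>16 * pi\<close>.\<close>

lemma coeff_compare:
  assumes e: "8 * pi * real n * exp (- (real n powr (1 / 8))) \<le> 1"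
  shows "exp_coeff \<theta> k * r ^ k \<le> 16 * pi * (exp_coeff \<theta> n * r ^ n)"
    and "n = Suc m \<Longrightarrow> \<bar>exp_coeff \<theta> n * r ^ n - exp_coeff \<theta> m * r ^ m\<bar> \<le>
      8 * pi * (real n powr (- 3 / 8) + pi * (real n * exp (- (real n powr (1 / 8))))) * (exp_coeff \<theta> n * r ^ n)"
proof -
  let ?e = "exp (- (real n powr (1 / 8)))"
  let ?p = "\<lambda>k. exp_coeff \<theta> k * r ^ k / H"
  have H: "H > 0" by (simp add: H_def)
  have sB: "sqrt B > 0" using B_pos by simp
  have "sqrt B * ?e \<le> real n * ?e" using sqrt_B_le by (rule mult_right_mono) simp
  hence Be: "8 * pi * (sqrt B * ?e) \<le> 1"
  proof -
    have "8 * pi * (sqrt B * ?e) \<le> 8 * pi * (real n * ?e)"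
      by (rule mult_left_mono[OF \<open>sqrt B * ?e \<le> real n * ?e\<close>]) simp
    thus ?thesis using e by (simp only: mult.assoc)
  qed
  have "sqrt B * ?e \<le> 1"
  proof -
    have "1 * (sqrt B * ?e) \<le> 8 * pi * (sqrt B * ?e)" using pi_gt3 sB by (intro mult_right_mono) auto
    thus ?thesis using Be by linarith
  qed
  hence up: "?p k \<le> 2 / sqrt B" for k
    using coeff_upper[of k] sB by (simp add: field_simps)
  have "?e \<le> 1 / (8 * pi * sqrt B)" using Be sB by (simp add: field_simps)
  moreover have "1 / (4 * pi * sqrt B) = 1 / (8 * pi * sqrt B) + 1 / (8 * pi * sqrt B)" by (simp add: field_simps)
  ultimately have lo: "1 / (8 * pi * sqrt B) \<le> ?p n" using coeff_lower by linarith
  hence lo': "1 / sqrt B \<le> 8 * pi * ?p n" using sB by (simp add: field_simps)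
  have "?p k \<le> 16 * pi * ?p n" using up[of k] lo' by simp
  thus "exp_coeff \<theta> k * r ^ k \<le> 16 * pi * (exp_coeff \<theta> n * r ^ n)" using H by (simp add: field_simps)
  assume m: "n = Suc m"
  have "\<bar>?p n - ?p m\<bar> \<le> (real n powr (- 3 / 8) + pi * (sqrt B * ?e)) * (1 / sqrt B)"
    using coeff_diff[OF m] sB by (simp add: field_simps)
  also have "\<dots> \<le> (real n powr (- 3 / 8) + pi * (real n * ?e)) * (8 * pi * ?p n)"
    using lo' sB sqrt_B_le by (intro mult_mono add_left_mono mult_left_mono mult_right_mono) auto
  also have "\<bar>?p n - ?p m\<bar> = \<bar>exp_coeff \<theta> n * r ^ n - exp_coeff \<theta> m * r ^ m\<bar> / H"
    using H by (simp add: diff_divide_distrib[symmetric])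
  finally show "\<bar>exp_coeff \<theta> n * r ^ n - exp_coeff \<theta> m * r ^ m\<bar> \<le>
      8 * pi * (real n powr (- 3 / 8) + pi * (real n * ?e)) * (exp_coeff \<theta> n * r ^ n)"
    using H by (simp add: field_simps)
qed

end

end

section \<open>Power series with an exponential singularity\<close>

lemma unit_disc_summableI:
  assumes "\<And>n. a n \<ge> 0" "\<And>x. 0 \<le> x \<Longrightarrow> x < 1 \<Longrightarrow> (\<lambda>n. a n * x ^ n) sums f x"
  shows "unit_disc_summable a"
  unfolding unit_disc_summable_def using assms by (auto simp: sums_iff)

lemma unit_disc_sums_cauchy:
  fixes x :: real
  assumes "unit_disc_summable a" "unit_disc_summable d" "\<bar>x\<bar> < 1"
    and "(\<lambda>n. a n * x ^ n) sums F" "(\<lambda>n. d n * x ^ n) sums G"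
  shows "(\<lambda>n. (\<Sum>i\<le>n. a i * d (n - i)) * x ^ n) sums (F * G)"
proof -
  have "(\<lambda>n. \<Sum>i\<le>n. (a i * x ^ i) * (d (n - i) * x ^ (n - i))) sums
      ((\<Sum>n. a n * x ^ n) * (\<Sum>n. d n * x ^ n))"
    by (rule Cauchy_product_sums)
      (use unit_disc_summableD(1)[OF assms(1), of x] unit_disc_summableD(1)[OF assms(2), of x] assms(3) in auto)
  moreover have "(\<Sum>i\<le>n. (a i * x ^ i) * (d (n - i) * x ^ (n - i))) = (\<Sum>i\<le>n. a i * d (n - i)) * x ^ n" for n
    unfolding sum_distrib_right
  proof (rule sum.cong[OF refl])
    fix i assume "i \<in> {..n}"
    hence "x ^ n = x ^ i * x ^ (n - i)" by (simp add: power_add[symmetric])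
    thus "a i * x ^ i * (d (n - i) * x ^ (n - i)) = a i * d (n - i) * x ^ n" by simp
  qed
  ultimately show ?thesis using assms(4,5) by (simp add: sums_iff)
qed

text \<open>The binomial coefficient of \<open>(1 - x) powr (- s)\<close>, written with a rising
  factorial so that its sign is visible for \<open>s \<ge> 0\<close>.\<close>

definition rising_coeff :: "real \<Rightarrow> nat \<Rightarrow> real" where
  "rising_coeff s n = pochhammer s n / fact n"

lemma rising_coeff_nonneg: "s \<ge> 0 \<Longrightarrow> rising_coeff s n \<ge> 0"
  unfolding rising_coeff_def pochhammer_prod by (intro divide_nonneg_nonneg prod_nonneg) auto

lemma rising_coeff_sums:
  fixes x :: real
  assumes "\<bar>x\<bar> < 1"
  shows "(\<lambda>n. rising_coeff s n * x ^ n) sums (1 - x) powr (- s)"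
proof -
  have "(\<lambda>n. ((- s) gchoose n) * (- x) ^ n) sums (1 + - x) powr (- s)"
    by (rule gen_binomial_real) (use assms in auto)
  moreover have "((- s) gchoose n) * (- x) ^ n = rising_coeff s n * x ^ n" for n
    by (simp add: rising_coeff_def gbinomial_pochhammer power_minus[of x] mult_ac)
  ultimately show ?thesis by simp
qed

lemma unit_disc_summable_rising: "s \<ge> 0 \<Longrightarrow> unit_disc_summable (rising_coeff s)"
  by (rule unit_disc_summableI[OF rising_coeff_nonneg rising_coeff_sums]) auto

text \<open>Splitting one factor \<open>1 / (1 - x)\<close> off \<open>(1 - x) powr (- c)\<close>
  amounts to taking partial sums of the other coefficients. Those are nonnegative because
  \<open>c - 1 \<ge> 0\<close>, so the result is nondecreasing.\<close>

lemma exp_singular_series: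
  fixes A a b c :: real
  assumes "A > 0" "a > 0" "b > 0" "c \<ge> 1"
  obtains g where "\<And>n. g n \<ge> 0" "\<And>n. g n \<le> g (Suc n)" "g 0 > 0"
    "\<And>x. \<bar>x\<bar> < 1 \<Longrightarrow> (\<lambda>n. g n * x ^ n) sums (A * (1 - x) powr (- c) * exp (a * (1 - x) powr (- b)))"
proof -
  \<comment> \<open>The factor \<open>j\<close> cancels the division by \<open>j\<close> in the
    exponent belonging to \<open>exp_coeff\<close>; the constant term \<open>a\<close> of the
    exponent cannot appear there and returns as \<open>exp a\<close> in \<open>v\<close>.\<close>
  define \<eta> where "\<eta> = (\<lambda>j. real j * (a * rising_coeff b j))"
  have \<eta>S: "(\<lambda>j. \<eta> (Suc j)) = diffs (\<lambda>n. a * rising_coeff b n)"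
    by (simp add: \<eta>_def diffs_def fun_eq_iff)
  have "unit_disc_summable (\<lambda>n. a * rising_coeff b n)"
  proof (rule unit_disc_summableI)
    show "a * rising_coeff b n \<ge> 0" for n using assms rising_coeff_nonneg[of b n] by simp
    show "(\<lambda>n. a * rising_coeff b n * x ^ n) sums (a * (1 - x) powr (- b))" if "0 \<le> x" "x < 1" for x
      using sums_mult[OF rising_coeff_sums[of x b], of a] that by (simp add: mult.assoc)
  qed
  hence us: "unit_disc_summable (\<lambda>j. \<eta> (Suc j))" unfolding \<eta>S by (rule unit_disc_summable_diffs)
  have \<eta>0: "\<eta> j \<ge> 0" for j using assms rising_coeff_nonneg[of b j] by (simp add: \<eta>_def)
  define v where "v = (\<lambda>n. A * exp a * exp_coeff \<eta> n)"
  have v0: "v n \<ge> 0" for n unfolding v_def using assms \<eta>0 exp_coeff_nonneg[of \<eta> n] by simp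
  have vs: "(\<lambda>n. v n * x ^ n) sums (A * exp (a * (1 - x) powr (- b)))" if x: "\<bar>x\<bar> < 1" for x
  proof -
    have "(\<lambda>j. (\<lambda>n. a * (rising_coeff b n * x ^ n)) (Suc j)) sums (a * (1 - x) powr (- b) - a * (rising_coeff b 0 * x ^ 0))"
      using sums_mult[OF rising_coeff_sums[OF x, of b], of a] by (subst sums_Suc_iff) simp
    moreover have "\<eta> (Suc j) / real (Suc j) * x ^ Suc j = a * (rising_coeff b (Suc j) * x ^ Suc j)" for j
      by (simp add: \<eta>_def del: of_nat_Suc power_Suc)
    ultimately have "(\<Sum>j. \<eta> (Suc j) / real (Suc j) * x ^ Suc j) = a * (1 - x) powr (- b) - a"
      by (simp add: sums_iff rising_coeff_def del: of_nat_Suc power_Suc)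
    hence "(\<lambda>n. exp_coeff \<eta> n * x ^ n) sums exp (a * (1 - x) powr (- b) - a)"
      using exp_coeff_sums_real[OF us x] by simp
    hence "(\<lambda>n. A * exp a * (exp_coeff \<eta> n * x ^ n)) sums (A * exp a * exp (a * (1 - x) powr (- b) - a))"
      by (rule sums_mult)
    thus ?thesis by (simp add: v_def mult.assoc exp_diff)
  qed
  have uv: "unit_disc_summable v" by (rule unit_disc_summableI[OF v0 vs]) auto
  define \<kappa> where "\<kappa> = (\<lambda>n. \<Sum>i\<le>n. rising_coeff (c - 1) i * v (n - i))"
  have r0: "rising_coeff (c - 1) n \<ge> 0" for n using assms by (intro rising_coeff_nonneg) auto
  have \<kappa>0: "\<kappa> n \<ge> 0" for n unfolding \<kappa>_def using r0 v0 by (intro sum_nonneg) auto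
  have \<kappa>s: "(\<lambda>n. \<kappa> n * x ^ n) sums ((1 - x) powr (- (c - 1)) * (A * exp (a * (1 - x) powr (- b))))" if x: "\<bar>x\<bar> < 1" for x
    unfolding \<kappa>_def
    by (rule unit_disc_sums_cauchy[OF _ uv x rising_coeff_sums[OF x] vs[OF x]]) (use assms unit_disc_summable_rising in auto)
  have u\<kappa>: "unit_disc_summable \<kappa>" by (rule unit_disc_summableI[OF \<kappa>0 \<kappa>s]) auto
  define g where "g = (\<lambda>n. \<Sum>i\<le>n. \<kappa> i)"
  show thesis
  proof
    show "g n \<ge> 0" "g n \<le> g (Suc n)" for n unfolding g_def using \<kappa>0 by (auto intro: sum_nonneg)
    show "g 0 > 0" using assms by (simp add: g_def \<kappa>_def v_def rising_coeff_def)
    fix x :: real assume x: "\<bar>x\<bar> < 1"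
    have "(\<lambda>n. (\<Sum>i\<le>n. \<kappa> i * (\<lambda>_. 1) (n - i)) * x ^ n) sums
        ((1 - x) powr (- (c - 1)) * (A * exp (a * (1 - x) powr (- b))) * (1 / (1 - x)))"
    proof (rule unit_disc_sums_cauchy[OF u\<kappa> _ x \<kappa>s[OF x]])
      show "(\<lambda>n. 1 * x ^ n) sums (1 / (1 - x))" using geometric_sums[of x] x by simp
      show "unit_disc_summable (\<lambda>_. 1)"
      proof (rule unit_disc_summableI)
        show "(\<lambda>n. 1 * x ^ n) sums (1 / (1 - x))" if "0 \<le> x" "x < 1" for x :: real
          using geometric_sums[of x] that by simp
      qed simp
    qed
    moreover have "(1 - x) powr (- (c - 1)) * (1 / (1 - x)) = (1 - x) powr (- c)"
    proof -
      have "1 / (1 - x) = (1 - x) powr (- 1)" using x by (simp add: powr_minus_divide)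
      thus ?thesis unfolding powr_add[symmetric] by (simp only: powr_add[symmetric]) simp
    qed
    hence "(1 - x) powr (- (c - 1)) * (A * exp (a * (1 - x) powr (- b))) * (1 / (1 - x)) =
        A * (1 - x) powr (- c) * exp (a * (1 - x) powr (- b))"
      by (metis mult.commute mult.left_commute)
    ultimately show "(\<lambda>n. g n * x ^ n) sums (A * (1 - x) powr (- c) * exp (a * (1 - x) powr (- b)))"
      by (simp add: g_def)
  qed
qed

text \<open>The expression vanishes at \<open>\<kappa> = 1\<close> with derivative
  \<open>b * (1 - Y)\<close>, so a small move to the right or to the left makes it negative. It is
  the Chernoff exponent on the scale \<open>a * t powr b\<close>.\<close>

lemma derivative_slope_neg:
  fixes b Y :: real
  assumes "b > 0"
  shows "Y > 1 \<Longrightarrow> \<exists>\<kappa>>1. \<kappa> powr b - 1 + Y * b * (1 / \<kappa> - 1) < 0"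
    and "Y < 1 \<Longrightarrow> \<exists>\<kappa>>0. \<kappa> < 1 \<and> \<kappa> powr b - 1 + Y * b * (1 / \<kappa> - 1) < 0"
proof -
  define f where "f = (\<lambda>\<kappa>::real. \<kappa> powr b - 1 + Y * b * (1 / \<kappa> - 1))"
  have d: "DERIV f 1 :> b * (1 - Y)"
    unfolding f_def by (auto intro!: derivative_eq_intros simp: algebra_simps)
  have f1: "f 1 = 0" by (simp add: f_def)
  show "\<exists>\<kappa>>1. \<kappa> powr b - 1 + Y * b * (1 / \<kappa> - 1) < 0" if Y: "Y > 1"
  proof -
    have "b * (1 - Y) < 0" using assms Y by (simp add: mult_pos_neg)
    from DERIV_neg_dec_right[OF d this] obtain e where e: "e > 0" "\<And>h. 0 < h \<Longrightarrow> h < e \<Longrightarrow> f (1 + h) < f 1" by auto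
    have "f (1 + e / 2) < 0" using e(2)[of "e / 2"] e(1) f1 by simp
    thus ?thesis using e(1) by (intro exI[of _ "1 + e / 2"]) (simp add: f_def)
  qed
  show "\<exists>\<kappa>>0. \<kappa> < 1 \<and> \<kappa> powr b - 1 + Y * b * (1 / \<kappa> - 1) < 0" if Y: "Y < 1"
  proof -
    have "b * (1 - Y) > 0" using assms Y by simp
    from DERIV_pos_inc_left[OF d this] obtain e where e: "e > 0" "\<And>h. 0 < h \<Longrightarrow> h < e \<Longrightarrow> f (1 - h) < f 1" by auto
    define h where "h = min (e / 2) (1 / 2)"
    have "f (1 - h) < 0" using e(2)[of h] e(1) f1 by (auto simp: h_def)
    thus ?thesis using e(1) by (intro exI[of _ "1 - h"]) (auto simp: f_def h_def min_def)
  qed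
qed

lemma log_ratio:
  fixes \<kappa> :: real
  assumes "\<kappa> > 0"
  shows "((\<lambda>t. (ln (1 - 1 / t) - ln (1 - 1 / (\<kappa> * t))) * t) \<longlongrightarrow> 1 / \<kappa> - 1) at_top"
proof -
  have "((\<lambda>t::real. ln (1 - 1 / t) * t) \<longlongrightarrow> - 1) at_top" by real_asymp
  moreover have "((\<lambda>t::real. ln (1 - 1 / (\<kappa> * t)) * t) \<longlongrightarrow> - inverse \<kappa>) at_top"
    using assms by real_asymp
  ultimately have "((\<lambda>t. ln (1 - 1 / t) * t - ln (1 - 1 / (\<kappa> * t)) * t) \<longlongrightarrow> - 1 - - inverse \<kappa>) at_top"
    by (rule tendsto_diff)
  thus ?thesis by (simp add: left_diff_distrib divide_inverse)
qed

lemma ln_over_powr_tendsto_0: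
  fixes b :: real
  assumes "b > 0"
  shows "((\<lambda>t. ln t / t powr b) \<longlongrightarrow> 0) at_top"
  using assms by real_asymp

context
  fixes a b c A :: real
  assumes pos: "a > 0" "b > 0" "A > 0"
begin

lemma log_saddle_at_top:
  "filterlim (\<lambda>t. ln (1 - 1 / t) + ln A + c * ln t + a * t powr b) at_top at_top"
  using pos by real_asymp

lemma log_saddle_equiv:
  "((\<lambda>t. (ln (1 - 1 / t) + ln A + c * ln t + a * t powr b) / t powr b) \<longlongrightarrow> a) at_top"
  using pos by real_asymp

lemma log_saddle_shift:
  assumes "\<kappa> > 0"
  shows "((\<lambda>t. (ln (1 - 1 / (\<kappa> * t)) + ln A + c * ln (\<kappa> * t) + a * (\<kappa> * t) powr b) / t powr b) \<longlongrightarrow> a * \<kappa> powr b) at_top"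
  using assms pos by real_asymp

end

section \<open>Saddle points and Chernoff bounds\<close>

locale exp_singular =
  fixes \<theta> :: "nat \<Rightarrow> real" and A a b c :: real
  assumes pos: "a > 0" "b > 0" "A > 0" "c \<ge> 1"
    and nonneg: "\<And>j. j \<ge> 1 \<Longrightarrow> \<theta> j \<ge> 0"
    and incr: "\<And>j. j \<ge> 1 \<Longrightarrow> \<theta> j \<le> \<theta> (Suc j)"
    and first_pos: "\<theta> 1 > 0"
    and sums: "\<And>x. \<bar>x\<bar> < 1 \<Longrightarrow>
      (\<lambda>n. \<theta> (Suc n) * x ^ n) sums (A * (1 - x) powr (- c) * exp (a * (1 - x) powr (- b)))"
begin

definition L :: "real \<Rightarrow> real" where "L x = x * (A * (1 - x) powr (- c) * exp (a * (1 - x) powr (- b)))"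

text \<open>The logarithm of \<open>L\<close> in the variable \<open>t = 1 / (1 - r)\<close>, which
  moves the singularity at \<open>1\<close> to infinity and makes the saddle equation read
  \<open>\<Lambda> t = ln n\<close>.\<close>

definition \<Lambda> :: "real \<Rightarrow> real" where "\<Lambda> t = ln (1 - 1 / t) + ln A + c * ln t + a * t powr b"

lemma usum: "unit_disc_summable (\<lambda>j. \<theta> (Suc j))"
  by (rule unit_disc_summableI[OF _ sums]) (use nonneg in auto)

lemma L_sums: "\<bar>x\<bar> < 1 \<Longrightarrow> (\<lambda>j. \<theta> (Suc j) * x ^ Suc j) sums L x"
  unfolding L_def using sums_mult[OF sums, of x x] by (simp add: mult_ac)

lemma L_eq_exp:
  assumes "t > 1"
  shows "L (1 - 1 / t) = exp (\<Lambda> t)"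
proof -
  have "(1 - 1 / t) > 0" using assms by simp
  moreover have "(1 / t) powr (- s) = t powr s" for s
    using assms by (simp add: powr_divide powr_minus_divide)
  ultimately show ?thesis
    using assms pos by (simp add: L_def \<Lambda>_def exp_add powr_def[of t c] mult_ac)
qed

lemma L_mono:
  assumes "0 \<le> x" "x \<le> y" "y < 1"
  shows "L x \<le> L y"
proof (rule sums_le[OF _ L_sums L_sums])
  show "\<theta> (Suc j) * x ^ Suc j \<le> \<theta> (Suc j) * y ^ Suc j" for j
    using nonneg assms by (intro mult_left_mono power_mono) auto
qed (use assms in auto)

lemma saddle_at: "t \<ge> 2 \<Longrightarrow> saddle \<theta> (1 - 1 / t)"
  by unfold_locales (use nonneg incr usum in \<open>auto simp: field_simps\<close>)

text \<open>Exponential tilting: on \<open>S\<close> the factor \<open>(r / \<rho>) ^ j\<close> is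
  at most its value at the threshold \<open>y\<close>, and the sum at radius \<rho> is at most
  \<open>L \<rho>\<close>. Moving outward (\<open>\<kappa> > 1\<close>) handles the upper tail,
  moving inward the lower one.\<close>

lemma tail_le:
  assumes t: "t > 1" "\<kappa> > 0" "\<kappa> * t > 1"
    and S: "\<And>j. j \<in> S \<Longrightarrow> (\<kappa> > 1 \<and> y \<le> real j) \<or> (\<kappa> < 1 \<and> real j \<le> y)"
  shows "(\<Sum>j\<in>{1..n}. if j \<in> S then \<theta> j * (1 - 1 / t) ^ j else 0) \<le>
    exp (y * (ln (1 - 1 / t) - ln (1 - 1 / (\<kappa> * t))) + \<Lambda> (\<kappa> * t))"
proof -
  define r where "r = 1 - 1 / t"
  define \<rho> where "\<rho> = 1 - 1 / (\<kappa> * t)"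
  have r: "0 < r" "r < 1" using t by (auto simp: r_def)
  have \<rho>: "0 < \<rho>" "\<rho> < 1" using t by (auto simp: \<rho>_def)
  have le: "r ^ j \<le> exp (y * (ln r - ln \<rho>)) * \<rho> ^ j" if "j \<in> S" for j
  proof -
    have "real j * (ln r - ln \<rho>) \<le> y * (ln r - ln \<rho>)"
    proof (cases "\<kappa> > 1")
      case True
      have "1 / (\<kappa> * t) \<le> 1 / t" using True t by (intro divide_left_mono) auto
      hence "r \<le> \<rho>" by (simp add: r_def \<rho>_def)
      hence "ln r - ln \<rho> \<le> 0" using r \<rho> by simp
      moreover have "y \<le> real j" using S[OF that] True by auto
      ultimately show ?thesis by (rule mult_right_mono_neg[rotated])
    next
      case False
      hence k: "\<kappa> < 1" "real j \<le> y" using S[OF that] by auto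
      have "1 / t \<le> 1 / (\<kappa> * t)" using k t by (intro divide_left_mono) auto
      hence "\<rho> \<le> r" by (simp add: r_def \<rho>_def)
      hence "0 \<le> ln r - ln \<rho>" using r \<rho> by simp
      thus ?thesis using k by (intro mult_right_mono)
    qed
    hence "exp (real j * (ln r - ln \<rho>)) \<le> exp (y * (ln r - ln \<rho>))" by simp
    moreover have "exp (real j * (ln r - ln \<rho>)) * \<rho> ^ j = r ^ j"
    proof -
      have "exp (real j * (ln r - ln \<rho>)) = (r / \<rho>) ^ j"
        using r \<rho> by (simp add: exp_of_nat_mult exp_diff)
      thus ?thesis using \<rho> by (simp add: power_divide)
    qed
    ultimately show ?thesis using \<rho> by (metis mult_right_mono zero_le_power less_imp_le)
  qed
  have s: "(\<lambda>j. \<theta> (Suc j) * \<rho> ^ Suc j) sums L \<rho>" using L_sums[of \<rho>] \<rho> by simp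
  have "(\<Sum>j\<in>{1..n}. if j \<in> S then \<theta> j * r ^ j else 0) \<le> (\<Sum>j\<in>{1..n}. exp (y * (ln r - ln \<rho>)) * (\<theta> j * \<rho> ^ j))"
  proof (rule sum_mono)
    fix j assume "j \<in> {1..n}"
    hence "\<theta> j \<ge> 0" using nonneg by simp
    thus "(if j \<in> S then \<theta> j * r ^ j else 0) \<le> exp (y * (ln r - ln \<rho>)) * (\<theta> j * \<rho> ^ j)"
      using mult_left_mono[OF le, of j "\<theta> j"] \<rho> by (auto simp: mult_ac)
  qed
  also have "\<dots> = exp (y * (ln r - ln \<rho>)) * (\<Sum>j\<in>{1..n}. \<theta> j * \<rho> ^ j)"
    by (simp add: sum_distrib_left)
  also have "(\<Sum>j\<in>{1..n}. \<theta> j * \<rho> ^ j) = (\<Sum>j<n. \<theta> (Suc j) * \<rho> ^ Suc j)"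
    by (rule sum.reindex_bij_witness[of _ Suc "\<lambda>j. j - 1"]) auto
  also have "exp (y * (ln r - ln \<rho>)) * \<dots> \<le> exp (y * (ln r - ln \<rho>)) * L \<rho>"
  proof (rule mult_left_mono)
    show "(\<Sum>j<n. \<theta> (Suc j) * \<rho> ^ Suc j) \<le> L \<rho>"
      using sum_le_suminf[of "\<lambda>j. \<theta> (Suc j) * \<rho> ^ Suc j" "{..<n}"] s nonneg \<rho> by (auto simp: sums_iff)
  qed simp
  also have "L \<rho> = exp (\<Lambda> (\<kappa> * t))" unfolding \<rho>_def by (rule L_eq_exp[OF t(3)])
  finally show ?thesis by (simp add: r_def \<rho>_def exp_add cong: if_cong)
qed

lemma powr_b_at_top: "filterlim (\<lambda>t. t powr b) at_top at_top"
  using pos by real_asymp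

lemma \<Lambda>_at_top: "filterlim \<Lambda> at_top at_top"
  unfolding \<Lambda>_def using log_saddle_at_top[OF pos(1-3)] .

lemma \<Lambda>_equiv: "((\<lambda>t. \<Lambda> t / t powr b) \<longlongrightarrow> a) at_top"
  unfolding \<Lambda>_def using log_saddle_equiv[OF pos(1-3)] .

lemma \<Lambda>_shift: "\<kappa> > 0 \<Longrightarrow> ((\<lambda>t. \<Lambda> (\<kappa> * t) / t powr b) \<longlongrightarrow> a * \<kappa> powr b) at_top"
  unfolding \<Lambda>_def using log_saddle_shift[OF pos(1-3)] .

text \<open>The unit \<open>a * b * t powr (b + 1)\<close> is the leading order of
  \<open>r * L' r / L r\<close>, the mean of the weights \<open>\<theta> j * r ^ j\<close>. Divided
  by \<open>t powr b\<close>, the exponent tends to \<open>a\<close> times the expression of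
  \<open>derivative_slope_neg\<close>.\<close>

lemma tail_exponent:
  assumes "\<kappa> > 0" "\<kappa> powr b - 1 + Y * b * (1 / \<kappa> - 1) < 0"
  shows "filterlim (\<lambda>t. (Y * (a * b * t powr (b + 1))) * (ln (1 - 1 / t) - ln (1 - 1 / (\<kappa> * t))) + \<Lambda> (\<kappa> * t) - \<Lambda> t) at_bot at_top"
proof -
  have "((\<lambda>t. (Y * a * b) * ((ln (1 - 1 / t) - ln (1 - 1 / (\<kappa> * t))) * t) + \<Lambda> (\<kappa> * t) / t powr b - \<Lambda> t / t powr b) \<longlongrightarrow>
      (Y * a * b) * (1 / \<kappa> - 1) + a * \<kappa> powr b - a) at_top"
    using assms by (intro tendsto_intros log_ratio \<Lambda>_shift \<Lambda>_equiv) auto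
  moreover have "(Y * a * b) * (1 / \<kappa> - 1) + a * \<kappa> powr b - a < 0"
  proof -
    have "a * (\<kappa> powr b - 1 + Y * b * (1 / \<kappa> - 1)) < 0" using assms pos by (simp add: mult_pos_neg)
    thus ?thesis by (simp add: algebra_simps)
  qed
  ultimately have f1: "filterlim (\<lambda>t. ((Y * a * b) * ((ln (1 - 1 / t) - ln (1 - 1 / (\<kappa> * t))) * t) + \<Lambda> (\<kappa> * t) / t powr b - \<Lambda> t / t powr b) * t powr b) at_bot at_top"
    using powr_b_at_top by (rule filterlim_tendsto_neg_mult_at_bot)
  have f2: "eventually (\<lambda>t. ((Y * a * b) * ((ln (1 - 1 / t) - ln (1 - 1 / (\<kappa> * t))) * t) + \<Lambda> (\<kappa> * t) / t powr b - \<Lambda> t / t powr b) * t powr b =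
    (Y * (a * b * t powr (b + 1))) * (ln (1 - 1 / t) - ln (1 - 1 / (\<kappa> * t))) + \<Lambda> (\<kappa> * t) - \<Lambda> t) at_top"
    using eventually_gt_at_top[of 0]
  proof eventually_elim
    case (elim t)
    have p: "t powr b > 0" using elim by simp
    have "t powr (b + 1) = t powr b * t" using elim by (simp add: powr_add)
    thus ?case using p by (simp add: ring_distribs mult_ac)
  qed
  show ?thesis by (rule filterlim_mono_eventually[OF f1 order_refl order_refl f2])
qed

text \<open>Enlarging the radius from \<open>t\<close> to \<open>\<kappa> * t\<close> gains
  \<open>exp (u * j)\<close> with \<open>u\<close> of order \<open>1 / t\<close>, enough to pay for
  \<open>j ^ 2\<close> up to a factor of order \<open>t ^ 2\<close>. The price is that
  \<open>\<Lambda> t\<close> becomes roughly \<open>\<kappa> powr b * \<Lambda> t\<close>.\<close>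

lemma second_moment_le:
  "eventually (\<lambda>t. saddle.T \<theta> (1 - 1 / t) \<le> exp (33 / 32 * \<Lambda> t)) at_top"
proof -
  \<comment> \<open>The value \<open>\<kappa> powr b = 65 / 64\<close> lies strictly between
    \<open>1\<close> and \<open>33 / 32\<close>; the gap absorbs the factor of order
    \<open>t ^ 2\<close>.\<close>
  define \<kappa> where "\<kappa> = (65 / 64) powr (1 / b)"
  have k1: "\<kappa> > 1" unfolding \<kappa>_def using pos by (simp add: gr_one_powr)
  have kb: "\<kappa> powr b = 65 / 64" unfolding \<kappa>_def using pos by (simp add: powr_powr)
  \<comment> \<open>Half of the limit of \<open>u * t\<close>, so that
    \<open>u > \<delta> / t\<close> holds eventually.\<close>
  define \<delta> where "\<delta> = (1 - 1 / \<kappa>) / 2"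
  have \<delta>: "\<delta> > 0" using k1 by (simp add: \<delta>_def)
  have "((\<lambda>t. - ((ln (1 - 1 / t) - ln (1 - 1 / (\<kappa> * t))) * t)) \<longlongrightarrow> - (1 / \<kappa> - 1)) at_top"
    using k1 by (intro tendsto_minus log_ratio) auto
  moreover have "\<delta> < - (1 / \<kappa> - 1)" using \<delta> by (simp add: \<delta>_def)
  ultimately have ev1: "eventually (\<lambda>t. \<delta> < - ((ln (1 - 1 / t) - ln (1 - 1 / (\<kappa> * t))) * t)) at_top"
    by (rule order_tendstoD)
  have "((\<lambda>t. (ln (2 / \<delta>\<^sup>2) / t powr b + 2 * (ln t / t powr b)) + \<Lambda> (\<kappa> * t) / t powr b - 33 / 32 * (\<Lambda> t / t powr b)) \<longlongrightarrow>
      (0 + 2 * 0) + a * \<kappa> powr b - 33 / 32 * a) at_top"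
    using k1 pos by (intro tendsto_intros \<Lambda>_shift \<Lambda>_equiv ln_over_powr_tendsto_0 tendsto_divide_0[OF tendsto_const]
      filterlim_at_top_imp_at_infinity powr_b_at_top) auto
  moreover have "(0 + 2 * 0) + a * \<kappa> powr b - 33 / 32 * a < 0" using pos kb by simp
  ultimately have ev2: "eventually (\<lambda>t. (ln (2 / \<delta>\<^sup>2) / t powr b + 2 * (ln t / t powr b)) + \<Lambda> (\<kappa> * t) / t powr b - 33 / 32 * (\<Lambda> t / t powr b) < 0) at_top"
    by (rule order_tendstoD)
  show ?thesis
    using ev1 ev2 eventually_ge_at_top[of 2]
  proof eventually_elim
    case (elim t)
    interpret saddle \<theta> "1 - 1 / t" by (rule saddle_at[OF elim(3)])
    define r where "r = 1 - 1 / t"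
    define \<rho> where "\<rho> = 1 - 1 / (\<kappa> * t)"
    have kt: "\<kappa> * t > 1" using k1 elim(3) less_1_mult[of \<kappa> t] by simp
    have r0: "0 < r" "r < 1" using elim(3) by (auto simp: r_def)
    have \<rho>: "0 < \<rho>" "\<rho> < 1" using kt by (auto simp: \<rho>_def)
    define u where "u = ln \<rho> - ln r"
    have "\<delta> < u * t" using elim(1) by (simp add: u_def r_def \<rho>_def algebra_simps)
    hence ut: "\<delta> / t < u" using elim(3) by (simp add: field_simps)
    moreover have "\<delta> / t > 0" using \<delta> elim(3) by simp
    ultimately have u: "u > 0" by linarith
    have "1 / u\<^sup>2 \<le> 1 / (\<delta> / t)\<^sup>2"
      using ut \<open>\<delta> / t > 0\<close> u by (intro frac_le power_mono zero_less_power) (simp_all add: less_imp_le)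
    hence ut2: "2 / u\<^sup>2 \<le> 2 / \<delta>\<^sup>2 * t\<^sup>2" by (simp add: power_divide)
    have s: "(\<lambda>j. \<theta> (Suc j) * \<rho> ^ Suc j) sums L \<rho>" using L_sums[of \<rho>] \<rho> by simp
    have "T \<le> (\<Sum>j. 2 / u\<^sup>2 * (\<theta> (Suc j) * \<rho> ^ Suc j))"
      unfolding T_def
    proof (rule suminf_le[OF _ summable_T])
      fix j
      let ?k = "real (Suc j)"
      have "1 + u * ?k + (u * ?k)\<^sup>2 / 2 \<le> exp (u * ?k)"
        using u by (intro exp_lower_Taylor_quadratic) auto
      moreover have "u * ?k \<ge> 0" using u by simp
      ultimately have "(u * ?k)\<^sup>2 / 2 \<le> exp (u * ?k)" by linarith
      hence "u\<^sup>2 * ?k\<^sup>2 / 2 \<le> exp (u * ?k)" by (simp only: power_mult_distrib)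
      hence "?k\<^sup>2 \<le> 2 / u\<^sup>2 * exp (u * ?k)" using u by (simp add: field_simps del: of_nat_Suc)
      moreover have "exp (u * ?k) * r ^ Suc j = \<rho> ^ Suc j"
      proof -
        have "exp (?k * u) = (\<rho> / r) ^ Suc j"
          unfolding exp_of_nat_mult u_def exp_diff using r0 \<rho> by simp
        thus ?thesis using r0 by (simp only: mult.commute[of u] power_divide) simp
      qed
      moreover have "w j \<ge> 0" by (rule w_nonneg)
      ultimately have "?k\<^sup>2 * w j \<le> 2 / u\<^sup>2 * exp (u * ?k) * w j" by (intro mult_right_mono) auto
      also have "\<dots> = 2 / u\<^sup>2 * (\<theta> (Suc j) * (exp (u * ?k) * r ^ Suc j))" by (simp add: w_def r_def)
      finally show "?k\<^sup>2 * w j \<le> 2 / u\<^sup>2 * (\<theta> (Suc j) * \<rho> ^ Suc j)"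
        using \<open>exp (u * ?k) * r ^ Suc j = \<rho> ^ Suc j\<close> by simp
    next
      show "summable (\<lambda>j. 2 / u\<^sup>2 * (\<theta> (Suc j) * \<rho> ^ Suc j))" using s by (intro summable_mult) (auto simp: sums_iff)
    qed
    also have "\<dots> = 2 / u\<^sup>2 * exp (\<Lambda> (\<kappa> * t))"
      using sums_mult[OF s, of "2 / u\<^sup>2"] L_eq_exp[OF kt] by (simp add: sums_iff \<rho>_def)
    also have "\<dots> \<le> 2 / \<delta>\<^sup>2 * t\<^sup>2 * exp (\<Lambda> (\<kappa> * t))" using ut2 by (rule mult_right_mono) simp
    also have "\<dots> = exp (ln (2 / \<delta>\<^sup>2) + 2 * ln t + \<Lambda> (\<kappa> * t))"
    proof -
      have "exp (2 * ln t) = t\<^sup>2" using elim(3) exp_of_nat_mult[of 2 "ln t"] by simp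
      moreover have "exp (ln (2 / \<delta>\<^sup>2)) = 2 / \<delta>\<^sup>2" using \<delta> by simp
      ultimately show ?thesis by (simp only: exp_add)
    qed
    also have "\<dots> \<le> exp (33 / 32 * \<Lambda> t)"
    proof -
      have p: "t powr b > 0" using elim(3) by simp
      have "(ln (2 / \<delta>\<^sup>2) + 2 * ln t + \<Lambda> (\<kappa> * t) - 33 / 32 * \<Lambda> t) / t powr b < 0"
        using elim(2) by (simp add: add_divide_distrib diff_divide_distrib)
      hence "ln (2 / \<delta>\<^sup>2) + 2 * ln t + \<Lambda> (\<kappa> * t) - 33 / 32 * \<Lambda> t < 0" using p by (simp add: divide_less_0_iff)
      thus ?thesis by simp
    qed
    finally show ?case .
  qed
qed

text \<open>Existence is the intermediate value theorem for \<open>L\<close>, which is unbounded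
  near \<open>1\<close>; divergence follows from monotonicity of \<open>L\<close>, since a bounded
  \<open>t n\<close> would bound \<open>n\<close>.\<close>

lemma saddle_point_sequence:
  obtains t :: "nat \<Rightarrow> real" where "\<forall>n\<ge>1. t n > 1" "\<forall>n\<ge>1. \<Lambda> (t n) = ln (real n)"
    "filterlim t at_top sequentially"
proof -
  have "\<exists>t>1. L (1 - 1 / t) = real n" if n: "n \<ge> 1" for n
  proof -
    have "eventually (\<lambda>t. \<Lambda> t \<ge> ln (real n) \<and> t > 1) at_top"
      using \<Lambda>_at_top eventually_gt_at_top[of 1] by (auto simp: filterlim_at_top eventually_conj_iff)
    then obtain t0 where t0: "\<Lambda> t0 \<ge> ln (real n)" "t0 > 1" by (auto simp: eventually_at_top_linorder)
    have "exp (ln (real n)) \<le> exp (\<Lambda> t0)" using t0 by simp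
    hence le: "real n \<le> L (1 - 1 / t0)" using L_eq_exp[OF t0(2)] n by simp
    have "\<exists>x. 0 \<le> x \<and> x \<le> 1 - 1 / t0 \<and> L x = real n"
    proof (rule IVT')
      show "L 0 \<le> real n" by (simp add: L_def)
      show "continuous_on {0..1 - 1 / t0} L"
      proof -
        have "1 - x \<noteq> 0" if "x \<in> {0..1 - 1 / t0}" for x
        proof -
          have "1 / t0 > 0" using t0 by simp
          thus ?thesis using that by auto
        qed
        thus ?thesis unfolding L_def by (intro continuous_intros) auto
      qed
    qed (use le t0 in auto)
    then obtain x where x: "0 \<le> x" "x \<le> 1 - 1 / t0" "L x = real n" by auto
    have x0: "x \<noteq> 0" using x(3) n by (auto simp: L_def)
    have "1 / t0 > 0" using t0 by simp
    hence x1: "x < 1" using x(2) by linarith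
    show ?thesis
      using x x0 x1 by (intro exI[of _ "1 / (1 - x)"]) auto
  qed
  then obtain t where t: "\<And>n. n \<ge> 1 \<Longrightarrow> t n > 1" "\<And>n. n \<ge> 1 \<Longrightarrow> L (1 - 1 / t n) = real n" by metis
  have \<Lambda>t: "\<Lambda> (t n) = ln (real n)" if "n \<ge> 1" for n
    using t(2)[OF that] L_eq_exp[OF t(1)[OF that]] by (metis ln_exp)
  have "filterlim t at_top sequentially"
    unfolding filterlim_at_top
  proof
    fix K :: real
    define k where "k = max K 2"
    have k: "k \<ge> 2" by (simp add: k_def)
    obtain m :: nat where m: "L (1 - 1 / k) < real m" using reals_Archimedean2 by blast
    show "eventually (\<lambda>n. K \<le> t n) sequentially"
      using eventually_ge_at_top[of "max 1 m"]
    proof eventually_elim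
      case (elim n)
      hence n: "n \<ge> 1" "real m \<le> real n" by auto
      show ?case
      proof (rule ccontr)
        assume "\<not> K \<le> t n"
        hence "t n \<le> k" by (simp add: k_def)
        hence "1 / k \<le> 1 / t n" using t(1)[OF n(1)] by (intro divide_left_mono) auto
        hence "L (1 - 1 / t n) \<le> L (1 - 1 / k)"
          using t(1)[OF n(1)] k by (intro L_mono) auto
        thus False using t(2)[OF n(1)] m n by linarith
      qed
    qed
  qed
  thus thesis using that t(1) \<Lambda>t by blast
qed

end

section \<open>Limit laws\<close>

context exp_singular
begin

abbreviation h :: "nat \<Rightarrow> real" where "h \<equiv> exp_coeff \<theta>"

lemma h_pos: "h n > 0"
  using nonneg first_pos by (rule exp_coeff_pos)

lemma coeff_bounds:
  assumes t: "\<forall>n\<ge>1. t n > 1" "\<forall>n\<ge>1. \<Lambda> (t n) = ln (real n)" "filterlim t at_top sequentially"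
  shows "eventually (\<lambda>n. \<forall>k. h k * (1 - 1 / t n) ^ k \<le> 16 * pi * (h n * (1 - 1 / t n) ^ n)) sequentially"
    and "eventually (\<lambda>n. \<bar>h n * (1 - 1 / t n) ^ n - h (n - 1) * (1 - 1 / t n) ^ (n - 1)\<bar> \<le>
      8 * pi * (real n powr (- 3 / 8) + pi * (real n * exp (- (real n powr (1 / 8))))) * (h n * (1 - 1 / t n) ^ n)) sequentially"
proof -
  have e1: "eventually (\<lambda>n. real n powr (1 / 8) \<ge> 4) sequentially" by real_asymp
  have e2: "eventually (\<lambda>n. real n powr (11 / 32) \<ge> 73728) sequentially" by real_asymp
  have e3: "eventually (\<lambda>n. 8 * pi * real n * exp (- (real n powr (1 / 8))) \<le> 1) sequentially" by real_asymp
  have e4: "eventually (\<lambda>n. saddle.T \<theta> (1 - 1 / t n) \<le> exp (33 / 32 * \<Lambda> (t n))) sequentially"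
    using second_moment_le t(3) by (rule eventually_compose_filterlim)
  have e5: "eventually (\<lambda>n. t n \<ge> 2) sequentially"
    using t(3) by (auto simp: filterlim_at_top)
  have *: "eventually (\<lambda>n. (\<forall>k. h k * (1 - 1 / t n) ^ k \<le> 16 * pi * (h n * (1 - 1 / t n) ^ n)) \<and>
    \<bar>h n * (1 - 1 / t n) ^ n - h (n - 1) * (1 - 1 / t n) ^ (n - 1)\<bar> \<le>
      8 * pi * (real n powr (- 3 / 8) + pi * (real n * exp (- (real n powr (1 / 8))))) * (h n * (1 - 1 / t n) ^ n)) sequentially"
    using e1 e2 e3 e4 e5 eventually_ge_at_top[of 1]
  proof eventually_elim
    case (elim n)
    interpret saddle \<theta> "1 - 1 / t n" by (rule saddle_at[OF elim(5)])
    have "\<bar>1 - 1 / t n\<bar> < 1" using r by auto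
    hence "N = L (1 - 1 / t n)" using L_sums by (simp add: N_def w_def sums_iff)
    also have "\<dots> = exp (\<Lambda> (t n))" using L_eq_exp t(1) elim(6) by simp
    also have "\<dots> = real n" using t(2) elim(6) by simp
    finally have N: "N = real n" .
    have "exp (33 / 32 * \<Lambda> (t n)) = real n powr (33 / 32)"
      using t(2) elim(6) by (simp add: powr_def)
    hence T: "T \<le> real n powr (33 / 32)" using elim(4) by simp
    obtain m where m: "n = Suc m" using elim(6) by (cases n) auto
    show ?case
      using coeff_compare(1)[OF N T elim(1,2,3)] coeff_compare(2)[OF N T elim(1,2,3) m] m by simp
  qed
  show "eventually (\<lambda>n. \<forall>k. h k * (1 - 1 / t n) ^ k \<le> 16 * pi * (h n * (1 - 1 / t n) ^ n)) sequentially"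
    using * by (rule eventually_mono) auto
  show "eventually (\<lambda>n. \<bar>h n * (1 - 1 / t n) ^ n - h (n - 1) * (1 - 1 / t n) ^ (n - 1)\<bar> \<le>
      8 * pi * (real n powr (- 3 / 8) + pi * (real n * exp (- (real n powr (1 / 8))))) * (h n * (1 - 1 / t n) ^ n)) sequentially"
    using * by (rule eventually_mono) auto
qed

text \<open>With \<open>q = 1 - 1 / t n\<close>, dividing the difference bound by
  \<open>h n * q ^ n\<close> yields \<open>h (n - 1) / (h n * q)\<close> tending to
  \<open>1\<close>; the factor \<open>q\<close> disappears because \<open>t n\<close>
  diverges.\<close>

lemma h_ratio: "(\<lambda>n. h n / h (Suc n)) \<longlonglongrightarrow> 1"
proof -
  obtain t :: "nat \<Rightarrow> real" where t: "\<forall>n\<ge>1. t n > 1" "\<forall>n\<ge>1. \<Lambda> (t n) = ln (real n)"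
    "filterlim t at_top sequentially" using saddle_point_sequence by blast
  define \<epsilon> where "\<epsilon> = (\<lambda>n. 8 * pi * (real n powr (- 3 / 8) + pi * (real n * exp (- (real n powr (1 / 8))))))"
  have \<epsilon>: "\<epsilon> \<longlonglongrightarrow> 0" unfolding \<epsilon>_def by real_asymp
  have r: "(\<lambda>n. 1 - 1 / t n) \<longlonglongrightarrow> 1"
  proof -
    have "(\<lambda>n. 1 - 1 / t n) \<longlonglongrightarrow> 1 - 0"
      by (intro tendsto_intros tendsto_divide_0[OF tendsto_const] filterlim_at_top_imp_at_infinity t(3))
    thus ?thesis by simp
  qed
  have "(\<lambda>n. 1 - h (n - 1) / (h n * (1 - 1 / t n))) \<longlonglongrightarrow> 0"
  proof (rule Lim_null_comparison[OF _ \<epsilon>])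
    have "eventually (\<lambda>n. 1 - 1 / t n > 0) sequentially" using order_tendstoD(1)[OF r, of 0] by simp
    thus "eventually (\<lambda>n. norm (1 - h (n - 1) / (h n * (1 - 1 / t n))) \<le> \<epsilon> n) sequentially"
      using coeff_bounds(2)[OF t] eventually_ge_at_top[of 1]
    proof eventually_elim
      case (elim n)
      define q where "q = 1 - 1 / t n"
      have q: "q > 0" using elim(1) by (simp add: q_def)
      obtain m where m: "n = Suc m" using elim(3) by (cases n) auto
      have p: "h n * q ^ n > 0" using h_pos q by simp
      have "1 - h (n - 1) / (h n * q) = (h n * q ^ n - h (n - 1) * q ^ (n - 1)) / (h n * q ^ n)"
        using p h_pos[of n] q by (simp add: m diff_divide_distrib)
      hence "\<bar>1 - h (n - 1) / (h n * q)\<bar> = \<bar>h n * q ^ n - h (n - 1) * q ^ (n - 1)\<bar> / (h n * q ^ n)"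
        using p by simp
      also have "\<dots> \<le> \<epsilon> n" using elim(2) p unfolding \<epsilon>_def q_def[symmetric] by (simp add: pos_divide_le_eq)
      finally show ?case by (simp add: q_def)
    qed
  qed
  hence "(\<lambda>n. (1 - (1 - h (n - 1) / (h n * (1 - 1 / t n)))) * (1 - 1 / t n)) \<longlonglongrightarrow> (1 - 0) * 1"
    by (intro tendsto_intros r)
  moreover have "eventually (\<lambda>n. (1 - (1 - h (n - 1) / (h n * (1 - 1 / t n)))) * (1 - 1 / t n) = h (n - 1) / h n) sequentially"
  proof -
    have "eventually (\<lambda>n. 1 - 1 / t n > 0) sequentially" using order_tendstoD(1)[OF r, of 0] by simp
    thus ?thesis
    proof eventually_elim
      case (elim n)
      define q where "q = 1 - 1 / t n"
      have "q > 0" using elim by (simp add: q_def)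
      hence "(1 - (1 - h (n - 1) / (h n * q))) * q = h (n - 1) / h n" by simp
      thus ?case unfolding q_def .
    qed
  qed
  ultimately have "(\<lambda>n. h (n - 1) / h n) \<longlonglongrightarrow> (1 - 0) * 1" by (rule Lim_transform_eventually)
  hence "(\<lambda>n. h (Suc n - 1) / h (Suc n)) \<longlonglongrightarrow> (1 - 0) * 1" by (rule LIMSEQ_Suc)
  thus ?thesis by simp
qed

text \<open>Both tails are treated together, with \<open>Y\<close> as threshold relative to the
  centre \<open>a * b * t n powr (b + 1)\<close>. The normalisation
  \<open>1 / n = exp (- \<Lambda> (t n))\<close> completes the Chernoff bound to the exponent of
  \<open>tail_exponent\<close>.\<close>

lemma prob_L1_tail:
  assumes t: "\<forall>n\<ge>1. t n > 1" "\<forall>n\<ge>1. \<Lambda> (t n) = ln (real n)" "filterlim t at_top sequentially"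
    and S: "Y > 1 \<and> eventually (\<lambda>n. \<forall>j\<in>S n. Y * (a * b * t n powr (b + 1)) \<le> real j) sequentially \<or>
      Y < 1 \<and> eventually (\<lambda>n. \<forall>j\<in>S n. real j \<le> Y * (a * b * t n powr (b + 1))) sequentially"
  shows "(\<lambda>n. measure_pmf.prob (Pn \<theta> n) {\<sigma>. L1 \<sigma> \<in> S n}) \<longlonglongrightarrow> 0"
proof -
  obtain \<kappa> where \<kappa>: "\<kappa> > 0" "\<kappa> powr b - 1 + Y * b * (1 / \<kappa> - 1) < 0"
    and S': "eventually (\<lambda>n. \<forall>j\<in>S n. (\<kappa> > 1 \<and> Y * (a * b * t n powr (b + 1)) \<le> real j) \<or>
      (\<kappa> < 1 \<and> real j \<le> Y * (a * b * t n powr (b + 1)))) sequentially"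
  proof (cases "Y > 1")
    case True
    then obtain \<kappa> where "\<kappa> > 1" "\<kappa> powr b - 1 + Y * b * (1 / \<kappa> - 1) < 0"
      using derivative_slope_neg(1)[OF pos(2)] by blast
    thus ?thesis using that[of \<kappa>] S True by auto
  next
    case False
    then obtain \<kappa> where "\<kappa> > 0" "\<kappa> < 1" "\<kappa> powr b - 1 + Y * b * (1 / \<kappa> - 1) < 0"
      using derivative_slope_neg(2)[OF pos(2)] S by blast
    thus ?thesis using that[of \<kappa>] S False by auto
  qed
  define f where "f = (\<lambda>t. (Y * (a * b * t powr (b + 1))) * (ln (1 - 1 / t) - ln (1 - 1 / (\<kappa> * t))) + \<Lambda> (\<kappa> * t) - \<Lambda> t)"
  have "filterlim f at_bot at_top" unfolding f_def by (rule tail_exponent[OF \<kappa>])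
  hence "filterlim (\<lambda>n. f (t n)) at_bot sequentially" using t(3) by (rule filterlim_compose)
  hence "(\<lambda>n. exp (f (t n))) \<longlonglongrightarrow> 0" by (rule filterlim_compose[OF exp_at_bot])
  hence lim: "(\<lambda>n. 16 * pi * exp (f (t n))) \<longlonglongrightarrow> 0" by (intro tendsto_mult_right_zero)
  have e1: "eventually (\<lambda>n. t n \<ge> max 2 (2 / \<kappa>)) sequentially"
    using t(3) unfolding filterlim_at_top by blast
  show ?thesis
  proof (rule Lim_null_comparison[OF _ lim])
    show "eventually (\<lambda>n. norm (measure_pmf.prob (Pn \<theta> n) {\<sigma>. L1 \<sigma> \<in> S n}) \<le> 16 * pi * exp (f (t n))) sequentially"
      using e1 S' coeff_bounds(1)[OF t] eventually_ge_at_top[of 1]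
    proof eventually_elim
      case (elim n)
      define q where "q = 1 - 1 / t n"
      have tn: "t n > 1" "\<kappa> * t n > 1"
      proof -
        show "t n > 1" using elim(1) by simp
        have "2 / \<kappa> \<le> t n" using elim(1) by simp
        thus "\<kappa> * t n > 1" using \<kappa>(1) by (simp add: divide_le_eq mult.commute)
      qed
      have q: "q > 0" "q < 1" using elim(1) by (auto simp: q_def)
      have n: "n > 0" using elim(4) by simp
      have hb: "h (n - j) \<le> 16 * pi * h n * q ^ j" if "j \<le> n" for j
      proof -
        have "h (n - j) * q ^ (n - j) \<le> 16 * pi * (h n * q ^ n)" using elim(3) by (simp add: q_def)
        also have "q ^ n = q ^ j * q ^ (n - j)" using that by (simp add: power_add[symmetric])
        finally have "h (n - j) * q ^ (n - j) \<le> (16 * pi * h n * q ^ j) * q ^ (n - j)" by (simp add: mult_ac)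
        thus ?thesis using q by (simp add: mult_le_cancel_right)
      qed
      have "measure_pmf.prob (Pn \<theta> n) {\<sigma>. L1 \<sigma> \<in> S n} =
        (\<Sum>j\<in>{1..n}. if j \<in> S n then \<theta> j * h (n - j) else 0) / (real n * h n)"
        using nonneg first_pos n by (rule prob_L1)
      also have "\<dots> \<le> (\<Sum>j\<in>{1..n}. 16 * pi * h n * (if j \<in> S n then \<theta> j * q ^ j else 0)) / (real n * h n)"
      proof (intro divide_right_mono sum_mono)
        fix j assume j: "j \<in> {1..n}"
        hence "\<theta> j * h (n - j) \<le> \<theta> j * (16 * pi * h n * q ^ j)"
          using hb[of j] nonneg[of j] by (intro mult_left_mono) auto
        thus "(if j \<in> S n then \<theta> j * h (n - j) else 0) \<le> 16 * pi * h n * (if j \<in> S n then \<theta> j * q ^ j else 0)"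
          by (simp add: mult_ac)
      qed (use h_pos[of n] in simp)
      also have "\<dots> = 16 * pi * ((\<Sum>j\<in>{1..n}. if j \<in> S n then \<theta> j * q ^ j else 0) / real n)"
        using h_pos[of n] n by (simp add: sum_distrib_left[symmetric])
      also have "(\<Sum>j\<in>{1..n}. if j \<in> S n then \<theta> j * q ^ j else 0) \<le>
        exp ((Y * (a * b * t n powr (b + 1))) * (ln (1 - 1 / t n) - ln (1 - 1 / (\<kappa> * t n))) + \<Lambda> (\<kappa> * t n))"
        unfolding q_def by (rule tail_le[OF tn(1) \<kappa>(1) tn(2)]) (use elim(2) in auto)
      also have "\<dots> / real n = exp (f (t n))"
      proof -
        have "exp (f (t n)) = exp ((Y * (a * b * t n powr (b + 1))) * (ln (1 - 1 / t n) - ln (1 - 1 / (\<kappa> * t n))) + \<Lambda> (\<kappa> * t n)) / exp (\<Lambda> (t n))"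
          unfolding f_def by (rule exp_diff)
        thus ?thesis using t(2) n by simp
      qed
      finally show ?case by (simp add: divide_right_mono)
    qed
  qed
qed

end

section \<open>Removing the first \<open>k\<close> weights\<close>

lemma exp_coeff_scale: "exp_coeff (\<lambda>j. \<theta> j * x ^ j) n = x ^ n * exp_coeff \<theta> n"
proof (induction n rule: less_induct)
  case (less n)
  show ?case
  proof (cases "n = 0")
    case False
    have "(\<Sum>j\<in>{1..n}. \<theta> j * x ^ j * exp_coeff (\<lambda>j. \<theta> j * x ^ j) (n - j)) =
      (\<Sum>j\<in>{1..n}. x ^ n * (\<theta> j * exp_coeff \<theta> (n - j)))"
    proof (rule sum.cong[OF refl])
      fix j assume j: "j \<in> {1..n}"
      hence "x ^ n = x ^ j * x ^ (n - j)" by (simp add: power_add[symmetric])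
      thus "\<theta> j * x ^ j * exp_coeff (\<lambda>j. \<theta> j * x ^ j) (n - j) = x ^ n * (\<theta> j * exp_coeff \<theta> (n - j))"
        using less[of "n - j"] j False by simp
    qed
    thus ?thesis
      using False unfolding exp_coeff.simps[of "\<lambda>j. \<theta> j * x ^ j" n] exp_coeff.simps[of \<theta> n]
      by (simp add: sum_distrib_left)
  qed simp
qed

lemma unit_disc_summableI':
  fixes a :: "nat \<Rightarrow> real"
  assumes "\<And>x. 0 \<le> x \<Longrightarrow> x < 1 \<Longrightarrow> summable (\<lambda>n. a n * x ^ n)"
  shows "unit_disc_summable a"
  unfolding unit_disc_summable_def
proof (intro allI impI)
  fix x :: real assume x: "0 \<le> x \<and> x < 1"
  have "summable (\<lambda>n. norm (a n * x ^ n))"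
    by (rule powser_insidea[of a "(x + 1) / 2"]) (use assms[of "(x + 1) / 2"] x in auto)
  thus "summable (\<lambda>n. \<bar>a n\<bar> * x ^ n)" using x by (simp add: abs_mult)
qed

text \<open>The functional equation of the exponential in terms of coefficients: one function has
  two power series, and their derivatives at \<open>0\<close> agree.\<close>

lemma exp_coeff_add:
  assumes \<theta>: "unit_disc_summable (\<lambda>j. \<theta> (Suc j))" and \<eta>: "unit_disc_summable (\<lambda>j. \<eta> (Suc j))"
  shows "exp_coeff (\<lambda>j. \<theta> j + \<eta> j) n = (\<Sum>i\<le>n. exp_coeff \<theta> i * exp_coeff \<eta> (n - i))"
proof -
  have us: "unit_disc_summable (exp_coeff \<theta>)" if "unit_disc_summable (\<lambda>j. \<theta> (Suc j))" for \<theta>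
    by (rule unit_disc_summableI') (use exp_coeff_sums_real[OF that] in \<open>auto simp: sums_iff\<close>)
  have u: "unit_disc_summable (\<lambda>j. \<theta> (Suc j) + \<eta> (Suc j))"
  proof (rule unit_disc_summableI')
    fix x :: real assume "0 \<le> x" "x < 1"
    hence "summable (\<lambda>n. \<theta> (Suc n) * x ^ n)" "summable (\<lambda>n. \<eta> (Suc n) * x ^ n)"
      using unit_disc_summableD(2)[OF \<theta>, of x] unit_disc_summableD(2)[OF \<eta>, of x] by auto
    from summable_add[OF this] show "summable (\<lambda>n. (\<theta> (Suc n) + \<eta> (Suc n)) * x ^ n)" by (simp add: distrib_right)
  qed
  define f where "f = (\<lambda>x::real. exp (\<Sum>j. (\<theta> (Suc j) + \<eta> (Suc j)) / real (Suc j) * x ^ Suc j))"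
  have s1: "(\<lambda>n. exp_coeff (\<lambda>j. \<theta> j + \<eta> j) n * x ^ n) sums f x" if "norm x < 1" for x
    unfolding f_def using exp_coeff_sums_real[of "\<lambda>j. \<theta> j + \<eta> j" x] u that by simp
  have s2: "(\<lambda>n. (\<Sum>i\<le>n. exp_coeff \<theta> i * exp_coeff \<eta> (n - i)) * x ^ n) sums f x" if "norm x < 1" for x
  proof -
    have x: "\<bar>x\<bar> < 1" using that by simp
    have "f x = exp (\<Sum>j. \<theta> (Suc j) / real (Suc j) * x ^ Suc j) * exp (\<Sum>j. \<eta> (Suc j) / real (Suc j) * x ^ Suc j)"
      unfolding f_def exp_add[symmetric] suminf_add[OF summable_integrated[OF \<theta> x] summable_integrated[OF \<eta> x]]
      by (simp add: add_divide_distrib distrib_right del: of_nat_Suc power_Suc)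
    thus ?thesis
      using unit_disc_sums_cauchy[OF us[OF \<theta>] us[OF \<eta>] x exp_coeff_sums_real[OF \<theta> x] exp_coeff_sums_real[OF \<eta> x]] by simp
  qed
  have "fact n * exp_coeff (\<lambda>j. \<theta> j + \<eta> j) n = (deriv ^^ n) f 0"
    by (rule powser_higher_deriv[symmetric, of 1]) (use s1 in auto)
  also have "\<dots> = fact n * (\<Sum>i\<le>n. exp_coeff \<theta> i * exp_coeff \<eta> (n - i))"
    by (rule powser_higher_deriv[of 1]) (use s2 in auto)
  finally show ?thesis by simp
qed

lemma shift_ratio_tendsto:
  fixes h :: "nat \<Rightarrow> real"
  assumes hpos: "\<And>n. h n > 0" and ratio: "(\<lambda>n. h n / h (Suc n)) \<longlonglongrightarrow> 1"
  shows "(\<lambda>n. h n / h (n + i)) \<longlonglongrightarrow> 1"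
proof (induction i)
  case 0
  have "h n \<noteq> 0" for n using hpos[of n] by simp
  thus ?case by simp
next
  case (Suc i)
  have "(\<lambda>n. h (n + i) / h (Suc (n + i))) \<longlonglongrightarrow> 1" using LIMSEQ_ignore_initial_segment[OF ratio, of i] by simp
  from tendsto_mult[OF Suc this] have "(\<lambda>n. h n / h (n + i) * (h (n + i) / h (Suc (n + i)))) \<longlonglongrightarrow> 1" by simp
  moreover have "h n / h (n + i) * (h (n + i) / h (Suc (n + i))) = h n / h (n + Suc i)" for n
    using hpos[of "n + i"] by simp
  ultimately show ?case by (simp only:)
qed

text \<open>Each quotient \<open>h (n - i) / h n\<close> tends to \<open>1\<close> and is at most
  \<open>C * \<rho> ^ i\<close>, so Tannery's theorem passes to the limit inside the sum. The
  domination is why \<open>d\<close> must be summable at a radius above \<open>1\<close>.\<close>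

lemma convolution_ratio_tendsto:
  fixes d h :: "nat \<Rightarrow> real"
  assumes hpos: "\<And>n. h n > 0" and ratio: "(\<lambda>n. h n / h (Suc n)) \<longlonglongrightarrow> 1"
    and \<rho>: "\<rho> > 1" and d: "summable (\<lambda>n. \<bar>d n\<bar> * \<rho> ^ n)"
  shows "(\<lambda>n. (\<Sum>i\<le>n. d i * h (n - i)) / h n) \<longlonglongrightarrow> (\<Sum>i. d i)"
proof -
  obtain M where M: "\<And>n. n \<ge> M \<Longrightarrow> h n / h (Suc n) \<le> \<rho>"
  proof -
    have "eventually (\<lambda>n. h n / h (Suc n) < \<rho>) sequentially" using order_tendstoD(2)[OF ratio \<rho>] .
    thus ?thesis using that unfolding eventually_at_top_linorder by (meson less_imp_le)
  qed
  have step: "h m \<le> \<rho> ^ i * h (m + i)" if "m \<ge> M" for m i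
  proof (induction i)
    case (Suc i)
    have "h (m + i) \<le> \<rho> * h (Suc (m + i))"
      using M[of "m + i"] that hpos[of "Suc (m + i)"] by (simp add: pos_divide_le_eq)
    hence "\<rho> ^ i * h (m + i) \<le> \<rho> ^ i * (\<rho> * h (Suc (m + i)))" using \<rho> by (intro mult_left_mono) auto
    thus ?case using Suc by (simp add: mult_ac)
  qed simp
  \<comment> \<open>The growth bound \<open>step\<close> starts only at \<open>M\<close>; this
    constant covers the finitely many values of \<open>h\<close> below \<open>M\<close>, compared
    with \<open>h M\<close>.\<close>
  define C where "C = 1 + (\<Sum>l\<le>M. h l / h M)"
  have C1: "C \<ge> 1" unfolding C_def using hpos by (simp add: sum_nonneg less_imp_le)
  have bound: "h (n - i) / h n \<le> C * \<rho> ^ i" if "n \<ge> M" "i \<le> n" for n i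
  proof (cases "n - i \<ge> M")
    case True
    have "h (n - i) \<le> \<rho> ^ i * h n" using step[OF True, of i] that by simp
    also have "\<dots> \<le> C * \<rho> ^ i * h n" using C1 \<rho> hpos[of n] by (simp add: mult_right_mono)
    finally show ?thesis using hpos[of n] by (simp add: pos_divide_le_eq)
  next
    case False
    have "h (n - i) / h M \<le> (\<Sum>l\<le>M. h l / h M)"
      using False hpos by (intro member_le_sum) (auto simp: less_imp_le)
    hence "h (n - i) \<le> C * h M" using hpos[of M] by (simp add: C_def pos_divide_le_eq distrib_right)
    also have "h M \<le> \<rho> ^ (n - M) * h n" using step[of M "n - M"] that by simp
    also have "\<rho> ^ (n - M) \<le> \<rho> ^ i" using \<rho> False that by (intro power_increasing) auto
    finally have "h (n - i) \<le> C * (\<rho> ^ i * h n)" using C1 hpos[of n] by (simp add: mult_right_mono mult_left_mono)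
    thus ?thesis using hpos[of n] by (simp add: pos_divide_le_eq mult_ac)
  qed
  define f where "f = (\<lambda>i n. if i \<le> n then d i * h (n - i) / h n else 0)"
  have lim: "(\<lambda>n. f i n) \<longlonglongrightarrow> d i" for i
  proof -
    have "(\<lambda>n. h n / h (n + i)) \<longlonglongrightarrow> 1" by (rule shift_ratio_tendsto[OF hpos ratio])
    hence "(\<lambda>n. d i * (h n / h (n + i))) \<longlonglongrightarrow> d i * 1" by (intro tendsto_intros)
    hence "(\<lambda>n. f i (n + i)) \<longlonglongrightarrow> d i" by (simp add: f_def)
    thus ?thesis by (rule LIMSEQ_offset)
  qed
  have "eventually (\<lambda>(i, n). norm (f i n) \<le> C * (\<bar>d i\<bar> * \<rho> ^ i)) (at_top \<times>\<^sub>F sequentially)"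
    unfolding eventually_prod_filter
  proof (intro exI conjI allI impI)
    show "eventually (\<lambda>_::nat. True) at_top" by simp
    show "eventually (\<lambda>n. n \<ge> M) sequentially" by (rule eventually_ge_at_top)
    fix i n assume "M \<le> n"
    have "norm (f i n) \<le> C * (\<bar>d i\<bar> * \<rho> ^ i)"
    proof (cases "i \<le> n")
      case True
      have "norm (f i n) = \<bar>d i\<bar> * (h (n - i) / h n)"
        using True hpos[of n] hpos[of "n - i"] by (simp add: f_def abs_mult)
      also have "\<dots> \<le> \<bar>d i\<bar> * (C * \<rho> ^ i)" using bound[OF \<open>M \<le> n\<close> True] by (intro mult_left_mono) auto
      finally show ?thesis by (simp add: mult_ac)
    next
      case False
      thus ?thesis using C1 \<rho> by (simp add: f_def)
    qed
    thus "case (i, n) of (i, n) \<Rightarrow> norm (f i n) \<le> C * (\<bar>d i\<bar> * \<rho> ^ i)" by simp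
  qed
  hence "(\<lambda>n. \<Sum>i. f i n) \<longlonglongrightarrow> (\<Sum>i. d i)"
    using tannerys_theorem[of f d sequentially "\<lambda>i. C * (\<bar>d i\<bar> * \<rho> ^ i)"] lim summable_mult[OF d] by auto
  moreover have "(\<Sum>i. f i n) = (\<Sum>i\<le>n. d i * h (n - i)) / h n" for n
  proof -
    have "(\<Sum>i. f i n) = (\<Sum>i\<le>n. f i n)" by (rule suminf_finite) (auto simp: f_def)
    thus ?thesis by (simp add: f_def sum_divide_distrib)
  qed
  ultimately show ?thesis by simp
qed

context exp_singular
begin

text \<open>Suppressing the first \<open>k\<close> weights multiplies the generating function by
  \<open>exp (- (\<Sum>j\<in>{1..k}. \<theta> j / j * z ^ j))\<close>. This factor is entire, so
  \<open>convolution_ratio_tendsto\<close> applies, and the limit is its value at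
  \<open>z = 1\<close>.\<close>

lemma truncated_ratio_tendsto:
  "(\<lambda>n. exp_coeff (\<lambda>j. if j \<le> k then 0 else \<theta> j) n / h n) \<longlonglongrightarrow> exp (- (\<Sum>j\<in>{1..k}. \<theta> j / real j))"
proof -
  define \<eta> where "\<eta> = (\<lambda>j. if j \<le> k then - \<theta> j else 0)"
  define d where "d = exp_coeff \<eta>"
  have fin: "unit_disc_summable (\<lambda>j. f (Suc j))" if "\<And>j. j > k \<Longrightarrow> f j = 0" for f :: "nat \<Rightarrow> real"
    unfolding unit_disc_summable_def
    by (intro allI impI summable_finite[of "{..k}"]) (use that in auto)
  \<comment> \<open>\<open>exp_coeff_sums_real\<close> is stated on the unit disc, but \<open>\<Sum>n. d n * x ^ n\<close> is needed beyond it\<close>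
  define \<eta>2 where "\<eta>2 = (\<lambda>j. \<eta> j * 2 ^ j)"
  have u2: "unit_disc_summable (\<lambda>j. \<eta>2 (Suc j))" by (rule fin) (simp add: \<eta>2_def \<eta>_def)
  have c2: "exp_coeff \<eta>2 n = 2 ^ n * d n" for n unfolding \<eta>2_def d_def by (rule exp_coeff_scale)
  have "unit_disc_summable (exp_coeff \<eta>2)"
    by (rule unit_disc_summableI') (use exp_coeff_sums_real[OF u2] in \<open>auto simp: sums_iff\<close>)
  \<comment> \<open>Radius \<open>3 / 4\<close> for the rescaled coefficients is radius
    \<open>3 / 2\<close>, beyond the unit disc, for \<open>d\<close>.\<close>
  hence "summable (\<lambda>n. \<bar>exp_coeff \<eta>2 n\<bar> * (3 / 4) ^ n)" by (simp add: unit_disc_summable_def)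
  moreover have "\<bar>exp_coeff \<eta>2 n\<bar> * (3 / 4) ^ n = \<bar>d n\<bar> * (3 / 2) ^ n" for n
  proof -
    have "(2::real) ^ n * (3 / 4) ^ n = (3 / 2) ^ n" by (simp add: power_mult_distrib[symmetric])
    thus ?thesis by (simp add: c2 abs_mult mult_ac)
  qed
  ultimately have sd: "summable (\<lambda>n. \<bar>d n\<bar> * (3 / 2) ^ n)" by simp
  have "(\<lambda>n. exp_coeff \<eta>2 n * (1 / 2) ^ n) sums exp (\<Sum>j. \<eta>2 (Suc j) / real (Suc j) * (1 / 2) ^ Suc j)"
    by (rule exp_coeff_sums_real[OF u2]) simp
  moreover have "exp_coeff \<eta>2 n * (1 / 2) ^ n = d n" for n by (simp add: c2 power_divide)
  moreover have "(\<Sum>j. \<eta>2 (Suc j) / real (Suc j) * (1 / 2) ^ Suc j) = - (\<Sum>j\<in>{1..k}. \<theta> j / real j)"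
  proof -
    have "\<eta>2 (Suc j) / real (Suc j) * (1 / 2) ^ Suc j = \<eta> (Suc j) / real (Suc j)" for j
    proof -
      have "(2::real) ^ Suc j * (1 / 2) ^ Suc j = 1" by (simp only: power_mult_distrib[symmetric]) simp
      thus ?thesis unfolding \<eta>2_def by (metis (no_types, lifting) mult.assoc mult.right_neutral times_divide_eq_left)
    qed
    hence "(\<Sum>j. \<eta>2 (Suc j) / real (Suc j) * (1 / 2) ^ Suc j) = (\<Sum>j. \<eta> (Suc j) / real (Suc j))" by simp
    also have "\<dots> = (\<Sum>j<k. \<eta> (Suc j) / real (Suc j))" by (rule suminf_finite) (auto simp: \<eta>_def)
    also have "\<dots> = (\<Sum>j\<in>{1..k}. - (\<theta> j / real j))"
      by (rule sum.reindex_bij_witness[of _ "\<lambda>j. j - 1" Suc]) (auto simp: \<eta>_def)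
    finally show ?thesis by (simp add: sum_negf)
  qed
  ultimately have ds: "(\<Sum>n. d n) = exp (- (\<Sum>j\<in>{1..k}. \<theta> j / real j))" by (simp add: sums_iff)
  have eq: "exp_coeff (\<lambda>j. if j \<le> k then 0 else \<theta> j) n = (\<Sum>i\<le>n. d i * h (n - i))" for n
  proof -
    have "(\<lambda>j. if j \<le> k then 0 else \<theta> j) = (\<lambda>j. \<eta> j + \<theta> j)" by (auto simp: \<eta>_def)
    thus ?thesis
      unfolding d_def using exp_coeff_add[of \<eta> \<theta> n] fin[of \<eta>] usum by (simp add: \<eta>_def)
  qed
  show ?thesis
    unfolding eq ds[symmetric] by (rule convolution_ratio_tendsto[OF h_pos h_ratio _ sd]) simp
qed

lemma cycle_counts_tendsto:
  "(\<lambda>n. measure_pmf.prob (Pn \<theta> n) {\<sigma>. \<forall>j\<in>{1..k}. cycle_count n \<sigma> j = r j})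
    \<longlonglongrightarrow> (\<Prod>j\<in>{1..k}. pmf (poisson_pmf (\<theta> j / real j)) (r j))"
proof -
  define s where "s = (\<Sum>j\<in>{1..k}. j * r j)"
  let ?e = "exp_coeff (\<lambda>j. if j \<le> k then 0 else \<theta> j)"
  have rat: "(\<lambda>n. h n / h (n + s)) \<longlonglongrightarrow> 1" by (rule shift_ratio_tendsto[OF h_pos h_ratio])
  \<comment> \<open>The limit is taken along \<open>n + s\<close>: after placing the prescribed
    short cycles the truncated coefficient then has index \<open>n\<close>, and the two ratios
    separate.\<close>
  have "(\<lambda>n. poisson_coeff \<theta> k r * (?e n / h n) * (h n / h (n + s))) \<longlonglongrightarrow>
      poisson_coeff \<theta> k r * exp (- (\<Sum>j\<in>{1..k}. \<theta> j / real j)) * 1"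
    by (intro tendsto_intros truncated_ratio_tendsto rat)
  also have "poisson_coeff \<theta> k r * exp (- (\<Sum>j\<in>{1..k}. \<theta> j / real j)) * 1 =
    (\<Prod>j\<in>{1..k}. pmf (poisson_pmf (\<theta> j / real j)) (r j))"
  proof -
    \<comment> \<open>\<open>pmf_poisson\<close> asks for a positive rate; monotonicity propagates
      positivity from \<open>\<theta> 1\<close>.\<close>
    have p: "\<theta> j > 0" if "j \<ge> 1" for j
      using that
    proof (induction j rule: dec_induct)
      case (step j)
      thus ?case using incr[of j] by simp
    qed (use first_pos in simp)
    have "(\<Prod>j\<in>{1..k}. pmf (poisson_pmf (\<theta> j / real j)) (r j)) =
      (\<Prod>j\<in>{1..k}. (\<theta> j / real j) ^ r j / fact (r j) * exp (- (\<theta> j / real j)))"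
      by (rule prod.cong[OF refl], subst pmf_poisson) (use p in auto)
    also have "\<dots> = poisson_coeff \<theta> k r * exp (- (\<Sum>j\<in>{1..k}. \<theta> j / real j))"
      unfolding poisson_coeff_def prod.distrib by (simp add: exp_sum sum_negf[symmetric])
    finally show ?thesis by simp
  qed
  finally have lim: "(\<lambda>n. poisson_coeff \<theta> k r * (?e n / h n) * (h n / h (n + s))) \<longlonglongrightarrow>
    (\<Prod>j\<in>{1..k}. pmf (poisson_pmf (\<theta> j / real j)) (r j))" .
  have "eventually (\<lambda>n. poisson_coeff \<theta> k r * (?e n / h n) * (h n / h (n + s)) =
    measure_pmf.prob (Pn \<theta> (n + s)) {\<sigma>. \<forall>j\<in>{1..k}. cycle_count (n + s) \<sigma> j = r j}) sequentially"
    using eventually_ge_at_top[of k]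
  proof eventually_elim
    case (elim n)
    have "measure_pmf.prob (Pn \<theta> (n + s)) {\<sigma>. \<forall>j\<in>{1..k}. cycle_count (n + s) \<sigma> j = r j} =
      poisson_coeff \<theta> k r * ?e (n + s - (\<Sum>j\<in>{1..k}. j * r j)) / h (n + s)"
      using nonneg first_pos by (rule prob_cycle_counts) (use elim in \<open>auto simp: s_def\<close>)
    thus ?case using h_pos[of n] by (simp add: s_def)
  qed
  from Lim_transform_eventually[OF lim this] show ?thesis
    by (rule LIMSEQ_offset[where k = s])
qed

end

section \<open>Specialisation to the given parameters\<close>

lemma exp_singular_theta:
  fixes \<gamma> :: real
  assumes \<gamma>: "0 < \<gamma>" "\<gamma> < 1"
  defines "b \<equiv> \<gamma> / (1 - \<gamma>)" and "a \<equiv> (1 - \<gamma>) * \<gamma> powr (\<gamma> / (1 - \<gamma>))"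
  obtains A c where "exp_singular (theta \<gamma>) A a b c"
proof -
  define c where "c = b / 2 + 1"
  define A where "A = sqrt (2 * pi * (b + 1)) * (a * b) powr (- (1 / (b + 1)) * (1 / 2 - c))"
  have pos: "a > 0" "b > 0" using \<gamma> by (auto simp: a_def b_def)
  hence pos': "A > 0" "c \<ge> 1" by (auto simp: A_def c_def)
  obtain g where g: "\<And>n. g n \<ge> 0" "\<And>n. g n \<le> g (Suc n)" "g 0 > 0"
    "\<And>x. \<bar>x\<bar> < 1 \<Longrightarrow> (\<lambda>n. g n * x ^ n) sums (A * (1 - x) powr (- c) * exp (a * (1 - x) powr (- b)))"
    using exp_singular_series[OF pos'(1) pos pos'(2)] by blast
  have "genfun \<gamma> = (\<lambda>x. A * (1 - x) powr (- c) * exp (a * (1 - x) powr (- b)))"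
    by (simp add: genfun_def Let_def A_def a_def b_def c_def fun_eq_iff)
  hence "(deriv ^^ n) (genfun \<gamma>) 0 = fact n * g n" for n
    using g(4) by (intro powser_higher_deriv[of 1]) auto
  \<comment> \<open>The shift reflects that \<open>theta\<close> at index \<open>n\<close> is the
    Taylor coefficient of order \<open>n - 1\<close>.\<close>
  hence th: "theta \<gamma> (Suc n) = g n" for n by (simp add: theta_def taylor_coeff_def)
  have "exp_singular (theta \<gamma>) A a b c"
  proof
    fix j :: nat assume "j \<ge> 1"
    then obtain m where "j = Suc m" by (cases j) auto
    thus "theta \<gamma> j \<ge> 0" "theta \<gamma> j \<le> theta \<gamma> (Suc j)" using g th by auto
  next
    show "theta \<gamma> 1 > 0" using g(3) th[of 0] by simp
  next
    fix x :: real assume "\<bar>x\<bar> < 1"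
    thus "(\<lambda>n. theta \<gamma> (Suc n) * x ^ n) sums (A * (1 - x) powr (- c) * exp (a * (1 - x) powr (- b)))"
      using g(4) by (simp add: th)
  qed (use pos pos' in auto)
  thus thesis by (rule that)
qed

section \<open>Convergence in distribution to a constant\<close>

lemma cdf_distr_pmf:
  "cdf (distr (measure_pmf M) borel f) x = measure_pmf.prob M {s. f s \<le> x}"
  by (simp add: cdf_def measure_distr vimage_def)

lemma weak_conv_m_return:
  fixes X :: "nat \<Rightarrow> 'a \<Rightarrow> real"
  assumes lower: "\<And>x. x < c \<Longrightarrow> (\<lambda>n. measure_pmf.prob (M n) {s. X n s \<le> x}) \<longlonglongrightarrow> 0"
    and upper: "\<And>x. x > c \<Longrightarrow> (\<lambda>n. measure_pmf.prob (M n) {s. X n s > x}) \<longlonglongrightarrow> 0"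
  shows "weak_conv_m (\<lambda>n. distr (measure_pmf (M n)) borel (X n)) (return borel c)"
  unfolding weak_conv_m_def weak_conv_def cdf_distr_pmf
proof (intro allI impI)
  fix x assume cont: "isCont (cdf (return borel c)) x"
  have cdf: "cdf (return borel c) x = (if c \<le> x then 1 else 0)" for x
    by (simp add: cdf_def measure_return indicator_def)
  consider "x < c" | "x > c" | "x = c" by linarith
  thus "(\<lambda>n. measure_pmf.prob (M n) {s. X n s \<le> x}) \<longlonglongrightarrow> cdf (return borel c) x"
  proof cases
    case 1
    thus ?thesis using lower by (simp add: cdf)
  next
    case 2
    have "measure_pmf.prob (M n) {s. X n s \<le> x} = 1 - measure_pmf.prob (M n) {s. X n s > x}" for n
    proof -
      have "{s. X n s \<le> x} = UNIV - {s. X n s > x}" by auto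
      thus ?thesis using measure_pmf.prob_compl[of "{s. X n s > x}" "M n"] by simp
    qed
    moreover have "(\<lambda>n. 1 - measure_pmf.prob (M n) {s. X n s > x}) \<longlonglongrightarrow> 1 - 0"
      by (intro tendsto_intros upper 2)
    ultimately show ?thesis using 2 by (simp add: cdf)
  next
    \<comment> \<open>The limiting distribution function jumps at \<open>c\<close>, so
      \<open>c\<close> is not a continuity point and this case is contradictory.\<close>
    case 3
    have "(cdf (return borel c) \<longlongrightarrow> 1) (at_left c)"
      using cont unfolding 3 continuous_at by (metis cdf filterlim_at_split order_refl)
    moreover have "(cdf (return borel c) \<longlongrightarrow> 0) (at_left c)"
      by (rule tendsto_eventually) (auto simp: cdf eventually_at_filter)
    ultimately have "(1::real) = 0" by (rule tendsto_unique[rotated]) simp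
    thus ?thesis by simp
  qed
qed

text \<open>As the counts are integers, weak convergence of the whole sequence of counts amounts to
  convergence of the probabilities of all values of its first \<open>k\<close> members, for each
  \<open>k\<close>; the product form of the limit expresses independence.\<close>

theorem theorem4p2:
  fixes \<gamma> :: real
  assumes "0 < \<gamma>" and "\<gamma> < 1"
  shows "weak_conv_m
           (\<lambda>n. distr (measure_pmf (Pn (theta \<gamma>) n)) borel
                  (\<lambda>\<sigma>. real (L1 \<sigma>) / (ln (real n)) powr (1 / \<gamma>)))
           (return borel ((1 - \<gamma>) powr (- 1 / \<gamma>)))
         \<and> (\<forall>(k::nat) (r::nat \<Rightarrow> nat).
           (\<lambda>n. measure_pmf.prob (Pn (theta \<gamma>) n)
                  {\<sigma>. \<forall>j\<in>{1..k}. cycle_count n \<sigma> j = r j})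
           \<longlonglongrightarrow> (\<Prod>j\<in>{1..k}. pmf (poisson_pmf (theta \<gamma> j / real j)) (r j)))"
proof -
  define b where "b = \<gamma> / (1 - \<gamma>)"
  define a where "a = (1 - \<gamma>) * \<gamma> powr (\<gamma> / (1 - \<gamma>))"
  obtain A c where "exp_singular (theta \<gamma>) A a b c"
    using exp_singular_theta[OF assms] unfolding a_def b_def by blast
  then interpret exp_singular "theta \<gamma>" A a b c .
  obtain t :: "nat \<Rightarrow> real" where t: "\<forall>n\<ge>1. t n > 1" "\<forall>n\<ge>1. \<Lambda> (t n) = ln (real n)"
    "filterlim t at_top sequentially" using saddle_point_sequence by blast
  define c0 where "c0 = (1 - \<gamma>) powr (- 1 / \<gamma>)"
  have c0: "c0 > 0" using assms by (simp add: c0_def)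
  define J where "J = (\<lambda>n. a * b * t n powr (b + 1))"
  \<comment> \<open>Since \<open>b / \<gamma> = b + 1\<close> and
    \<open>\<Lambda> (t n) = ln n\<close>, this is the quotient of
    \<open>(ln n) powr (1 / \<gamma>)\<close> by the centre \<open>J n\<close>.\<close>
  have "(\<lambda>n. (\<Lambda> (t n) / t n powr b) powr (1 / \<gamma>) / (a * b)) \<longlonglongrightarrow> a powr (1 / \<gamma>) / (a * b)"
    using filterlim_compose[OF \<Lambda>_equiv t(3)] pos by (intro tendsto_intros) auto
  \<comment> \<open>Writing \<open>1 / \<gamma> = 1 + 1 / b\<close> cancels \<open>a\<close>; the
    rest is \<open>(1 - \<gamma>) powr (1 / b) * \<gamma> / b\<close> with
    \<open>\<gamma> / b = 1 - \<gamma>\<close>.\<close>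
  also have "a powr (1 / \<gamma>) / (a * b) = 1 / c0"
  proof -
    have g: "1 / \<gamma> = 1 + 1 / b" using assms by (simp add: b_def field_simps)
    have "a powr (1 / b) = (1 - \<gamma>) powr (1 / b) * \<gamma>"
      using assms pos unfolding a_def b_def[symmetric] by (simp add: powr_mult powr_powr)
    hence "a powr (1 / \<gamma>) / (a * b) = (1 - \<gamma>) powr (1 / b) * \<gamma> / b"
      unfolding g powr_add using pos by simp
    also have "\<dots> = (1 - \<gamma>) powr (1 / b) * (1 - \<gamma>) powr 1"
      using assms by (simp add: b_def)
    also have "\<dots> = (1 - \<gamma>) powr (1 / \<gamma>)" unfolding g powr_add[symmetric] by (simp add: add.commute)
    finally show ?thesis by (simp add: c0_def powr_minus_divide)
  qed
  finally have "(\<lambda>n. (\<Lambda> (t n) / t n powr b) powr (1 / \<gamma>) / (a * b)) \<longlonglongrightarrow> 1 / c0" .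
  moreover have "eventually (\<lambda>n. (\<Lambda> (t n) / t n powr b) powr (1 / \<gamma>) / (a * b) = ln (real n) powr (1 / \<gamma>) / J n) sequentially"
    using eventually_ge_at_top[of 1]
  proof eventually_elim
    case (elim n)
    have "b * (1 / \<gamma>) = b + 1" using assms by (simp add: b_def field_simps)
    hence "(t n powr b) powr (1 / \<gamma>) = t n powr (b + 1)" by (simp only: powr_powr)
    thus ?case using t(2) elim by (simp add: powr_divide J_def)
  qed
  ultimately have R: "(\<lambda>n. ln (real n) powr (1 / \<gamma>) / J n) \<longlonglongrightarrow> 1 / c0"
    by (rule Lim_transform_eventually)
  have Jpos: "eventually (\<lambda>n. J n > 0 \<and> ln (real n) powr (1 / \<gamma>) > 0) sequentially"
    using eventually_ge_at_top[of 2]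
  proof eventually_elim
    case (elim n)
    have "t n > 1" using t(1) elim by simp
    thus ?case using elim pos by (simp add: J_def)
  qed
  have xR: "(\<lambda>n. x * (ln (real n) powr (1 / \<gamma>) / J n)) \<longlonglongrightarrow> x / c0" for x
    using tendsto_mult[OF tendsto_const R, of x] by simp
  have lower: "(\<lambda>n. measure_pmf.prob (Pn (theta \<gamma>) n) {\<sigma>. real (L1 \<sigma>) / ln (real n) powr (1 / \<gamma>) \<le> x}) \<longlonglongrightarrow> 0"
    if x: "x < c0" for x
  proof -
    have "x / c0 < 1" using x c0 by simp
    \<comment> \<open>The centre \<open>J n\<close> agrees with
      \<open>c0 * (ln n) powr (1 / \<gamma>)\<close> only asymptotically; a threshold strictly
      inside the gap absorbs the error.\<close>
    then obtain Y where Y: "x / c0 < Y" "Y < 1" using dense by blast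
    have "eventually (\<lambda>n. x * (ln (real n) powr (1 / \<gamma>) / J n) < Y) sequentially"
      by (rule order_tendstoD(2)[OF xR Y(1)])
    hence "eventually (\<lambda>n. \<forall>j\<in>{j. real j / ln (real n) powr (1 / \<gamma>) \<le> x}. real j \<le> Y * (a * b * t n powr (b + 1))) sequentially"
      using Jpos
    proof eventually_elim
      case (elim n)
      show ?case
      proof
        fix j assume "j \<in> {j. real j / ln (real n) powr (1 / \<gamma>) \<le> x}"
        hence "real j \<le> x * ln (real n) powr (1 / \<gamma>)" using elim(2) by (simp add: pos_divide_le_eq)
        also have "\<dots> \<le> Y * J n" using elim by (simp add: pos_divide_less_eq less_imp_le)
        finally show "real j \<le> Y * (a * b * t n powr (b + 1))" by (simp add: J_def)
      qed
    qed
    hence "(\<lambda>n. measure_pmf.prob (Pn (theta \<gamma>) n) {\<sigma>. L1 \<sigma> \<in> {j. real j / ln (real n) powr (1 / \<gamma>) \<le> x}}) \<longlonglongrightarrow> 0"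
      using Y by (intro prob_L1_tail[OF t, of Y]) auto
    thus ?thesis by simp
  qed
  have upper: "(\<lambda>n. measure_pmf.prob (Pn (theta \<gamma>) n) {\<sigma>. real (L1 \<sigma>) / ln (real n) powr (1 / \<gamma>) > x}) \<longlonglongrightarrow> 0"
    if x: "x > c0" for x
  proof -
    have "1 < x / c0" using x c0 by simp
    then obtain Y where Y: "1 < Y" "Y < x / c0" using dense by blast
    have "eventually (\<lambda>n. Y < x * (ln (real n) powr (1 / \<gamma>) / J n)) sequentially"
      by (rule order_tendstoD(1)[OF xR Y(2)])
    hence "eventually (\<lambda>n. \<forall>j\<in>{j. real j / ln (real n) powr (1 / \<gamma>) > x}. Y * (a * b * t n powr (b + 1)) \<le> real j) sequentially"
      using Jpos
    proof eventually_elim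
      case (elim n)
      show ?case
      proof
        fix j assume "j \<in> {j. real j / ln (real n) powr (1 / \<gamma>) > x}"
        hence "x * ln (real n) powr (1 / \<gamma>) \<le> real j" using elim(2) by (simp add: pos_less_divide_eq less_imp_le)
        moreover have "Y * J n \<le> x * ln (real n) powr (1 / \<gamma>)" using elim by (simp add: pos_less_divide_eq less_imp_le)
        ultimately show "Y * (a * b * t n powr (b + 1)) \<le> real j" by (simp add: J_def)
      qed
    qed
    hence "(\<lambda>n. measure_pmf.prob (Pn (theta \<gamma>) n) {\<sigma>. L1 \<sigma> \<in> {j. real j / ln (real n) powr (1 / \<gamma>) > x}}) \<longlonglongrightarrow> 0"
      using Y by (intro prob_L1_tail[OF t, of Y]) auto
    thus ?thesis by simp
  qed
  have "weak_conv_m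
     (\<lambda>n. distr (measure_pmf (Pn (theta \<gamma>) n)) borel (\<lambda>\<sigma>. real (L1 \<sigma>) / (ln (real n)) powr (1 / \<gamma>)))
     (return borel c0)"
    by (rule weak_conv_m_return[OF lower upper])
  thus ?thesis using cycle_counts_tendsto by (simp add: c0_def)
qed

end
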